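(* Let $d,n,m$ be positive integers. For any $P_1,\ldots,P_m,Q \in M_n(\mathbb{R}[x_1,\ldots,x_d])$ the following are equivalent: (1) For every $a \in \mathbb{R}^d$ and every (column vector) $\mathbf{v} \in \mathbb{R}^n$ such that $P_1(a)\mathbf{v}=\ldots=P_m(a)\mathbf{v}=0$, we have $Q(a)\mathbf{v}=0$. (2) $Q$ belongs to the smallest real left ideal of $M_n(\mathbb{R}[x_1,\ldots,x_d])$ that contains $P_1,\ldots,P_m$.
   Context: The ring $\mathbb{R}[x_1,\ldots,x_d]$ carries the trivial involution, and for a ring with involution $A$ the ring $M_n(A)$ carries the conjugated transpose involution $[a_{i,j}]^\ast=[a_{j,i}^\ast]$; so here the involution of $M_n(\mathbb{R}[x_1,\ldots,x_d])$ is the transpose. A left ideal $I$ of a ring with involution $B$ is called real if for every $k$ and all $b_1,\ldots,b_k \in B$ such that $b_1^\ast b_1+\ldots+b_k^\ast b_k \in I$ we have $b_1,\ldots,b_k \in I$. An intersection of real left ideals is a real left ideal, so every subset of $B$ is contained in a smallest real left ideal. *)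

theory Defs
  imports
    Complex_Main
    "HOL-Library.Poly_Mapping"
    "HOL-Algebra.Ideal"
    "Jordan_Normal_Form.Matrix"
begin

section \<open>Real left ideals in rings with involution\<close>

locale involution_ring = ring R for R (structure) +
  fixes star :: "'a \<Rightarrow> 'a"
  assumes star_closed: "x \<in> carrier R \<Longrightarrow> star x \<in> carrier R"
    and star_add: "\<lbrakk>x \<in> carrier R; y \<in> carrier R\<rbrakk> \<Longrightarrow> star (x \<oplus> y) = star x \<oplus> star y"
    and star_mult: "\<lbrakk>x \<in> carrier R; y \<in> carrier R\<rbrakk> \<Longrightarrow> star (x \<otimes> y) = star y \<otimes> star x"
    and star_star: "x \<in> carrier R \<Longrightarrow> star (star x) = x"

locale left_ideal = additive_subgroup I R + ring R for I and R (structure) +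
  assumes I_l_closed: "\<lbrakk>a \<in> I; x \<in> carrier R\<rbrakk> \<Longrightarrow> x \<otimes> a \<in> I"

locale real_left_ideal = left_ideal I R + involution_ring R star
  for I and R (structure) and star +
  assumes real:
    "\<lbrakk>\<And>i. i \<in> {1..k::nat} \<Longrightarrow> b i \<in> carrier R;
      (\<Oplus>i\<in>{1..k}. star (b i) \<otimes> b i) \<in> I; i \<in> {1..k}\<rbrakk> \<Longrightarrow> b i \<in> I"

definition smallest_real_left_ideal ::
    "('a, 'b) ring_scheme \<Rightarrow> ('a \<Rightarrow> 'a) \<Rightarrow> 'a set \<Rightarrow> 'a set"
  where "smallest_real_left_ideal R star S = \<Inter>{I. real_left_ideal I R star \<and> S \<subseteq> I}"

lemma (in involution_ring) real_left_ideal_carrier: "real_left_ideal (carrier R) R star"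
  by unfold_locales auto

lemma (in involution_ring) real_left_ideal_smallest:
  assumes "S \<subseteq> carrier R"
  shows "real_left_ideal (smallest_real_left_ideal R star S) R star"
proof -
  let ?F = "{I. real_left_ideal I R star \<and> S \<subseteq> I}"
  have car: "carrier R \<in> ?F"
    using assms real_left_ideal_carrier by simp
  have F: "additive_subgroup I R" "left_ideal I R" "real_left_ideal I R star" if "I \<in> ?F" for I
    using that by (auto simp: real_left_ideal_def left_ideal_def)
  have "additive_subgroup (\<Inter>?F) R"
  proof (intro additive_subgroup.intro subgroup.intro)
    show "\<Inter>?F \<subseteq> carrier (add_monoid R)"
      using car by auto
  next
    fix x y assume xy: "x \<in> \<Inter>?F" "y \<in> \<Inter>?F"
    show "x \<otimes>\<^bsub>add_monoid R\<^esub> y \<in> \<Inter>?F"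
    proof
      fix I assume I: "I \<in> ?F"
      show "x \<otimes>\<^bsub>add_monoid R\<^esub> y \<in> I"
        using additive_subgroup.a_closed[OF F(1)[OF I]] xy I by simp
    qed
  next
    show "\<one>\<^bsub>add_monoid R\<^esub> \<in> \<Inter>?F"
      using additive_subgroup.zero_closed[OF F(1)] by auto
  next
    fix x assume x: "x \<in> \<Inter>?F"
    show "inv\<^bsub>add_monoid R\<^esub> x \<in> \<Inter>?F"
    proof
      fix I assume I: "I \<in> ?F"
      show "inv\<^bsub>add_monoid R\<^esub> x \<in> I"
        using subgroup.m_inv_closed[OF additive_subgroup.a_subgroup[OF F(1)[OF I]]] x I by blast
    qed
  qed
  moreover have "left_ideal_axioms (\<Inter>?F) R"
    using F(2) by (auto simp: left_ideal_axioms_def intro: left_ideal.I_l_closed)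
  moreover have "real_left_ideal_axioms (\<Inter>?F) R star"
  proof
    fix k :: nat and b i
    assume b: "\<And>i. i \<in> {1..k} \<Longrightarrow> b i \<in> carrier R"
      and s: "(\<Oplus>i\<in>{1..k}. star (b i) \<otimes> b i) \<in> \<Inter>?F" and i: "i \<in> {1..k}"
    show "b i \<in> \<Inter>?F"
    proof
      fix I assume I: "I \<in> ?F"
      show "b i \<in> I"
        using real_left_ideal.real[OF F(3)[OF I], of k b i] b s i I by blast
    qed
  qed
  ultimately show ?thesis
    unfolding smallest_real_left_ideal_def real_left_ideal_def left_ideal_def
    using ring_axioms involution_ring_axioms by blast
qed


section \<open>Real polynomials in \<open>d\<close> variables\<close>

text \<open>
  The variables are indexed by a finite type \<open>'d\<close>, so \<open>d = CARD('d)\<close> and points of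
  \<open>d\<close>-dimensional real space are functions \<open>'d \<Rightarrow> real\<close>.
  An exponent vector is an element of \<open>'d \<Rightarrow>\<^sub>0 nat\<close>, and the product
  of \<^typ>\<open>('d \<Rightarrow>\<^sub>0 nat) \<Rightarrow>\<^sub>0 real\<close> is the convolution product.
\<close>

type_synonym 'd rpoly = "('d \<Rightarrow>\<^sub>0 nat) \<Rightarrow>\<^sub>0 real"

definition eval_rpoly :: "('d::finite \<Rightarrow> real) \<Rightarrow> 'd rpoly \<Rightarrow> real"
  where "eval_rpoly a p =
    (\<Sum>e\<in>Poly_Mapping.keys p. Poly_Mapping.lookup p e * (\<Prod>i\<in>UNIV. a i ^ Poly_Mapping.lookup e i))"

lemma eval_rpoly_superset:
  assumes "finite S" "Poly_Mapping.keys p \<subseteq> S"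
  shows "eval_rpoly a p =
    (\<Sum>e\<in>S. Poly_Mapping.lookup p e * (\<Prod>i\<in>UNIV. a i ^ Poly_Mapping.lookup e i))"
  unfolding eval_rpoly_def using assms
  by (intro sum.mono_neutral_left) (auto simp: in_keys_iff)

lemma eval_rpoly_zero [simp]: "eval_rpoly a 0 = 0"
  by (simp add: eval_rpoly_def)

lemma eval_rpoly_single:
  "eval_rpoly a (Poly_Mapping.single e c) = c * (\<Prod>i\<in>UNIV. a i ^ Poly_Mapping.lookup e i)"
  by (subst eval_rpoly_superset[of "{e}"]) auto

lemma eval_rpoly_const: "eval_rpoly a (Poly_Mapping.single 0 c) = c"
  by (simp add: eval_rpoly_single)

lemma eval_rpoly_one [simp]: "eval_rpoly a 1 = 1"
  using eval_rpoly_const[of a 1] by simp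

lemma eval_rpoly_var:
  "eval_rpoly a (Poly_Mapping.single (Poly_Mapping.single i 1) 1) = a i"
proof -
  have "(\<Prod>j\<in>UNIV. a j ^ Poly_Mapping.lookup (Poly_Mapping.single i 1) j)
      = (\<Prod>j\<in>UNIV. if j = i then a j else 1)"
    by (intro prod.cong) (auto simp: lookup_single when_def)
  then show ?thesis
    by (simp add: eval_rpoly_single)
qed

lemma eval_rpoly_add: "eval_rpoly a (p + q) = eval_rpoly a p + eval_rpoly a q"
proof -
  let ?S = "Poly_Mapping.keys p \<union> Poly_Mapping.keys q"
  have "Poly_Mapping.keys (p + q) \<subseteq> ?S"
    by (rule keys_add)
  then show ?thesis
    by (simp add: eval_rpoly_superset[of ?S] lookup_add sum.distrib distrib_right)
qed

lemma rpoly_induct [case_names zero add]: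
  assumes "P 0" "\<And>e c p. P p \<Longrightarrow> P (Poly_Mapping.single e c + p)"
  shows "P (p :: 'd rpoly)"
proof (induction p rule: update_induct)
  case const
  then show ?case using assms(1) by simp
next
  case (update p e c)
  have "Poly_Mapping.update e c p = Poly_Mapping.single e c + p"
    using update(1)
    by (intro poly_mapping_eqI) (auto simp: lookup_update lookup_add lookup_single in_keys_iff when_def)
  then show ?case using assms(2) update by simp
qed

lemma eval_rpoly_mult: "eval_rpoly a (p * q) = eval_rpoly a p * eval_rpoly a q"
proof (induction p rule: rpoly_induct)
  case zero
  then show ?case by simp
next
  case (add e c p)
  have "eval_rpoly a (Poly_Mapping.single e c * q)
      = eval_rpoly a (Poly_Mapping.single e c) * eval_rpoly a q"
    by (induction q rule: rpoly_induct)
       (simp_all add: distrib_left eval_rpoly_add mult_single eval_rpoly_single lookup_add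
          power_add prod.distrib)
  then show ?case
    using add by (simp add: distrib_right eval_rpoly_add)
qed


section \<open>Matrices of polynomials\<close>

abbreviation eval_mat :: "('d::finite \<Rightarrow> real) \<Rightarrow> 'd rpoly mat \<Rightarrow> real mat"
  where "eval_mat a \<equiv> map_mat (eval_rpoly a)"

abbreviation rpoly_mat_ring :: "nat \<Rightarrow> 'd::finite rpoly mat ring"
  where "rpoly_mat_ring n \<equiv> ring_mat TYPE('d rpoly) n ()"

lemma involution_ring_mat:
  "involution_ring (ring_mat TYPE('a::comm_ring_1) n b) transpose_mat"
proof -
  interpret ring "ring_mat TYPE('a) n b"
    by (rule ring_mat)
  show ?thesis
    by unfold_locales (auto simp: ring_mat_simps intro: transpose_add transpose_mult)
qed

end

theory Submission
  imports
    Defs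
    "HOL-Algebra.Algebraic_Closure_Type"
    "Jordan_Normal_Form.Char_Poly"
begin

text \<open>
  The implication from (2) to (1) holds because the matrices annihilating a fixed vector at a fixed
  point form a real left ideal. For the converse, left ideals of matrices are turned into submodules
  of \<open>A\<^sup>n\<close>, where \<open>A\<close> is the polynomial ring. Let \<open>q\<close> be a row of \<open>Q\<close> outside the submodule, which is
  enlarged to a real submodule \<open>M\<close> maximal without \<open>q\<close>. By maximality \<open>p = {c. c q \<in> M}\<close> is a real
  prime ideal. If some \<open>r = s q - \<nu>\<close> with \<open>\<nu> \<in> M\<close> has all its entries in \<open>p\<close>, then all rows of
  \<open>r\<^sup>T r\<close> lie in \<open>M\<close>, so \<open>r \<in> M\<close> and \<open>s \<in> p\<close>. Hence linear algebra over the fraction field of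
  \<open>A / p\<close> gives \<open>w \<in> A\<^sup>n\<close> with \<open>\<nu> w \<in> p\<close> for all \<open>\<nu> \<in> M\<close> but \<open>q w \<notin> p\<close>. By the real Nullstellensatz
  for \<open>p\<close> there is a real point \<open>a\<close> at which the \<open>P\<^sub>i w\<close> vanish but \<open>q w\<close> does not, and \<open>w(a)\<close> is the
  vector sought.

  The real Nullstellensatz is reduced to the Artin-Lang theorem: the fraction field of \<open>A / p\<close> embeds
  into a real closed field, and Cohen-Hoermander elimination of the variables one by one shows that
  finitely many sign conditions satisfied there are also satisfied at a real point.
\<close>

text \<open>No syntax of formulas is set up: quantifier elimination appears only as a comparison of
  two real closed fields. If two ring homomorphisms give equal signs to finitely many coefficients,
  then the two images of a finite family of polynomials have sign tables that correspond along a
  finite order isomorphism between points of the two lines. One field is abstract, the other is the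
  field of real numbers, and the induction over the variables works because the coefficients are
  again polynomials, in fewer variables. It ends with real constants, whose signs every homomorphism
  into an ordered field preserves because positive reals are squares. The real closed field is
  obtained without choosing an ordering first. Inside an algebraic closure a single maximality
  argument, over cones that carry a subfield together with a preordering of it, yields both the
  total order and the intermediate value property. The rows of \<open>r\<^sup>T r\<close> lie in
  \<open>M\<close> because row \<open>j\<close> is
  \<open>r\<^sub>j r = s r\<^sub>j q - r\<^sub>j \<nu>\<close>, and
  \<open>r\<^sub>j q \<in> M\<close> is what \<open>r\<^sub>j \<in> p\<close> means.\<close>

hide_const (open) Module.smult Polynomials.degree up_ring.monom up_ring.coeff

section \<open>Polynomials over real closed fields\<close>

text \<open>The intermediate value property for polynomials characterises the real closed fields
  among the ordered fields. Polynomials enter as coefficient functions, so that the axiom speaks of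
  field operations only.\<close>

class real_closed = linordered_field +
  assumes sum_sign_change:
    "\<lbrakk>a < b; (\<Sum>k\<le>n. f k * a ^ k) < 0; 0 < (\<Sum>k\<le>n. f k * b ^ k)\<rbrakk>
      \<Longrightarrow> \<exists>x. a < x \<and> x < b \<and> (\<Sum>k\<le>n. f k * x ^ k) = 0"

lemma poly_sign_change:
  fixes p :: "'a::real_closed poly"
  shows "\<lbrakk>a < b; poly p a < 0; 0 < poly p b\<rbrakk> \<Longrightarrow> \<exists>x. a < x \<and> x < b \<and> poly p x = 0"
  unfolding poly_altdef by (rule sum_sign_change)

lemma real_closedI:
  assumes "\<And>p (a :: 'a) b. \<lbrakk>a < b; poly p a < 0; 0 < poly p b\<rbrakk>
    \<Longrightarrow> \<exists>x. a < x \<and> x < b \<and> poly p x = 0"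
  shows "OFCLASS('a :: linordered_field, real_closed_class)"
proof
  fix a b :: 'a and n f
  assume *: "a < b" "(\<Sum>k\<le>n. f k * a ^ k) < 0" "0 < (\<Sum>k\<le>n. f k * b ^ k)"
  have "poly (\<Sum>k\<le>n. monom (f k) k) x = (\<Sum>k\<le>n. f k * x ^ k)" for x
    by (simp add: poly_sum poly_monom)
  then show "\<exists>x. a < x \<and> x < b \<and> (\<Sum>k\<le>n. f k * x ^ k) = 0"
    using assms[OF *(1), of "\<Sum>k\<le>n. monom (f k) k"] *(2,3) by simp
qed

instance real :: real_closed
  by (rule real_closedI) (use poly_IVT_pos in blast)

lemma poly_sign_change_mult:
  fixes p :: "'a::real_closed poly"
  assumes "a < b" "poly p a * poly p b < 0"
  shows "\<exists>x. a < x \<and> x < b \<and> poly p x = 0"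
proof (cases "poly p a < 0")
  case True
  then show ?thesis
    using assms by (intro poly_sign_change) (auto simp: mult_less_0_iff)
next
  case False
  then have "poly (-p) a < 0" "0 < poly (-p) b"
    using assms(2) by (auto simp: mult_less_0_iff)
  from poly_sign_change[OF assms(1) this] show ?thesis by simp
qed

lemma poly_sgn_eq_if_no_root:
  fixes p :: "'a::real_closed poly"
  assumes "a \<le> b" "\<And>x. a \<le> x \<Longrightarrow> x \<le> b \<Longrightarrow> poly p x \<noteq> 0"
  shows "sgn (poly p a) = sgn (poly p b)"
proof (rule ccontr)
  assume ne: "sgn (poly p a) \<noteq> sgn (poly p b)"
  then have "a < b" using assms(1) by (cases "a = b") auto
  moreover have "poly p a \<noteq> 0" "poly p b \<noteq> 0" using assms by auto
  ultimately have "poly p a * poly p b < 0"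
    using ne by (auto simp: sgn_if mult_less_0_iff split: if_splits)
  from poly_sign_change_mult[OF \<open>a < b\<close> this] assms(2) show False
    using less_imp_le by blast
qed

text \<open>Splitting off the full multiplicities gives
  \<open>p = (x-a)^(m+1) (x-b)^(k+1) g\<close>, with derivative \<open>(x-a)^m (x-b)^k h\<close>. At
  the two ends \<open>h\<close> equals \<open>(m+1) (a-b) g(a)\<close> and
  \<open>(k+1) (b-a) g(b)\<close>. Since \<open>g\<close> has no root in the closed interval,
  \<open>h\<close> changes sign.\<close>

lemma poly_rolle_consecutive_zeros:
  fixes p :: "'a::real_closed poly"
  assumes ab: "a < b" and p: "p \<noteq> 0" and za: "poly p a = 0" and zb: "poly p b = 0"
    and no: "\<And>x. a < x \<Longrightarrow> x < b \<Longrightarrow> poly p x \<noteq> 0"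
  shows "\<exists>x. a < x \<and> x < b \<and> poly (pderiv p) x = 0"
proof -
  obtain q where q: "p = [:-a, 1:] ^ order a p * q" "\<not> [:-a, 1:] dvd q"
    using order_decomp[OF p] by blast
  have q0: "q \<noteq> 0" using p q(1) by auto
  have qa: "poly q a \<noteq> 0" using q(2) by (simp add: poly_eq_0_iff_dvd)
  obtain g where g: "q = [:-b, 1:] ^ order b q * g" "\<not> [:-b, 1:] dvd g"
    using order_decomp[OF q0] by blast
  have gb: "poly g b \<noteq> 0" using g(2) by (simp add: poly_eq_0_iff_dvd)
  have ga: "poly g a \<noteq> 0" using qa by (subst (asm) g(1)) auto
  have "poly q b = 0"
    using zb ab by (subst (asm) q(1)) auto
  then have "order b q \<noteq> 0" using q0 by (simp add: order_root)
  then obtain k where k: "order b q = Suc k" using not0_implies_Suc by blast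
  have "order a p \<noteq> 0" using p za by (simp add: order_root)
  then obtain m where m: "order a p = Suc m" using not0_implies_Suc by blast
  have pe: "p = [:-a, 1:] ^ Suc m * ([:-b, 1:] ^ Suc k * g)"
    using q(1) g(1) k m by metis
  define h where "h = smult (of_nat (Suc m)) ([:-b, 1:] * g) + smult (of_nat (Suc k)) ([:-a, 1:] * g)
     + [:-a, 1:] * [:-b, 1:] * pderiv g"
  have der: "pderiv (U ^ Suc m * (V ^ Suc k * g)) = U ^ m * V ^ k *
      (smult (of_nat (Suc m)) (V * g) + smult (of_nat (Suc k)) (U * g) + U * V * pderiv g)"
    if "pderiv U = 1" "pderiv V = 1" for U V :: "'a poly"
    unfolding pderiv_mult pderiv_power_Suc that
    by (simp add: algebra_simps del: of_nat_Suc)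
  have dp: "pderiv p = [:-a, 1:] ^ m * [:-b, 1:] ^ k * h"
    unfolding h_def by (subst pe, rule der) (simp_all add: pderiv_pCons)
  have nog: "poly g x \<noteq> 0" if "a \<le> x" "x \<le> b" for x
  proof (cases "x = a \<or> x = b")
    case True
    then show ?thesis using ga gb by blast
  next
    case False
    then have "poly p x \<noteq> 0" using that no[of x] by auto
    then show ?thesis using pe by auto
  qed
  have s: "sgn (poly g a) = sgn (poly g b)"
    using poly_sgn_eq_if_no_root[OF _ nog] ab by simp
  have ha: "poly h a = of_nat (Suc m) * (a - b) * poly g a"
    unfolding h_def by (simp add: algebra_simps)
  have hb: "poly h b = of_nat (Suc k) * (b - a) * poly g b"
    unfolding h_def by (simp add: algebra_simps)
  have gg: "poly g a * poly g b > 0"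
    using s ga gb by (auto simp: sgn_if zero_less_mult_iff split: if_splits)
  have "poly h a * poly h b =
      - ((of_nat (Suc m) * of_nat (Suc k)) * ((b - a) * (b - a)) * (poly g a * poly g b))"
    unfolding ha hb by (simp add: algebra_simps)
  also have "\<dots> < 0"
    using gg ab by (simp only: neg_less_0_iff_less) (rule mult_pos_pos, rule mult_pos_pos, auto simp: zero_less_mult_iff add_pos_nonneg)
  finally obtain x where "a < x" "x < b" "poly h x = 0"
    using poly_sign_change_mult[OF ab] by blast
  then show ?thesis unfolding dp by auto
qed

lemma poly_rolle:
  fixes p :: "'a::real_closed poly"
  assumes ab: "a < b" and eq: "poly p a = poly p b"
  shows "\<exists>x. a < x \<and> x < b \<and> poly (pderiv p) x = 0"
proof -
  define q where "q = p - [:poly p a:]"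
  have dq: "pderiv q = pderiv p" unfolding q_def by (simp add: pderiv_diff pderiv_pCons)
  show ?thesis
  proof (cases "q = 0")
    case True
    then have "pderiv p = 0" using dq by simp
    then show ?thesis using dense[OF ab] by auto
  next
    case False
    \<comment> \<open>The least zero of \<open>q\<close> to the right of \<open>a\<close> is
      consecutive to \<open>a\<close>, which reduces the claim to the previous lemma.\<close>
    define R where "R = {x. poly q x = 0 \<and> a < x \<and> x \<le> b}"
    have finR: "finite R"
      using poly_roots_finite[OF False] by (rule rev_finite_subset) (auto simp: R_def)
    have bR: "b \<in> R" using ab eq by (auto simp: R_def q_def)
    have "Min R \<in> R" using finR bR Min_in by blast
    then have c: "a < Min R" "Min R \<le> b" "poly q (Min R) = 0" by (auto simp: R_def)
    have "poly q x \<noteq> 0" if "a < x" "x < Min R" for x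
    proof
      assume "poly q x = 0"
      then have "x \<in> R" using that c by (auto simp: R_def)
      then show False using Min_le[OF finR] that by fastforce
    qed
    then obtain x where "a < x" "x < Min R" "poly (pderiv q) x = 0"
      using poly_rolle_consecutive_zeros[OF c(1) False _ c(3)] by (auto simp: q_def)
    then show ?thesis using c dq by (intro exI[of _ x]) auto
  qed
qed

lemma poly_mvt:
  fixes p :: "'a::real_closed poly"
  assumes ab: "a < b"
  shows "\<exists>x. a < x \<and> x < b \<and> poly p b - poly p a = (b - a) * poly (pderiv p) x"
proof -
  define c where "c = (poly p b - poly p a) / (b - a)"
  define q where "q = p - [:0, c:]"
  have "poly q a = poly q b"
    using ab by (simp add: q_def c_def field_simps)
  then obtain x where x: "a < x" "x < b" "poly (pderiv q) x = 0"
    using poly_rolle[OF ab] by blast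
  have "poly (pderiv p) x = c"
    using x(3) by (simp add: q_def pderiv_diff pderiv_pCons)
  then show ?thesis using x ab by (intro exI[of _ x]) (simp add: c_def)
qed

text \<open>The positive lower bound, instead of mere positivity, carries the Horner induction: a
  large \<open>x\<close> times such a bound outweighs the next constant term.\<close>

lemma poly_sgn_at_top:
  fixes p :: "'a::linordered_field poly"
  assumes "0 < lead_coeff p"
  shows "\<exists>B. \<forall>x\<ge>B. lead_coeff p \<le> poly p x"
  using assms
proof (induction p rule: pCons_induct)
  case 0
  then show ?case by simp
next
  case (pCons a p)
  show ?case
  proof (cases "p = 0")
    case True
    then show ?thesis by simp
  next
    case False
    then have l: "lead_coeff (pCons a p) = lead_coeff p" by simp
    then obtain B where B: "\<And>x. B \<le> x \<Longrightarrow> lead_coeff p \<le> poly p x" "0 < lead_coeff p"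
      using pCons by auto
    \<comment> \<open>The summand \<open>\<bar>a\<bar> / lead_coeff p\<close> absorbs the constant
      term \<open>a\<close>, and the summand 1 leaves a full \<open>lead_coeff p\<close>
      over.\<close>
    have "lead_coeff p \<le> poly (pCons a p) x" if x: "max B (1 + \<bar>a\<bar> / lead_coeff p) \<le> x" for x
    proof -
      have "1 + \<bar>a\<bar> / lead_coeff p \<ge> 0" using B(2) by (simp add: add_nonneg_nonneg)
      then have "x \<ge> 0" using x by simp
      have "(1 + \<bar>a\<bar> / lead_coeff p) * lead_coeff p \<le> x * lead_coeff p"
        using x B(2) by (intro mult_right_mono) auto
      also have "\<dots> \<le> x * poly p x"
        using B(1)[of x] x \<open>x \<ge> 0\<close> by (intro mult_left_mono) auto
      finally have "lead_coeff p + \<bar>a\<bar> \<le> x * poly p x"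
        using B(2) False by (simp add: distrib_right)
      then show ?thesis using abs_ge_minus_self[of a] by simp
    qed
    then show ?thesis unfolding l by blast
  qed
qed

lemma poly_sgn_far_right:
  fixes p :: "'a::linordered_field poly"
  shows "\<exists>B. \<forall>x\<ge>B. sgn (poly p x) = sgn (lead_coeff p)"
proof (cases "p = 0")
  case False
  then consider "0 < lead_coeff p" | "0 < lead_coeff (-p)"
    by (metis coeff_minus degree_minus leading_coeff_0_iff neg_0_less_iff_less not_less_iff_gr_or_eq)
  then show ?thesis
  proof cases
    case 1
    from poly_sgn_at_top[OF this] obtain B where "\<forall>x\<ge>B. lead_coeff p \<le> poly p x" by blast
    then show ?thesis using 1 by (intro exI[of _ B]) (auto simp: sgn_if) 
  next
    case 2
    from poly_sgn_at_top[OF this] obtain B where "\<forall>x\<ge>B. lead_coeff (-p) \<le> poly (-p) x" by blast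
    then show ?thesis using 2 by (intro exI[of _ B]) (fastforce simp: sgn_if)
  qed
qed auto

lemma poly_sgn_far_left:
  fixes p :: "'a::linordered_field poly"
  shows "\<exists>B. \<forall>x\<le>B. sgn (poly p x) = sgn (lead_coeff p) * (-1) ^ degree p"
proof -
  define q where "q = pcompose p [:0, -1:]"
  have l: "lead_coeff q = lead_coeff p * (-1) ^ degree p"
    unfolding q_def by (subst lead_coeff_comp) auto
  obtain B where B: "\<forall>x\<ge>B. sgn (poly q x) = sgn (lead_coeff q)"
    using poly_sgn_far_right by blast
  have "sgn (poly p x) = sgn (lead_coeff p) * (-1) ^ degree p" if "x \<le> - B" for x
  proof -
    have "sgn (poly q (-x)) = sgn (lead_coeff q)" using B that by (simp add: le_minus_iff)
    then show ?thesis unfolding l by (simp add: q_def poly_pcompose sgn_mult power_sgn[symmetric])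
  qed
  then show ?thesis by blast
qed

section \<open>Matching the roots of two families of polynomials\<close>

text \<open>The two arguments live in different ordered rings, so their values under
  \<open>sgn\<close> could not be compared by an equation.\<close>

definition same_sgn :: "'a::linordered_idom \<Rightarrow> 'b::linordered_idom \<Rightarrow> bool"
  where "same_sgn x y \<longleftrightarrow> (x < 0 \<longleftrightarrow> y < 0) \<and> (x = 0 \<longleftrightarrow> y = 0)"

lemma same_sgn_sym: "same_sgn x y \<Longrightarrow> same_sgn y x"
  by (auto simp: same_sgn_def)

lemma same_sgn_zero: "same_sgn x y \<Longrightarrow> x = 0 \<longleftrightarrow> y = 0"
  by (simp add: same_sgn_def)

lemma same_sgn_mult: "same_sgn x y \<Longrightarrow> same_sgn x' y' \<Longrightarrow> same_sgn (x * x') (y * y')"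
  unfolding same_sgn_def by (auto simp: mult_less_0_iff not_less_iff_gr_or_eq)

lemma sgn_eq_iff: "sgn x = sgn y \<longleftrightarrow> same_sgn x y"
  by (auto simp: same_sgn_def sgn_if not_less_iff_gr_or_eq)

lemma same_sgn_trans: "same_sgn x y \<Longrightarrow> same_sgn y z \<Longrightarrow> same_sgn x z"
  by (auto simp: same_sgn_def)

lemma same_sgn_cong:
  "\<lbrakk>sgn a = sgn b; sgn c = sgn d; same_sgn a c\<rbrakk> \<Longrightarrow> same_sgn b d"
  by (auto simp: sgn_eq_iff same_sgn_def)

text \<open>The first components of \<open>H\<close> cut one line into cells, which are points and
  open intervals, and the second components cut the other line. The relation says that
  \<open>y\<close> and \<open>z\<close> lie in corresponding cells.\<close>

definition same_pos :: "('a::linorder \<times> 'b::linorder) set \<Rightarrow> 'a \<Rightarrow> 'b \<Rightarrow> bool"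
  where "same_pos H y z \<longleftrightarrow> (\<forall>(x, x') \<in> H. (y < x \<longleftrightarrow> z < x') \<and> (y = x \<longleftrightarrow> z = x'))"

text \<open>Such a relation is the graph of an order isomorphism between two finite sets of
  points.\<close>

definition matching :: "('a::linorder \<times> 'b::linorder) set \<Rightarrow> bool"
  where "matching H \<longleftrightarrow> finite H \<and> (\<forall>(x, x') \<in> H. same_pos H x x')"

text \<open>This expresses that the sign tables of \<open>p\<close> and \<open>q\<close> over the
  cells of \<open>H\<close> agree, without representing a table as an object.\<close>

definition matched ::
    "('a::linordered_idom \<times> 'b::linordered_idom) set \<Rightarrow> 'a poly \<Rightarrow> 'b poly \<Rightarrow> bool"
  where "matched H p q \<longleftrightarrow> (\<forall>y z. same_pos H y z \<longrightarrow> same_sgn (poly p y) (poly q z))"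

lemma same_posD:
  assumes "same_pos H y z" "(x, x') \<in> H"
  shows "y < x \<longleftrightarrow> z < x'" "y = x \<longleftrightarrow> z = x'" "x < y \<longleftrightarrow> x' < z"
  using assms by (auto simp: same_pos_def not_less_iff_gr_or_eq)

lemma same_posD_le:
  assumes "same_pos H y z" "(x, x') \<in> H"
  shows "y \<le> x \<longleftrightarrow> z \<le> x'" "x \<le> y \<longleftrightarrow> x' \<le> z"
  using same_posD[OF assms] by (simp_all flip: not_less)

lemma same_pos_converse: "same_pos (H\<inverse>) z y \<longleftrightarrow> same_pos H y z"
  by (auto simp: same_pos_def)

lemma same_pos_mono: "same_pos H y z \<Longrightarrow> K \<subseteq> H \<Longrightarrow> same_pos K y z"
  by (auto simp: same_pos_def)

lemma matching_converse: "matching (H\<inverse>) \<longleftrightarrow> matching H"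
  unfolding matching_def by (auto simp: same_pos_converse split_paired_All Ball_def)

lemma matchingD: "matching H \<Longrightarrow> (x, x') \<in> H \<Longrightarrow> same_pos H x x'"
  by (auto simp: matching_def)

lemma matching_mono: "matching H \<Longrightarrow> K \<subseteq> H \<Longrightarrow> matching K"
  unfolding matching_def by (blast intro: finite_subset same_pos_mono)

lemma matched_converse: "matched (H\<inverse>) q p \<longleftrightarrow> matched H p q"
  by (auto simp: matched_def same_pos_converse same_sgn_sym)

lemma matched_mono: "matched K p q \<Longrightarrow> K \<subseteq> H \<Longrightarrow> matched H p q"
  by (auto simp: matched_def intro: same_pos_mono)

lemma matched_root_iff:
  "matched H p q \<Longrightarrow> same_pos H y z \<Longrightarrow> poly p y = 0 \<longleftrightarrow> poly q z = 0"
  by (simp add: matched_def same_sgn_def)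

lemma between_finite_sets:
  fixes L U :: "'a::linordered_field set"
  assumes "finite L" "finite U" "\<And>l u. l \<in> L \<Longrightarrow> u \<in> U \<Longrightarrow> l < u"
  shows "\<exists>z. (\<forall>l\<in>L. l < z) \<and> (\<forall>u\<in>U. z < u)"
proof -
  consider "L = {}" "U = {}" | "L = {}" "U \<noteq> {}" | "L \<noteq> {}" "U = {}" | "L \<noteq> {}" "U \<noteq> {}" by blast
  then show ?thesis
  proof cases
    case 2
    then show ?thesis
      using assms(2) lt_ex[of "Min U"] by auto
  next
    case 3
    then show ?thesis
      using assms(1) gt_ex[of "Max L"] by auto
  next
    case 4
    then have "Max L < Min U" using assms by simp
    then obtain z where "Max L < z" "z < Min U" using dense by blast
    then show ?thesis using assms 4 by (intro exI[of _ z]) auto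
  qed auto
qed

text \<open>A finite order isomorphism extends by one more point, as in a back-and-forth argument,
  because the target order is dense and has no end points.\<close>

lemma same_pos_exists:
  fixes H :: "('a::linorder \<times> 'b::linordered_field) set"
  assumes H: "matching H"
  shows "\<exists>z. same_pos H y z"
proof (cases "y \<in> Domain H")
  case True
  then show ?thesis using H matchingD by blast
next
  case False
  define L where "L = {x'. \<exists>x. (x, x') \<in> H \<and> x < y}"
  define U where "U = {x'. \<exists>x. (x, x') \<in> H \<and> y < x}"
  have fin: "finite H" using H by (simp add: matching_def)
  have "L \<subseteq> snd ` H" "U \<subseteq> snd ` H" unfolding L_def U_def by force+
  then have "finite L" "finite U" using fin finite_subset by blast+
  moreover have "l < u" if lu: "l \<in> L" "u \<in> U" for l u
  proof -
    obtain x1 x2 where x: "(x1, l) \<in> H" "x1 < y" "(x2, u) \<in> H" "y < x2"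
      using lu by (auto simp: L_def U_def)
    then show ?thesis using same_posD(1)[OF matchingD[OF H x(1)] x(3)] by auto
  qed
  ultimately obtain z where z: "\<forall>l\<in>L. l < z" "\<forall>u\<in>U. z < u"
    using between_finite_sets[of L U] by blast
  have "(y < x \<longleftrightarrow> z < x') \<and> (y = x \<longleftrightarrow> z = x')" if "(x, x') \<in> H" for x x'
  proof -
    have "x \<noteq> y" using that False by blast
    then consider "x < y" | "y < x" by fastforce
    then show ?thesis
    proof cases
      case 1
      then have "x' \<in> L" using that by (auto simp: L_def)
      then show ?thesis using z 1 by auto
    next
      case 2
      then have "x' \<in> U" using that by (auto simp: U_def)
      then show ?thesis using z 2 by auto
    qed
  qed
  then show ?thesis by (auto simp: same_pos_def)
qed

lemma same_pos_exists':
  fixes H :: "('a::linordered_field \<times> 'b::linorder) set"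
  assumes "matching H"
  shows "\<exists>y. same_pos H y z"
  using same_pos_exists[of "H\<inverse>" z] assms by (simp add: matching_converse same_pos_converse)

lemma matched_zero_iff:
  fixes H :: "('a::linordered_field \<times> 'b::linordered_field) set"
  assumes "matching H" "matched H p q"
  shows "p = 0 \<longleftrightarrow> q = 0"
proof -
  have "poly q z = 0" if "p = 0" for z
    using same_pos_exists'[OF assms(1), of z] matched_root_iff[OF assms(2)] that by auto
  moreover have "poly p y = 0" if "q = 0" for y
    using same_pos_exists[OF assms(1), of y] matched_root_iff[OF assms(2)] that by auto
  ultimately show ?thesis by (metis poly_all_0_iff_0)
qed

text \<open>Off the domain of a matching, the position of a point does not change when the point is
  moved a little; so a root there would give infinitely many roots.\<close>

lemma matched_root_in_Domain:
  fixes H :: "('a::linordered_field \<times> 'b::linordered_field) set"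
  assumes H: "matching H" and m: "matched H p q" and p: "p \<noteq> 0" and y: "poly p y = 0"
  shows "y \<in> Domain H"
proof (rule ccontr)
  assume n: "y \<notin> Domain H"
  obtain z where z: "same_pos H y z" using same_pos_exists[OF H] by blast
  have qz: "poly q z = 0" using matched_root_iff[OF m z] y by simp
  have fin: "finite (Domain H)" using H by (simp add: matching_def finite_Domain)
  have "\<exists>v. (\<forall>l\<in>{y}. l < v) \<and> (\<forall>u\<in>{x \<in> Domain H. y < x}. v < u)"
    by (rule between_finite_sets) (use fin in simp_all)
  then obtain v where v: "y < v" "\<forall>u\<in>{x \<in> Domain H. y < x}. v < u" by blast
  have "poly p w = 0" if w: "w \<in> {y<..<v}" for w
  proof -
    have "(w < x \<longleftrightarrow> z < x') \<and> (w = x \<longleftrightarrow> z = x')" if xx: "(x, x') \<in> H" for x x'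
    proof -
      have "x \<noteq> y" using n xx by blast
      then consider "x < y" | "y < x" by fastforce
      then show ?thesis
      proof cases
        case 1
        then show ?thesis using same_posD[OF z xx] w by auto
      next
        case 2
        then have "v < x" using v(2) xx by blast
        then show ?thesis using same_posD[OF z xx] w 2 by auto
      qed
    qed
    then have "same_pos H w z" by (auto simp: same_pos_def)
    then show ?thesis using matched_root_iff[OF m] qz by simp
  qed
  then have "{y<..<v} \<subseteq> {w. poly p w = 0}" by blast
  then show False
    using poly_roots_finite[OF p] infinite_Ioo[OF v(1)] finite_subset by blast
qed

lemma matched_root_in_Range:
  fixes H :: "('a::linordered_field \<times> 'b::linordered_field) set"
  assumes "matching H" "matched H p q" "q \<noteq> 0" "poly q z = 0"
  shows "z \<in> Range H"
  using matched_root_in_Domain[of "H\<inverse>" q p z] assms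
  by (simp add: matching_converse matched_converse)

definition roots_part ::
    "('a::linordered_idom \<times> 'b::linordered_idom) set \<Rightarrow> ('a poly \<times> 'b poly) set \<Rightarrow> ('a \<times> 'b) set"
  where "roots_part H G = {(x, x') \<in> H. \<exists>(g, g') \<in> G. g \<noteq> 0 \<and> poly g x = 0}"

text \<open>Forgetting points merges cells. The sign of a member of the family remains constant on
  the merged cells, because all roots of its nonzero members are retained.\<close>

lemma matched_roots_part:
  fixes H :: "('a::linordered_field \<times> 'b::real_closed) set"
  assumes H: "matching H" and G: "\<And>g g'. (g, g') \<in> G \<Longrightarrow> matched H g g'"
    and gG: "(g, g') \<in> G"
  shows "matched (roots_part H G) g g'"
  unfolding matched_def
proof (intro allI impI)
  fix y z
  assume p0: "same_pos (roots_part H G) y z"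
  obtain z1 where z1: "same_pos H y z1" using same_pos_exists[OF H] by blast
  have s1: "same_sgn (poly g y) (poly g' z1)"
    using G[OF gG] z1 by (auto simp: matched_def)
  have "sgn (poly g' z1) = sgn (poly g' z)"
  proof (cases "g' = 0 \<or> z = z1")
    case True
    then show ?thesis by auto
  next
    case False
    then have g0: "g \<noteq> 0" using matched_zero_iff[OF H G[OF gG]] by blast
    \<comment> \<open>\<open>z\<close> and \<open>z1\<close> both correspond to \<open>y\<close>,
      one for the coarse and one for the fine cells. A root of \<open>g'\<close> is a retained
      point, so both lie on the same side of it and it cannot fall between them.\<close>
    have nr: "poly g' w \<noteq> 0" if w: "min z z1 \<le> w" "w \<le> max z z1" for w
    proof
      assume r: "poly g' w = 0"
      then obtain x where x: "(x, w) \<in> H"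
        using matched_root_in_Range[OF H G[OF gG]] False by blast
      have "poly g x = 0"
        using matched_root_iff[OF G[OF gG] matchingD[OF H x]] r by simp
      then have "(x, w) \<in> roots_part H G"
        using x g0 gG by (auto simp: roots_part_def)
      then have "z < w \<longleftrightarrow> z1 < w" "z = w \<longleftrightarrow> z1 = w"
        using same_posD[OF p0, of x w] same_posD[OF z1 x] by simp_all
      moreover have "w = z \<or> w = z1 \<or> z < w \<and> w < z1 \<or> z1 < w \<and> w < z"
        using w by (auto simp: min_le_iff_disj le_max_iff_disj)
      ultimately show False using False by auto
    qed
    show ?thesis
    proof (cases "z \<le> z1")
      case True
      then show ?thesis using poly_sgn_eq_if_no_root[of z z1 g'] nr by (simp add: min_def max_def)
    next
      case False
      then show ?thesis using poly_sgn_eq_if_no_root[of z1 z g'] nr by (simp add: min_def max_def)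
    qed
  qed
  then show "same_sgn (poly g y) (poly g' z)"
    using same_sgn_trans[OF s1] by (simp add: sgn_eq_iff)
qed

text \<open>The setting in which the roots of \<open>f\<close> and \<open>g\<close> are added to
  \<open>H\<close>. The critical points are already present, so both polynomials are monotone
  between neighbouring points, and the end pairs bracket all roots. The assumptions are symmetric in
  the two fields, so every result also holds for the converse relation.\<close>

locale root_extension =
  fixes H :: "('a::real_closed \<times> 'b::real_closed) set" and f :: "'a poly" and g :: "'b poly"
  assumes H: "matching H"
    and sgn_fg: "\<And>x x'. (x, x') \<in> H \<Longrightarrow> same_sgn (poly f x) (poly g x')"
    and f0: "f \<noteq> 0" and g0: "g \<noteq> 0"
    and crit_f: "\<And>x. poly (pderiv f) x = 0 \<Longrightarrow> x \<in> Domain H"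
    and crit_g: "\<And>x'. poly (pderiv g) x' = 0 \<Longrightarrow> x' \<in> Range H"
    and left_end: "\<exists>(M, M') \<in> H. (\<forall>x\<le>M. poly f x \<noteq> 0) \<and> (\<forall>x'\<le>M'. poly g x' \<noteq> 0)"
    and right_end: "\<exists>(N, N') \<in> H. (\<forall>x\<ge>N. poly f x \<noteq> 0) \<and> (\<forall>x'\<ge>N'. poly g x' \<noteq> 0)"
begin

lemma converse: "root_extension (H\<inverse>) g f"
  using left_end right_end
  by unfold_locales
    (auto simp: matching_converse H f0 g0 same_sgn_sym sgn_fg intro: crit_f crit_g)

lemma critical_between:
  assumes "a < b" "poly f a = poly f b"
  shows "\<exists>(x, x') \<in> H. a < x \<and> x < b"
proof -
  obtain x where x: "a < x" "x < b" "poly (pderiv f) x = 0"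
    using poly_rolle[OF assms] by blast
  then show ?thesis using crit_f[OF x(3)] by blast
qed

text \<open>By Rolle, two roots in one cell would enclose a critical point, which is a point of
  \<open>H\<close> and hence separates their cells.\<close>

lemma root_unique:
  assumes "same_pos H r s" "same_pos H t s" "poly f r = 0" "poly f t = 0"
  shows "r = t"
proof (rule ccontr)
  assume "r \<noteq> t"
  then consider "r < t" | "t < r" by fastforce
  then show False
  proof cases
    case 1
    then obtain x x' where x: "(x, x') \<in> H" "r < x" "x < t"
      using critical_between[of r t] assms by auto
    then show ?thesis using same_posD[OF assms(1) x(1)] same_posD[OF assms(2) x(1)] by auto
  next
    case 2
    then obtain x x' where x: "(x, x') \<in> H" "t < x" "x < r"
      using critical_between[of t r] assms by auto
    then show ?thesis using same_posD[OF assms(1) x(1)] same_posD[OF assms(2) x(1)] by auto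
  qed
qed

lemma neighbours:
  assumes y: "y \<notin> Domain H" and M: "(M, M') \<in> H" "M < y" and N: "(N, N') \<in> H" "y < N"
  obtains u u' v v' where "(u, u') \<in> H" "(v, v') \<in> H" "u < y" "y < v"
    "\<forall>(x, x') \<in> H. (x < y \<longrightarrow> x \<le> u) \<and> (y < x \<longrightarrow> v \<le> x)"
proof -
  define L where "L = {x \<in> Domain H. x < y}"
  define U where "U = {x \<in> Domain H. y < x}"
  have "finite (Domain H)" using H by (simp add: matching_def finite_Domain)
  then have fin: "finite L" "finite U" by (simp_all add: L_def U_def)
  have "M \<in> L" "N \<in> U" using M N by (auto simp: L_def U_def)
  then have "Max L \<in> L" "Min U \<in> U" using fin Max_in Min_in by blast+
  then obtain u' v' where uv: "(Max L, u') \<in> H" "(Min U, v') \<in> H" "Max L < y" "y < Min U"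
    unfolding L_def U_def by blast
  moreover have "x \<le> Max L" if "(x, x') \<in> H" "x < y" for x x'
    using fin that by (intro Max_ge) (auto simp: L_def)
  moreover have "Min U \<le> x" if "(x, x') \<in> H" "y < x" for x x'
    using fin that by (intro Min_le) (auto simp: U_def)
  ultimately show ?thesis by (intro that) auto
qed

lemma between_ends:
  assumes r: "poly f r = 0"
  obtains M M' N N' where "(M, M') \<in> H" "M < r" "(N, N') \<in> H" "r < N"
proof -
  obtain M M' where M: "(M, M') \<in> H" "\<forall>x\<le>M. poly f x \<noteq> 0" using left_end by blast
  obtain N N' where N: "(N, N') \<in> H" "\<forall>x\<ge>N. poly f x \<noteq> 0" using right_end by blast
  have "M < r" "r < N" using M N r by (metis not_le_imp_less)+
  then show ?thesis using that M N by blast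
qed

text \<open>Between consecutive points of the domain \<open>f\<close> is strictly monotone, so a root of \<open>f\<close> there
  is witnessed by opposite signs at the two endpoints, which \<open>g\<close> has as well.\<close>

lemma root_transfer:
  assumes r: "poly f r = 0"
  shows "\<exists>s. poly g s = 0 \<and> same_pos H r s"
proof (cases "r \<in> Domain H")
  case True
  then obtain s where s: "(r, s) \<in> H" by blast
  then show ?thesis using sgn_fg[OF s] r matchingD[OF H s] by (auto simp: same_sgn_def)
next
  case False
  obtain M M' N N' where MN: "(M, M') \<in> H" "M < r" "(N, N') \<in> H" "r < N"
    using between_ends[OF r] .
  obtain u u' v v' where uv: "(u, u') \<in> H" "(v, v') \<in> H" "u < r" "r < v"
    and nb: "\<forall>(x, x') \<in> H. (x < r \<longrightarrow> x \<le> u) \<and> (r < x \<longrightarrow> v \<le> x)"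
    using neighbours[OF False MN] .
  have adj: "x < r \<Longrightarrow> x \<le> u" "r < x \<Longrightarrow> v \<le> x" if "(x, x') \<in> H" for x x'
    using nb that by auto
  have nocrit: "poly (pderiv f) x \<noteq> 0" if "u < x" "x < v" for x
  proof
    assume "poly (pderiv f) x = 0"
    then obtain x' where x': "(x, x') \<in> H" using crit_f by blast
    have "x \<noteq> r" using x' False by blast
    then show False using adj(1)[OF x'] adj(2)[OF x'] that by fastforce
  qed
  obtain c1 where c1: "u < c1" "c1 < r" "poly f r - poly f u = (r - u) * poly (pderiv f) c1"
    using poly_mvt[OF uv(3)] by blast
  obtain c2 where c2: "r < c2" "c2 < v" "poly f v - poly f r = (v - r) * poly (pderiv f) c2"
    using poly_mvt[OF uv(4)] by blast
  have "sgn (poly (pderiv f) c1) = sgn (poly (pderiv f) c2)"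
    by (rule poly_sgn_eq_if_no_root) (use c1 c2 uv nocrit in auto)
  moreover have "poly (pderiv f) c1 \<noteq> 0" using nocrit c1 c2 uv by simp
  ultimately have pos: "0 < poly (pderiv f) c1 * poly (pderiv f) c2"
    by (auto simp: sgn_if zero_less_mult_iff split: if_splits)
  have "- poly f u = (r - u) * poly (pderiv f) c1" "poly f v = (v - r) * poly (pderiv f) c2"
    using c1(3) c2(3) r by simp_all
  then have "poly f u = - ((r - u) * poly (pderiv f) c1)" "poly f v = (v - r) * poly (pderiv f) c2"
    by (metis minus_minus)+
  then have "poly f u * poly f v = - ((r - u) * (v - r) * (poly (pderiv f) c1 * poly (pderiv f) c2))"
    by (simp only: mult_minus_left mult_minus_right mult_ac)
  also have "\<dots> < 0" using pos uv by (simp add: mult_pos_pos)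
  finally have neg: "poly f u * poly f v < 0" .
  have "same_sgn (poly f u * poly f v) (poly g u' * poly g v')"
    using sgn_fg uv by (intro same_sgn_mult) auto
  with neg have "poly g u' * poly g v' < 0" by (simp add: same_sgn_def)
  moreover have u'v': "u' < v'" using same_posD(1)[OF matchingD[OF H uv(1)] uv(2)] uv by simp
  ultimately obtain s where s: "u' < s" "s < v'" "poly g s = 0"
    using poly_sign_change_mult[OF u'v'] by blast
  have "(r < x \<longleftrightarrow> s < x') \<and> (r = x \<longleftrightarrow> s = x')" if x: "(x, x') \<in> H" for x x'
  proof -
    have "x \<noteq> r" using x False by blast
    then consider "x \<le> u" "x < r" | "v \<le> x" "r < x" using adj(1)[OF x] adj(2)[OF x] by fastforce
    then show ?thesis
    proof cases
      case 1
      then have "x' \<le> u'" using same_posD_le[OF matchingD[OF H x] uv(1)] by simp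
      then show ?thesis using 1 s by auto
    next
      case 2
      then have "v' \<le> x'" using same_posD_le[OF matchingD[OF H x] uv(2)] by simp
      then show ?thesis using 2 s by auto
    qed
  qed
  then show ?thesis using s by (auto simp: same_pos_def)
qed

definition ext :: "('a \<times> 'b) set"
  where "ext = H \<union> {(r, s). poly f r = 0 \<and> poly g s = 0 \<and> same_pos H r s}"

lemma H_subset_ext: "H \<subseteq> ext" by (auto simp: ext_def)

text \<open>Distinct roots on either line are separated by a point of \<open>H\<close>, again by
  Rolle. Their order is thus visible from their positions relative to \<open>H\<close>, and these
  are shared by the two partners of a pair.\<close>

lemma matching_ext: "matching ext"
proof -
  interpret c: root_extension "H\<inverse>" g f by (rule converse)
  have "ext \<subseteq> H \<union> {r. poly f r = 0} \<times> {s. poly g s = 0}" by (auto simp: ext_def)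
  then have fin: "finite ext"
    using poly_roots_finite[OF f0] poly_roots_finite[OF g0] H finite_subset
    by (metis finite_SigmaI finite_Un matching_def)
  have lt: "s < s'" if p: "poly f r = 0" "same_pos H r s" "poly f r' = 0" "same_pos H r' s'" "r < r'"
    for r s r' s'
  proof -
    obtain x x' where x: "(x, x') \<in> H" "r < x" "x < r'"
      using critical_between[OF p(5)] p by auto
    then show ?thesis using same_posD[OF p(2) x(1)] same_posD[OF p(4) x(1)] by auto
  qed
  have lt': "r < r'" if p: "poly g s = 0" "same_pos H r s" "poly g s' = 0" "same_pos H r' s'" "s < s'"
    for r s r' s'
  proof -
    obtain x x' where x: "(x', x) \<in> H\<inverse>" "s < x'" "x' < s'"
      using c.critical_between[OF p(5)] p by auto
    then have x1: "(x, x') \<in> H" by simp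
    then show ?thesis using same_posD[OF p(2) x1] same_posD[OF p(4) x1] x by auto
  qed
  have eq: "r = r' \<longleftrightarrow> s = s'"
    if "poly f r = 0" "poly g s = 0" "same_pos H r s" "poly f r' = 0" "poly g s' = 0" "same_pos H r' s'"
    for r s r' s'
    using root_unique c.root_unique that by (auto simp: same_pos_converse)
  have "same_pos ext x x'" if "(x, x') \<in> ext" for x x'
  proof -
    have "(x < t \<longleftrightarrow> x' < t') \<and> (x = t \<longleftrightarrow> x' = t')" if t: "(t, t') \<in> ext" for t t'
    proof (cases "(t, t') \<in> H")
      case True
      have "same_pos H x x'" using \<open>(x, x') \<in> ext\<close> matchingD[OF H] by (auto simp: ext_def)
      from same_posD[OF this True] show ?thesis by simp
    next
      case nt: False
      then have T: "poly f t = 0" "poly g t' = 0" "same_pos H t t'" using t by (auto simp: ext_def)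
      show ?thesis
      proof (cases "(x, x') \<in> H")
        case True
        from same_posD[OF T(3) this] show ?thesis by auto
      next
        case False
        then have X: "poly f x = 0" "poly g x' = 0" "same_pos H x x'"
          using \<open>(x, x') \<in> ext\<close> by (auto simp: ext_def)
        show ?thesis
          using lt[OF X(1,3) T(1,3)] lt'[OF X(2,3) T(2,3)] eq[OF X T] by blast
      qed
    qed
    then show ?thesis by (auto simp: same_pos_def)
  qed
  then show ?thesis using fin by (auto simp: matching_def)
qed

text \<open>\<open>f\<close> keeps on the way to \<open>y\<close> the sign it has at
  \<open>u\<close>. So does \<open>g\<close> between \<open>u'\<close> and \<open>z\<close>, because
  a root of \<open>g\<close> there would transfer back to a root of \<open>f\<close> between
  \<open>u\<close> and \<open>y\<close>. The signs at \<open>u\<close> and \<open>u'\<close> agree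
  by assumption.\<close>

lemma sgn_if_nonzero_left:
  assumes "same_pos ext y z" "(u, u') \<in> H" "u < y"
    and nz: "\<And>x. u \<le> x \<Longrightarrow> x \<le> y \<Longrightarrow> poly f x \<noteq> 0"
  shows "same_sgn (poly f y) (poly g z)"
proof -
  interpret c: root_extension "H\<inverse>" g f by (rule converse)
  have yz: "same_pos H y z" using assms(1) H_subset_ext same_pos_mono by blast
  have uz: "u' < z" using same_posD[OF yz assms(2)] assms(3) by simp
  have "poly g s \<noteq> 0" if s: "u' \<le> s" "s \<le> z" for s
  proof
    assume gs: "poly g s = 0"
    then obtain r where r: "poly f r = 0" "same_pos H r s"
      using c.root_transfer by (auto simp: same_pos_converse)
    then have "(r, s) \<in> ext" using gs by (auto simp: ext_def)
    then have "r \<le> y" using same_posD_le[OF assms(1)] s by blast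
    moreover have "u \<le> r" using same_posD_le[OF r(2) assms(2)] s by blast
    ultimately show False using nz r by blast
  qed
  then have 1: "sgn (poly g u') = sgn (poly g z)"
    using uz by (intro poly_sgn_eq_if_no_root) auto
  have 2: "sgn (poly f u) = sgn (poly f y)"
    using assms(3) nz by (intro poly_sgn_eq_if_no_root) auto
  show ?thesis by (rule same_sgn_cong[OF 2 1 sgn_fg[OF assms(2)]])
qed

lemma sgn_if_nonzero_right:
  assumes "same_pos ext y z" "(v, v') \<in> H" "y < v"
    and nz: "\<And>x. y \<le> x \<Longrightarrow> x \<le> v \<Longrightarrow> poly f x \<noteq> 0"
  shows "same_sgn (poly f y) (poly g z)"
proof -
  interpret c: root_extension "H\<inverse>" g f by (rule converse)
  have yz: "same_pos H y z" using assms(1) H_subset_ext same_pos_mono by blast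
  have zv: "z < v'" using same_posD[OF yz assms(2)] assms(3) by simp
  have "poly g s \<noteq> 0" if s: "z \<le> s" "s \<le> v'" for s
  proof
    assume gs: "poly g s = 0"
    then obtain r where r: "poly f r = 0" "same_pos H r s"
      using c.root_transfer by (auto simp: same_pos_converse)
    then have "(r, s) \<in> ext" using gs by (auto simp: ext_def)
    then have "y \<le> r" using same_posD_le[OF assms(1)] s by blast
    moreover have "r \<le> v" using same_posD_le[OF r(2) assms(2)] s by blast
    ultimately show False using nz r by blast
  qed
  then have 1: "sgn (poly g v') = sgn (poly g z)"
    using zv by (intro poly_sgn_eq_if_no_root[symmetric]) auto
  have 2: "sgn (poly f v) = sgn (poly f y)"
    using assms(3) nz by (intro poly_sgn_eq_if_no_root[symmetric]) auto
  show ?thesis by (rule same_sgn_cong[OF 2 1 sgn_fg[OF assms(2)]])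
qed

lemma matched_ext: "matched ext f g"
  unfolding matched_def
proof (intro allI impI)
  fix y z
  assume yz: "same_pos ext y z"
  have H_yz: "same_pos H y z" using yz H_subset_ext same_pos_mono by blast
  show "same_sgn (poly f y) (poly g z)"
  proof (cases "y \<in> Domain H \<or> poly f y = 0")
    case True
    then consider y' where "(y, y') \<in> H" | "poly f y = 0" by blast
    then show ?thesis
    proof cases
      case 1
      then have "z = y'" using same_posD(2)[OF H_yz] by blast
      then show ?thesis using sgn_fg 1 by simp
    next
      case 2
      then obtain s where s: "poly g s = 0" "same_pos H y s" using root_transfer by blast
      then have "(y, s) \<in> ext" using 2 by (auto simp: ext_def)
      then have "z = s" using same_posD(2)[OF yz] by blast
      then show ?thesis using s 2 by (simp add: same_sgn_def)
    qed
  next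
    case False
    obtain M M' where M: "(M, M') \<in> H" "\<forall>x\<le>M. poly f x \<noteq> 0" using left_end by blast
    obtain N N' where N: "(N, N') \<in> H" "\<forall>x\<ge>N. poly f x \<noteq> 0" using right_end by blast
    have ne: "y \<noteq> M" "y \<noteq> N" using False M N by blast+
    consider "y < M" | "N < y" | "M < y" "y < N" using ne by fastforce
    then show ?thesis
    proof cases
      case 1
      show ?thesis by (rule sgn_if_nonzero_right[OF yz M(1) 1]) (use M(2) in auto)
    next
      case 2
      show ?thesis by (rule sgn_if_nonzero_left[OF yz N(1) 2]) (use N(2) in auto)
    next
      case 3
      have yd: "y \<notin> Domain H" using False by blast
      obtain u u' v v' where uv: "(u, u') \<in> H" "(v, v') \<in> H" "u < y" "y < v"
        and nb: "\<forall>(x, x') \<in> H. (x < y \<longrightarrow> x \<le> u) \<and> (y < x \<longrightarrow> v \<le> x)"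
        using neighbours[OF yd M(1) 3(1) N(1) 3(2)] .
      have adj: "x < y \<Longrightarrow> x \<le> u" "y < x \<Longrightarrow> v \<le> x" if "(x, x') \<in> H" for x x'
        using nb that by auto
      show ?thesis
      proof (rule ccontr)
        \<comment> \<open>If neither neighbour decides the sign, then \<open>f\<close> has a root on
          each side of \<open>y\<close> between the two neighbours, and Rolle yields a further point
          of \<open>H\<close> between these roots.\<close>
        assume n: "\<not> ?thesis"
        then obtain a where a: "u \<le> a" "a \<le> y" "poly f a = 0"
          using sgn_if_nonzero_left[OF yz uv(1,3)] by blast
        from n obtain b where b: "y \<le> b" "b \<le> v" "poly f b = 0"
          using sgn_if_nonzero_right[OF yz uv(2,4)] by blast
        have "a < y" "y < b" using a b False by (auto simp: less_le)
        then obtain x x' where x: "(x, x') \<in> H" "a < x" "x < b"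
          using critical_between[of a b] a b by auto
        have "x \<noteq> y" using x False by blast
        then show False using adj[OF x(1)] x a b by fastforce
      qed
    qed
  qed
qed

end

section \<open>Signs beyond all given points, and adding one polynomial to a matching\<close>

lemma same_sgn_sgn: "same_sgn (sgn x) (sgn y) \<longleftrightarrow> same_sgn x y"
  by (auto simp: same_sgn_def sgn_if)

lemma same_sgn_neg_one_power: "same_sgn ((-1) ^ d) ((-1) ^ d)"
  by (cases "even d") (auto simp: same_sgn_def)

text \<open>The equality of the degrees enters through their parity, which together with the leading
  coefficient decides the sign near minus infinity.\<close>

lemma same_sgn_far_left:
  fixes f :: "'a::linordered_field poly" and g :: "'b::linordered_field poly"
  assumes "finite D" "finite D'" "degree f = degree g" "same_sgn (lead_coeff f) (lead_coeff g)"
    "f \<noteq> 0"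
  shows "\<exists>M M'. (\<forall>x\<in>D. M < x) \<and> (\<forall>x\<in>D'. M' < x) \<and> same_sgn (poly f M) (poly g M') \<and>
    (\<forall>x\<le>M. poly f x \<noteq> 0) \<and> (\<forall>x\<le>M'. poly g x \<noteq> 0)"
proof -
  have nz: "lead_coeff f \<noteq> 0" "lead_coeff g \<noteq> 0"
    using \<open>f \<noteq> 0\<close> same_sgn_zero[OF \<open>same_sgn (lead_coeff f) (lead_coeff g)\<close>] by simp_all
  obtain B where B: "\<forall>x\<le>B. sgn (poly f x) = sgn (lead_coeff f) * (-1) ^ degree f"
    using poly_sgn_far_left[of f] by blast
  obtain B' where B': "\<forall>x\<le>B'. sgn (poly g x) = sgn (lead_coeff g) * (-1) ^ degree g"
    using poly_sgn_far_left[of g] by blast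
  have "\<exists>M. (\<forall>l\<in>{}. l < M) \<and> (\<forall>u\<in>insert B D. M < u)"
    by (rule between_finite_sets) (use assms in simp_all)
  then obtain M where M: "M < B" "\<forall>u\<in>D. M < u" by blast
  have "\<exists>M'. (\<forall>l\<in>{}. l < M') \<and> (\<forall>u\<in>insert B' D'. M' < u)"
    by (rule between_finite_sets) (use assms in simp_all)
  then obtain M' where M': "M' < B'" "\<forall>u\<in>D'. M' < u" by blast
  have "same_sgn (sgn (poly f M)) (sgn (poly g M'))"
    using M M' B B' assms(3,4)
    by (auto intro!: same_sgn_mult simp: same_sgn_sgn same_sgn_neg_one_power)
  moreover have "poly f x \<noteq> 0" if "x \<le> M" for x
  proof -
    have "sgn (poly f x) = sgn (lead_coeff f) * (-1) ^ degree f" using B M that by simp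
    then show ?thesis using nz by (auto simp: sgn_0_0)
  qed
  moreover have "poly g x \<noteq> 0" if "x \<le> M'" for x
  proof -
    have "sgn (poly g x) = sgn (lead_coeff g) * (-1) ^ degree g" using B' M' that by simp
    then show ?thesis using nz by (auto simp: sgn_0_0)
  qed
  ultimately show ?thesis using M M' by (auto simp: same_sgn_sgn)
qed

lemma same_sgn_far_right:
  fixes f :: "'a::linordered_field poly" and g :: "'b::linordered_field poly"
  assumes "finite D" "finite D'" "same_sgn (lead_coeff f) (lead_coeff g)" "f \<noteq> 0"
  shows "\<exists>N N'. (\<forall>x\<in>D. x < N) \<and> (\<forall>x\<in>D'. x < N') \<and> same_sgn (poly f N) (poly g N') \<and>
    (\<forall>x\<ge>N. poly f x \<noteq> 0) \<and> (\<forall>x\<ge>N'. poly g x \<noteq> 0)"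
proof -
  have nz: "lead_coeff f \<noteq> 0" "lead_coeff g \<noteq> 0"
    using \<open>f \<noteq> 0\<close> same_sgn_zero[OF \<open>same_sgn (lead_coeff f) (lead_coeff g)\<close>] by simp_all
  obtain B where B: "\<forall>x\<ge>B. sgn (poly f x) = sgn (lead_coeff f)"
    using poly_sgn_far_right[of f] by blast
  obtain B' where B': "\<forall>x\<ge>B'. sgn (poly g x) = sgn (lead_coeff g)"
    using poly_sgn_far_right[of g] by blast
  have "\<exists>N. (\<forall>l\<in>insert B D. l < N) \<and> (\<forall>u\<in>{}. N < u)"
    by (rule between_finite_sets) (use assms in simp_all)
  then obtain N where N: "B < N" "\<forall>u\<in>D. u < N" by blast
  have "\<exists>N'. (\<forall>l\<in>insert B' D'. l < N') \<and> (\<forall>u\<in>{}. N' < u)"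
    by (rule between_finite_sets) (use assms in simp_all)
  then obtain N' where N': "B' < N'" "\<forall>u\<in>D'. u < N'" by blast
  have "same_sgn (sgn (poly f N)) (sgn (poly g N'))"
    using N N' B B' assms(3) by (auto simp: same_sgn_sgn)
  moreover have "poly f x \<noteq> 0" if "N \<le> x" for x
  proof -
    have "sgn (poly f x) = sgn (lead_coeff f)" using B N that by simp
    then show ?thesis using nz by (auto simp: sgn_0_0)
  qed
  moreover have "poly g x \<noteq> 0" if "N' \<le> x" for x
  proof -
    have "sgn (poly g x) = sgn (lead_coeff g)" using B' N' that by simp
    then show ?thesis using nz by (auto simp: sgn_0_0)
  qed
  ultimately show ?thesis using N N' by (auto simp: same_sgn_sgn)
qed

text \<open>A pair beyond all points and all roots is first added on each side. The critical points
  need not be added: as roots of matched nonzero polynomials they already occur in the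
  matching.\<close>

lemma matched_extend:
  fixes f :: "'a::real_closed poly" and g :: "'b::real_closed poly"
  assumes H: "matching H"
    and deg: "degree f = degree g" "degree f \<noteq> 0"
    and lc: "same_sgn (lead_coeff f) (lead_coeff g)"
    and sgn: "\<And>x x'. (x, x') \<in> H \<Longrightarrow> same_sgn (poly f x) (poly g x')"
    and der: "matched H (pderiv f) (pderiv g)"
  shows "\<exists>K. H \<subseteq> K \<and> matching K \<and> matched K f g"
proof -
  have f0: "f \<noteq> 0" and g0: "g \<noteq> 0" using deg by auto
  have fin: "finite (Domain H)" "finite (Range H)"
    using H by (simp_all add: matching_def finite_Domain finite_Range)
  obtain M M' where M: "\<forall>x\<in>Domain H. M < x" "\<forall>x\<in>Range H. M' < x"
      "same_sgn (poly f M) (poly g M')" "\<forall>x\<le>M. poly f x \<noteq> 0" "\<forall>x\<le>M'. poly g x \<noteq> 0"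
    using same_sgn_far_left[OF fin deg(1) lc f0] by blast
  have "finite (insert M (Domain H))" "finite (insert M' (Range H))" using fin by simp_all
  then obtain N N' where N: "\<forall>x\<in>insert M (Domain H). x < N" "\<forall>x\<in>insert M' (Range H). x < N'"
      "same_sgn (poly f N) (poly g N')" "\<forall>x\<ge>N. poly f x \<noteq> 0" "\<forall>x\<ge>N'. poly g x \<noteq> 0"
    using same_sgn_far_right[OF _ _ lc f0, of "insert M (Domain H)" "insert M' (Range H)"] by blast
  define K where "K = insert (M, M') (insert (N, N') H)"
  have HK: "H \<subseteq> K" by (auto simp: K_def)
  have MN: "M < N" "M' < N'" using N by auto
  have "same_pos K x x'" if "(x, x') \<in> K" for x x'
  proof -
    have "(x < t \<longleftrightarrow> x' < t') \<and> (x = t \<longleftrightarrow> x' = t')" if t: "(t, t') \<in> K" for t t'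
    proof (cases "(x, x') \<in> H \<and> (t, t') \<in> H")
      case True
      then show ?thesis using same_posD[OF matchingD[OF H]] by blast
    next
      case False
      have 1: "M < s \<and> M' < s' \<and> s < N \<and> s' < N'" if "(s, s') \<in> H" for s s'
        using M(1,2) N(1,2) that by blast
      show ?thesis
        using False t \<open>(x, x') \<in> K\<close> 1[of x x'] 1[of t t'] MN unfolding K_def by auto
    qed
    then show ?thesis by (auto simp: same_pos_def)
  qed
  then have K: "matching K" using H by (auto simp: matching_def K_def)
  have derK: "matched K (pderiv f) (pderiv g)" using matched_mono[OF der HK] .
  have pd: "pderiv f \<noteq> 0" "pderiv g \<noteq> 0" using deg by (simp_all add: pderiv_eq_0_iff)
  interpret root_extension K f g
  proof
    show "same_sgn (poly f x) (poly g x')" if "(x, x') \<in> K" for x x'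
      using that sgn M(3) N(3) by (auto simp: K_def)
    show "x \<in> Domain K" if "poly (pderiv f) x = 0" for x
      using matched_root_in_Domain[OF K derK pd(1) that] .
    show "x \<in> Range K" if "poly (pderiv g) x = 0" for x
      using matched_root_in_Range[OF K derK pd(2) that] .
    show "\<exists>(M, M')\<in>K. (\<forall>x\<le>M. poly f x \<noteq> 0) \<and> (\<forall>x'\<le>M'. poly g x' \<noteq> 0)"
      using M by (auto simp: K_def)
    show "\<exists>(N, N')\<in>K. (\<forall>x\<ge>N. poly f x \<noteq> 0) \<and> (\<forall>x'\<ge>N'. poly g x' \<noteq> 0)"
      using N by (auto simp: K_def)
  qed (use K f0 g0 in auto)
  show ?thesis
    using HK H_subset_ext matching_ext matched_ext by blast
qed

section \<open>Coefficient subrings, formal derivatives and pseudo-division\<close>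

definition subring_set :: "'c::comm_ring_1 set \<Rightarrow> bool"
  where "subring_set C \<longleftrightarrow> 0 \<in> C \<and> 1 \<in> C \<and> (\<forall>x\<in>C. \<forall>y\<in>C. x - y \<in> C \<and> x * y \<in> C)"

lemma subring_setD:
  assumes "subring_set C"
  shows "0 \<in> C" "1 \<in> C" "\<And>x y. x \<in> C \<Longrightarrow> y \<in> C \<Longrightarrow> x - y \<in> C"
    "\<And>x y. x \<in> C \<Longrightarrow> y \<in> C \<Longrightarrow> x * y \<in> C"
  using assms by (auto simp: subring_set_def)

lemma subring_set_add: "subring_set C \<Longrightarrow> x \<in> C \<Longrightarrow> y \<in> C \<Longrightarrow> x + y \<in> C"
  by (metis add.commute diff_0 diff_minus_eq_add subring_setD(1,3))

lemma subring_set_of_nat: "subring_set C \<Longrightarrow> of_nat n \<in> C"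
  by (induction n) (auto simp: subring_set_add subring_setD)

definition polys_over :: "'c::comm_ring_1 set \<Rightarrow> 'c poly set"
  where "polys_over C = {p. \<forall>i. coeff p i \<in> C}"

text \<open>The library's \<^const>\<open>pderiv\<close> requires a coefficient ring without zero divisors.\<close>

definition formal_deriv :: "'c::comm_ring_1 poly \<Rightarrow> 'c poly"
  where "formal_deriv p = (\<Sum>i<degree p. monom (of_nat (Suc i) * coeff p (Suc i)) i)"

lemma coeff_formal_deriv: "coeff (formal_deriv p) n = of_nat (Suc n) * coeff p (Suc n)"
proof (cases "n < degree p")
  case True
  then show ?thesis by (simp add: formal_deriv_def coeff_sum sum.delta')
next
  case False
  then have "coeff p (Suc n) = 0" by (simp add: coeff_eq_0)
  then show ?thesis using False by (simp add: formal_deriv_def coeff_sum sum.delta')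
qed

lemma degree_formal_deriv: "degree p \<noteq> 0 \<Longrightarrow> degree (formal_deriv p) < degree p"
  by (rule degree_lessI) (auto simp: coeff_formal_deriv coeff_eq_0)

lemma map_poly_formal_deriv:
  fixes \<phi> :: "'c::comm_ring_1 \<Rightarrow> 'a::idom"
  assumes "comm_ring_hom \<phi>"
  shows "map_poly \<phi> (formal_deriv p) = pderiv (map_poly \<phi> p)"
proof -
  interpret comm_ring_hom \<phi> by fact
  show ?thesis
    by (rule poly_eqI) (simp add: coeff_formal_deriv coeff_pderiv hom_distribs)
qed

text \<open>An even power of the leading coefficient is used so that the sign of \<open>f\<close> at a root of \<open>g\<close>
  is the sign of the remainder.\<close>

lemma pseudo_remainder:
  assumes C: "subring_set C" and f: "f \<in> polys_over C" and g: "g \<in> polys_over C"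
  shows "\<exists>e q r. r \<in> polys_over C \<and> (\<forall>i\<ge>degree g. coeff r i = 0) \<and>
    smult (lead_coeff g ^ (2 * e)) f = q * g + r"
proof -
  \<comment> \<open>Vanishing coefficients express the degree bound uniformly: for
    \<open>degree g = 0\<close> the condition says that \<open>r = 0\<close>. The induction is on a
    bound \<open>n\<close> for the dividend of the same kind.\<close>
  have "\<exists>e q r. r \<in> polys_over C \<and> (\<forall>i\<ge>degree g. coeff r i = 0) \<and>
      smult (lead_coeff g ^ (2 * e)) f = q * g + r"
    if "f \<in> polys_over C" "\<forall>i\<ge>n. coeff f i = 0" for n
    using that
  proof (induction n arbitrary: f)
    case 0
    then show ?case by (intro exI[of _ 0] exI[of _ 0] exI[of _ f]) auto
  next
    case (Suc n)
    show ?case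
    proof (cases "Suc n \<le> degree g")
      case True
      then show ?thesis
        using Suc.prems by (intro exI[of _ 0] exI[of _ 0] exI[of _ f]) auto
    next
      case False
      define l where "l = lead_coeff g"
      \<comment> \<open>One step of long division: at index \<open>n\<close> the product
        \<open>m * g\<close> has the coefficient \<open>l ^ 2 * coeff f n\<close>, which cancels the
        top term of \<open>smult (l ^ 2) f\<close>.\<close>
      define m where "m = monom (l * coeff f n) (n - degree g)"
      define h where "h = smult (l ^ 2) f - m * g"
      have lC: "l \<in> C" using g by (simp add: l_def polys_over_def)
      have ch: "coeff h i = l ^ 2 * coeff f i -
          (if i < n - degree g then 0 else l * coeff f n * coeff g (i - (n - degree g)))" for i
        by (simp add: h_def m_def coeff_monom_mult)
      have "coeff h i \<in> C" for i
        unfolding ch power2_eq_square using Suc.prems(1) g lC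
        by (auto simp: polys_over_def intro!: subring_setD[OF C])
      then have "h \<in> polys_over C" by (simp add: polys_over_def)
      moreover have "coeff h i = 0" if i: "n \<le> i" for i
      proof (cases "i = n")
        case True
        then show ?thesis using False by (simp add: ch l_def power2_eq_square)
      next
        case ne: False
        then have "degree g < i - (n - degree g)" using i False by simp
        then show ?thesis using ne i Suc.prems(2) by (simp add: ch coeff_eq_0)
      qed
      ultimately obtain e q r where *: "r \<in> polys_over C" "\<forall>i\<ge>degree g. coeff r i = 0"
          "smult (lead_coeff g ^ (2 * e)) h = q * g + r"
        using Suc.IH[of h] by blast
      have "smult (l ^ (2 * Suc e)) f = smult (l ^ (2 * e)) (h + m * g)"
        by (simp add: h_def power2_eq_square mult_ac)
      also have "\<dots> = (q + smult (l ^ (2 * e)) m) * g + r"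
        using *(3) by (simp add: l_def smult_add_right distrib_right)
      finally show ?thesis using *(1,2) unfolding l_def by blast
    qed
  qed
  from this[of "Suc (degree f)"] show ?thesis using f by (auto simp: coeff_eq_0)
qed

section \<open>Cohen-Hoermander elimination\<close>

text \<open>A semantic form of eliminating one variable: the signs of the finitely many elements of
  \<open>K\<close> under a homomorphism fix the sign table of the image of \<open>F\<close>. The
  first two arguments only name the two fields, over which the homomorphisms range.\<close>

definition determines ::
    "'a::real_closed itself \<Rightarrow> 'b::real_closed itself \<Rightarrow> 'c::comm_ring_1 set \<Rightarrow> 'c poly set \<Rightarrow> bool"
  where "determines _ _ K F \<longleftrightarrow> (\<forall>(\<phi> :: 'c \<Rightarrow> 'a) (\<psi> :: 'c \<Rightarrow> 'b).
    comm_ring_hom \<phi> \<longrightarrow> comm_ring_hom \<psi> \<longrightarrow> (\<forall>c\<in>K. same_sgn (\<phi> c) (\<psi> c)) \<longrightarrow>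
    (\<exists>H. matching H \<and> (\<forall>f\<in>F. matched H (map_poly \<phi> f) (map_poly \<psi> f))))"

lemma determinesD:
  fixes \<phi> :: "'c::comm_ring_1 \<Rightarrow> 'a::real_closed" and \<psi> :: "'c \<Rightarrow> 'b::real_closed"
  assumes "determines TYPE('a) TYPE('b) K F" "comm_ring_hom \<phi>" "comm_ring_hom \<psi>"
    "\<And>c. c \<in> K \<Longrightarrow> same_sgn (\<phi> c) (\<psi> c)"
  obtains H where "matching H" "\<forall>f\<in>F. matched H (map_poly \<phi> f) (map_poly \<psi> f)"
  using assms unfolding determines_def by blast

lemma poly_cutoff_in_polys_over:
  "subring_set C \<Longrightarrow> f \<in> polys_over C \<Longrightarrow> poly_cutoff k f \<in> polys_over C"
  by (auto simp: polys_over_def coeff_poly_cutoff subring_setD)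

lemma map_poly_cutoff:
  fixes \<phi> :: "'c::comm_ring_1 \<Rightarrow> 'a::idom"
  assumes "comm_ring_hom \<phi>" "\<And>i. k \<le> i \<Longrightarrow> \<phi> (coeff f i) = 0"
  shows "map_poly \<phi> (poly_cutoff k f) = map_poly \<phi> f"
proof -
  interpret comm_ring_hom \<phi> by fact
  show ?thesis by (rule poly_eqI) (simp add: coeff_poly_cutoff assms(2))
qed

lemma map_poly_const:
  fixes \<phi> :: "'c::comm_ring_1 \<Rightarrow> 'a::idom"
  assumes "comm_ring_hom \<phi>"
  shows "map_poly \<phi> [:c:] = [:\<phi> c:]"
proof -
  interpret comm_ring_hom \<phi> by fact
  show ?thesis by (rule poly_eqI) (simp add: coeff_pCons split: nat.split)
qed

lemma degree_map_poly_eq: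
  fixes \<phi> :: "'c::comm_ring_1 \<Rightarrow> 'a::idom"
  assumes "comm_ring_hom \<phi>" "\<phi> (lead_coeff f) \<noteq> 0"
  shows "degree (map_poly \<phi> f) = degree f"
proof -
  interpret comm_ring_hom \<phi> by fact
  show ?thesis using assms(2) by (intro antisym degree_map_poly_le le_degree) simp
qed

lemma sgn_at_root_by_remainder:
  fixes \<phi> :: "'c::comm_ring_1 \<Rightarrow> 'a::linordered_idom"
  assumes "comm_ring_hom \<phi>" "smult (l ^ (2 * e)) f = q * g + r" "\<phi> l \<noteq> 0"
    "poly (map_poly \<phi> g) x = 0"
  shows "same_sgn (poly (map_poly \<phi> f) x) (poly (map_poly \<phi> r) x)"
proof -
  interpret comm_ring_hom \<phi> by fact
  interpret p: map_poly_comm_ring_hom \<phi> ..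
  have "map_poly \<phi> (smult (l ^ (2 * e)) f) = map_poly \<phi> (q * g + r)" using assms(2) by simp
  then have "smult (\<phi> l ^ (2 * e)) (map_poly \<phi> f) = map_poly \<phi> q * map_poly \<phi> g + map_poly \<phi> r"
    by (simp add: hom_distribs)
  then have "poly (smult (\<phi> l ^ (2 * e)) (map_poly \<phi> f)) x = poly (map_poly \<phi> r) x"
    using assms(4) by simp
  moreover have "0 < \<phi> l ^ (2 * e)" using assms(3) by (simp add: power_mult)
  ultimately obtain c where "poly (map_poly \<phi> r) x = c * poly (map_poly \<phi> f) x" "0 < c"
    by (metis poly_smult)
  then show ?thesis by (simp add: same_sgn_def mult_less_0_iff)
qed

text \<open>The roots of polynomials matched by \<open>H\<close> but not in \<open>G\<close>, such as the remainders, are dropped from the matching by \<^const>\<open>roots_part\<close>: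
  the sign of \<open>f\<close> is only known at the roots of \<open>G\<close>.\<close>

lemma matched_insert:
  fixes \<phi> :: "'c::comm_ring_1 \<Rightarrow> 'a::real_closed" and \<psi> :: "'c \<Rightarrow> 'b::real_closed"
  assumes \<phi>: "comm_ring_hom \<phi>" and \<psi>: "comm_ring_hom \<psi>"
    and H: "matching H" and HG: "\<And>g. g \<in> G \<Longrightarrow> matched H (map_poly \<phi> g) (map_poly \<psi> g)"
    and deg: "degree f \<noteq> 0" and lc: "same_sgn (\<phi> (lead_coeff f)) (\<psi> (lead_coeff f))"
      "\<phi> (lead_coeff f) \<noteq> 0"
    and der: "formal_deriv f \<in> G"
    and rem: "\<And>g x x'. \<lbrakk>g \<in> G; map_poly \<phi> g \<noteq> 0; (x, x') \<in> H; poly (map_poly \<phi> g) x = 0;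
      poly (map_poly \<psi> g) x' = 0\<rbrakk> \<Longrightarrow> same_sgn (poly (map_poly \<phi> f) x) (poly (map_poly \<psi> f) x')"
  shows "\<exists>K. matching K \<and> (\<forall>g\<in>insert f G. matched K (map_poly \<phi> g) (map_poly \<psi> g))"
proof -
  interpret \<phi>: comm_ring_hom \<phi> by fact
  interpret \<psi>: comm_ring_hom \<psi> by fact
  define P where "P = (\<lambda>g. (map_poly \<phi> g, map_poly \<psi> g)) ` G"
  define H0 where "H0 = roots_part H P"
  have H0H: "H0 \<subseteq> H" by (auto simp: H0_def roots_part_def)
  have H0: "matching H0" using matching_mono[OF H H0H] .
  have P: "matched H g g'" if "(g, g') \<in> P" for g g'
    using that HG by (auto simp: P_def)
  have mH0: "matched H0 (map_poly \<phi> g) (map_poly \<psi> g)" if "g \<in> G" for g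
    unfolding H0_def by (rule matched_roots_part[OF H P]) (use that in \<open>auto simp: P_def\<close>)
  have \<psi>0: "\<psi> (lead_coeff f) \<noteq> 0" using lc by (simp add: same_sgn_def)
  have deg_\<phi>: "degree (map_poly \<phi> f) = degree f" and deg_\<psi>: "degree (map_poly \<psi> f) = degree f"
    using degree_map_poly_eq[OF \<phi> lc(2)] degree_map_poly_eq[OF \<psi> \<psi>0] by simp_all
  have "same_sgn (poly (map_poly \<phi> f) x) (poly (map_poly \<psi> f) x')" if x: "(x, x') \<in> H0" for x x'
  proof -
    obtain g where g: "g \<in> G" "map_poly \<phi> g \<noteq> 0" "poly (map_poly \<phi> g) x = 0"
      using x by (auto simp: H0_def roots_part_def P_def)
    have xH: "(x, x') \<in> H" using x H0H by blast
    have "poly (map_poly \<psi> g) x' = 0"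
      using matched_root_iff[OF HG[OF g(1)] matchingD[OF H xH]] g(3) by simp
    then show ?thesis using rem g xH by blast
  qed
  moreover have "matched H0 (pderiv (map_poly \<phi> f)) (pderiv (map_poly \<psi> f))"
    using mH0[OF der] by (simp add: map_poly_formal_deriv \<phi> \<psi>)
  ultimately obtain K where K: "H0 \<subseteq> K" "matching K" "matched K (map_poly \<phi> f) (map_poly \<psi> f)"
    using matched_extend[OF H0, of "map_poly \<phi> f" "map_poly \<psi> f"] deg lc
    by (auto simp: deg_\<phi> deg_\<psi>)
  then have "\<forall>g\<in>insert f G. matched K (map_poly \<phi> g) (map_poly \<psi> g)"
    using matched_mono[OF mH0 K(1)] by blast
  then show ?thesis using K(2) by blast
qed

text \<open>Whether the degree of \<open>f\<close> drops depends on the homomorphism, so the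
  induction hypothesis is used twice. If the leading coefficient of \<open>f\<close> is annihilated,
  \<open>f\<close> may be replaced by its truncation \<open>f0\<close>. Otherwise the signs of
  \<open>f\<close> at the roots of the other polynomials and of its derivative are those of
  remainders of smaller degree.\<close>

lemma determines_step:
  fixes C :: "'c::comm_ring_1 set"
  assumes C: "subring_set C" and F: "finite F" "F \<subseteq> polys_over C" and f: "f \<in> F" "degree f \<noteq> 0"
    and deg: "\<And>g. g \<in> F \<Longrightarrow> degree g \<le> degree f"
    and IH: "\<And>R. \<lbrakk>finite R; R \<subseteq> polys_over C; \<And>r. r \<in> R \<Longrightarrow> degree r < degree f\<rbrakk> \<Longrightarrow>
      \<exists>K\<subseteq>C. finite K \<and> determines TYPE('a::real_closed) TYPE('b::real_closed) K ((F - {f}) \<union> R)"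
  shows "\<exists>K\<subseteq>C. finite K \<and> determines TYPE('a) TYPE('b) K F"
proof -
  define f0 where "f0 = poly_cutoff (degree f) f"
  define G where "G = insert (formal_deriv f) (F - {f})"
  \<comment> \<open>The degrees of the divisors may drop too, whereas pseudo-division is of use only
    if the leading coefficient of the divisor is not annihilated. Some truncation has the same image
    and such a leading coefficient. As \<open>poly_cutoff k\<close> keeps the coefficients below
    \<open>k\<close>, the bound has to be \<open>Suc (degree f)\<close>.\<close>
  define T where "T = (\<Union>g\<in>G. (\<lambda>k. poly_cutoff k g) ` {..Suc (degree f)})"
  have fC: "f \<in> polys_over C" using F f by blast
  have dC: "formal_deriv f \<in> polys_over C"
    using C fC by (auto simp: polys_over_def coeff_formal_deriv intro!: subring_setD subring_set_of_nat
        simp del: of_nat_Suc)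
  have GC: "G \<subseteq> polys_over C" using dC F by (auto simp: G_def)
  have degG: "degree g \<le> degree f" if "g \<in> G" for g
    using that deg degree_formal_deriv[OF f(2)] by (auto simp: G_def)
  have finG: "finite G" using F by (simp add: G_def)
  have finT: "finite T" using finG by (simp add: T_def)
  have TC: "T \<subseteq> polys_over C"
    using GC poly_cutoff_in_polys_over[OF C] by (auto simp: T_def)
  have degT: "degree t \<le> degree f" if tT: "t \<in> T" for t
  proof -
    obtain g k where t: "g \<in> G" "t = poly_cutoff k g" using tT by (auto simp: T_def)
    have "degree t \<le> degree g" unfolding t(2)
      by (rule degree_le) (auto simp: coeff_poly_cutoff coeff_eq_0)
    then show ?thesis using degG[OF t(1)] by simp
  qed
  have "\<forall>t\<in>T. \<exists>r. r \<in> polys_over C \<and> (\<forall>i\<ge>degree t. coeff r i = 0) \<and>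
      (\<exists>e q. smult (lead_coeff t ^ (2 * e)) f = q * t + r)"
    using pseudo_remainder[OF C fC] TC by blast
  then obtain rm where rm: "\<And>t. t \<in> T \<Longrightarrow> rm t \<in> polys_over C"
    "\<And>t i. t \<in> T \<Longrightarrow> degree t \<le> i \<Longrightarrow> coeff (rm t) i = 0"
    "\<And>t. t \<in> T \<Longrightarrow> \<exists>e q. smult (lead_coeff t ^ (2 * e)) f = q * t + rm t"
    by metis
  define R where "R = insert (formal_deriv f) (rm ` T)"
  have degR: "degree r < degree f" if rR: "r \<in> R" for r
  proof -
    consider "r = formal_deriv f" | t where "t \<in> T" "r = rm t" using rR unfolding R_def by blast
    then show ?thesis
    proof cases
      case 1
      then show ?thesis using degree_formal_deriv[OF f(2)] by simp
    next
      case 2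
      then show ?thesis using f(2) degT[of t] rm(2)[of t] by (intro degree_lessI) auto
    qed
  qed
  have "R \<subseteq> polys_over C" using dC rm(1) by (auto simp: R_def)
  then obtain K1 where K1: "K1 \<subseteq> C" "finite K1"
      "determines TYPE('a) TYPE('b) K1 ((F - {f}) \<union> R)"
    using IH[of R] finT degR by (auto simp: R_def)
  have "degree f0 < degree f"
    unfolding f0_def by (rule degree_lessI) (use f in \<open>auto simp: coeff_poly_cutoff\<close>)
  moreover have "f0 \<in> polys_over C" unfolding f0_def by (rule poly_cutoff_in_polys_over[OF C fC])
  ultimately obtain K0 where K0: "K0 \<subseteq> C" "finite K0"
      "determines TYPE('a) TYPE('b) K0 ((F - {f}) \<union> {f0})"
    using IH[of "{f0}"] by auto
  \<comment> \<open>With the coefficients included, \<open>\<phi>\<close> and \<open>\<psi>\<close>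
    annihilate the same ones, so that one truncation serves both fields.\<close>
  define K where "K = K0 \<union> K1 \<union> (\<Union>g\<in>insert f G. coeff g ` {..degree f})"
  have "K \<subseteq> C" using K0 K1 GC fC by (auto simp: K_def polys_over_def)
  moreover have "finite K" using K0 K1 finG by (simp add: K_def)
  moreover have "determines TYPE('a) TYPE('b) K F"
    unfolding determines_def
  proof (intro allI impI)
    fix \<phi> :: "'c \<Rightarrow> 'a" and \<psi> :: "'c \<Rightarrow> 'b"
    assume \<phi>: "comm_ring_hom \<phi>" and \<psi>: "comm_ring_hom \<psi>"
      and s: "\<forall>c\<in>K. same_sgn (\<phi> c) (\<psi> c)"
    interpret \<phi>: comm_ring_hom \<phi> by fact
    interpret \<psi>: comm_ring_hom \<psi> by fact
    have sc: "same_sgn (\<phi> (coeff g i)) (\<psi> (coeff g i))" if "g \<in> insert f G" for g i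
    proof (cases "i \<le> degree f")
      case True
      then show ?thesis using s that by (auto simp: K_def)
    next
      case False
      then have "coeff g i = 0" using that degG by (intro coeff_eq_0) fastforce
      then show ?thesis by (simp add: same_sgn_def)
    qed
    have sK0: "same_sgn (\<phi> c) (\<psi> c)" if "c \<in> K0" for c using s that by (simp add: K_def)
    have sK1: "same_sgn (\<phi> c) (\<psi> c)" if "c \<in> K1" for c using s that by (simp add: K_def)
    show "\<exists>H. matching H \<and> (\<forall>f\<in>F. matched H (map_poly \<phi> f) (map_poly \<psi> f))"
    proof (cases "\<phi> (lead_coeff f) = 0")
      case True
      then have "\<psi> (lead_coeff f) = 0" using sc[of f] by (auto simp: same_sgn_def)
      then have eq: "map_poly \<phi> f0 = map_poly \<phi> f" "map_poly \<psi> f0 = map_poly \<psi> f"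
        unfolding f0_def using True
        by (auto intro!: map_poly_cutoff \<phi> \<psi> simp: le_less coeff_eq_0)
      obtain H where H: "matching H"
          "\<forall>g\<in>(F - {f}) \<union> {f0}. matched H (map_poly \<phi> g) (map_poly \<psi> g)"
        using determinesD[OF K0(3) \<phi> \<psi> sK0] .
      have "matched H (map_poly \<phi> g) (map_poly \<psi> g)" if "g \<in> F" for g
        using H(2) that eq by (cases "g = f") auto
      then show ?thesis using H(1) by blast
    next
      case False
      obtain H where H: "matching H"
          "\<forall>g\<in>(F - {f}) \<union> R. matched H (map_poly \<phi> g) (map_poly \<psi> g)"
        using determinesD[OF K1(3) \<phi> \<psi> sK1] .
      have "\<exists>H. matching H \<and> (\<forall>g\<in>insert f G. matched H (map_poly \<phi> g) (map_poly \<psi> g))"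
      proof (rule matched_insert[OF \<phi> \<psi> H(1) _ f(2) _ False])
        show "matched H (map_poly \<phi> g) (map_poly \<psi> g)" if "g \<in> G" for g
          using H(2) that by (auto simp: G_def R_def)
        show "same_sgn (\<phi> (lead_coeff f)) (\<psi> (lead_coeff f))" using sc by simp
        show "formal_deriv f \<in> G" by (simp add: G_def)
      next
        fix g x x'
        assume g: "g \<in> G" "map_poly \<phi> g \<noteq> 0" "poly (map_poly \<phi> g) x = 0"
          "poly (map_poly \<psi> g) x' = 0" and x: "(x, x') \<in> H"
        \<comment> \<open>The cutoff falls just above the last coefficient of \<open>g\<close> that
          survives under \<open>\<phi>\<close>, which becomes the leading coefficient of
          \<open>t\<close>.\<close>
        define k where "k = Suc (degree (map_poly \<phi> g))"
        define t where "t = poly_cutoff k g"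
        have kf: "degree (map_poly \<phi> g) \<le> degree f"
          using degG[OF g(1)] degree_map_poly_le[of \<phi> g] by simp
        have tT: "t \<in> T" using g(1) kf by (auto simp: T_def t_def k_def)
        have van: "\<phi> (coeff g i) = 0" if "k \<le> i" for i
          using that coeff_eq_0[of "map_poly \<phi> g" i] by (simp add: k_def)
        have van': "\<psi> (coeff g i) = 0" if "k \<le> i" for i
          using sc[of g i] van[OF that] g(1) by (auto simp: same_sgn_def)
        have t\<phi>: "map_poly \<phi> t = map_poly \<phi> g" unfolding t_def by (rule map_poly_cutoff[OF \<phi> van])
        have t\<psi>: "map_poly \<psi> t = map_poly \<psi> g" unfolding t_def by (rule map_poly_cutoff[OF \<psi> van'])
        have ne: "\<phi> (coeff g (degree (map_poly \<phi> g))) \<noteq> 0"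
          using g(2) leading_coeff_0_iff[of "map_poly \<phi> g"] by simp
        have "degree t = degree (map_poly \<phi> g)"
        proof (rule antisym)
          show "degree t \<le> degree (map_poly \<phi> g)"
            by (rule degree_le) (auto simp: t_def coeff_poly_cutoff k_def)
          have "coeff t (degree (map_poly \<phi> g)) \<noteq> 0"
            using ne by (auto simp: t_def coeff_poly_cutoff k_def)
          then show "degree (map_poly \<phi> g) \<le> degree t" by (rule le_degree)
        qed
        then have lt: "lead_coeff t = coeff g (degree (map_poly \<phi> g))"
          by (simp add: t_def coeff_poly_cutoff k_def)
        have lt\<phi>: "\<phi> (lead_coeff t) \<noteq> 0" using ne lt by simp
        have lt\<psi>: "\<psi> (lead_coeff t) \<noteq> 0"
          using ne sc[of g "degree (map_poly \<phi> g)"] g(1) unfolding lt by (auto simp: same_sgn_def)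
        obtain e q where eq: "smult (lead_coeff t ^ (2 * e)) f = q * t + rm t"
          using rm(3)[OF tT] by blast
        have "same_sgn (poly (map_poly \<phi> f) x) (poly (map_poly \<phi> (rm t)) x)"
          by (rule sgn_at_root_by_remainder[OF \<phi> eq lt\<phi>]) (simp add: t\<phi> g)
        moreover have "same_sgn (poly (map_poly \<psi> f) x') (poly (map_poly \<psi> (rm t)) x')"
          by (rule sgn_at_root_by_remainder[OF \<psi> eq lt\<psi>]) (simp add: t\<psi> g)
        moreover have "same_sgn (poly (map_poly \<phi> (rm t)) x) (poly (map_poly \<psi> (rm t)) x')"
          using bspec[OF H(2), of "rm t"] tT matchingD[OF H(1) x] by (simp add: matched_def R_def)
        ultimately show "same_sgn (poly (map_poly \<phi> f) x) (poly (map_poly \<psi> f) x')"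
          by (simp add: same_sgn_def)
      qed
      then show ?thesis by (auto simp: G_def)
    qed
  qed
  ultimately show ?thesis by blast
qed

text \<open>The induction is on the maximal degree, then on the number of polynomials of that degree.\<close>

theorem finite_sign_determination:
  fixes C :: "'c::comm_ring_1 set"
  assumes C: "subring_set C" and F: "finite F" "F \<subseteq> polys_over C"
  shows "\<exists>K\<subseteq>C. finite K \<and> determines TYPE('a::real_closed) TYPE('b::real_closed) K F"
proof -
  have "\<exists>K\<subseteq>C. finite K \<and> determines TYPE('a::real_closed) TYPE('b::real_closed) K F"
    if "finite F" "F \<subseteq> polys_over C" "\<forall>f\<in>F. degree f \<le> D" for F D
    using that
  proof (induction D arbitrary: F)
    case 0
    \<comment> \<open>Constants need no points: for the empty matching each line is a single
      cell.\<close>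
    have "determines TYPE('a) TYPE('b) ((\<lambda>f. coeff f 0) ` F) F"
      unfolding determines_def
    proof (intro allI impI exI[of _ "{}"] conjI ballI)
      fix \<phi> :: "'c \<Rightarrow> 'a" and \<psi> :: "'c \<Rightarrow> 'b" and f
      assume "comm_ring_hom \<phi>" "comm_ring_hom \<psi>"
        and s: "\<forall>c\<in>(\<lambda>f. coeff f 0) ` F. same_sgn (\<phi> c) (\<psi> c)" and f: "f \<in> F"
      interpret \<phi>: comm_ring_hom \<phi> by fact
      interpret \<psi>: comm_ring_hom \<psi> by fact
      have "degree f = 0" using 0 f by auto
      then obtain c where c: "f = [:c:]" by (rule degree_eq_zeroE)
      then have "same_sgn (\<phi> c) (\<psi> c)" using s f by force
      then show "matched {} (map_poly \<phi> f) (map_poly \<psi> f)"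
        by (simp add: c map_poly_const \<open>comm_ring_hom \<phi>\<close> \<open>comm_ring_hom \<psi>\<close> matched_def)
    qed (simp add: matching_def)
    moreover have "(\<lambda>f. coeff f 0) ` F \<subseteq> C" using 0 by (auto simp: polys_over_def)
    ultimately show ?case using 0 by (intro exI[of _ "(\<lambda>f. coeff f 0) ` F"]) auto
  next
    case (Suc D)
    have "\<exists>K\<subseteq>C. finite K \<and> determines TYPE('a) TYPE('b) K F"
      if "finite F" "F \<subseteq> polys_over C" "\<forall>f\<in>F. degree f \<le> Suc D"
        "card {f \<in> F. degree f = Suc D} = n" for F n
      using that
    proof (induction n arbitrary: F)
      case 0
      then have "{f \<in> F. degree f = Suc D} = {}" by simp
      then have "\<forall>f\<in>F. degree f \<le> D" using 0 by (metis (mono_tags, lifting) empty_Collect_eq le_SucE)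
      then show ?case using Suc.IH 0 by blast
    next
      case (Suc n)
      then have "\<not> {f \<in> F. degree f = Suc D} \<subseteq> {}"
        by (metis card.empty nat.distinct(1) subset_empty)
      then obtain f where f: "f \<in> F" "degree f = Suc D" by auto
      show ?case
      proof (rule determines_step[OF C Suc.prems(1,2) f(1)])
        show "\<exists>K\<subseteq>C. finite K \<and> determines TYPE('a) TYPE('b) K (F - {f} \<union> R)"
          if R: "finite R" "R \<subseteq> polys_over C" "\<And>r. r \<in> R \<Longrightarrow> degree r < degree f" for R
        proof (rule Suc.IH)
          have *: "degree r \<le> D" if "r \<in> R" for r using R(3)[OF that] f(2) by simp
          then have "{g \<in> F - {f} \<union> R. degree g = Suc D} = {g \<in> F. degree g = Suc D} - {f}"
            by fastforce
          moreover have "card ({g \<in> F. degree g = Suc D} - {f}) = n"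
            using Suc.prems(4) f by (subst card_Diff_singleton) simp_all
          ultimately show "card {g \<in> F - {f} \<union> R. degree g = Suc D} = n" by simp
          show "\<forall>g\<in>F - {f} \<union> R. degree g \<le> Suc D"
          proof
            fix g assume "g \<in> F - {f} \<union> R"
            then show "degree g \<le> Suc D" using Suc.prems(3) *[of g] by (cases "g \<in> R") auto
          qed
        qed (use R Suc.prems in auto)
      qed (use f Suc.prems in auto)
    qed
    then show ?case using Suc.prems by blast
  qed
  then show ?thesis using F finite_imageI[OF F(1), of degree] by (metis Max_ge image_eqI)
qed

section \<open>Real closure of a formally real field\<close>

class formally_real_field = field +
  assumes sum_squares_ne_minus_one: "(\<Sum>i<(n::nat). f i * f i) \<noteq> - 1"

section \<open>Cones in a field and their extension\<close>

lemma mult_inverse_square: "s * (inverse s * inverse s) = inverse (s :: 'a::field)"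
  by (cases "s = 0") (simp_all flip: mult.assoc)

text \<open>A cone encodes a subfield of the ambient field, namely the set of its differences,
  together with a preordering of it: the condition on \<open>(x - y) * (x - y)\<close> puts the
  squares of this subfield into the cone. Enlarging a cone may refine the ordering, enlarge the
  subfield, or both.\<close>

definition cone :: "'a::field set \<Rightarrow> bool"
  where "cone P \<longleftrightarrow> 0 \<in> P \<and> 1 \<in> P \<and> - 1 \<notin> P \<and>
    (\<forall>x\<in>P. \<forall>y\<in>P. x + y \<in> P \<and> x * y \<in> P \<and> (x - y) * (x - y) \<in> P) \<and> (\<forall>x\<in>P. inverse x \<in> P)"

definition cone_field :: "'a::field set \<Rightarrow> 'a set"
  where "cone_field P = {x - y | x y. x \<in> P \<and> y \<in> P}"

context
  fixes P :: "'a::field set"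
  assumes P: "cone P"
begin

lemma coneD:
  "0 \<in> P" "1 \<in> P" "- 1 \<notin> P" "\<And>x y. x \<in> P \<Longrightarrow> y \<in> P \<Longrightarrow> x + y \<in> P"
  "\<And>x y. x \<in> P \<Longrightarrow> y \<in> P \<Longrightarrow> x * y \<in> P" "\<And>x. x \<in> P \<Longrightarrow> inverse x \<in> P"
  using P by (auto simp: cone_def)

lemma cone_antisym: "x \<in> P \<Longrightarrow> - x \<in> P \<Longrightarrow> x = 0"
  using coneD(5)[of "- x" "inverse x"] coneD(6)[of x] coneD(3) by (cases "x = 0") auto

lemma cone_field_square: "x \<in> cone_field P \<Longrightarrow> x * x \<in> P"
  using P by (auto simp: cone_field_def cone_def)

lemma cone_subset_field: "x \<in> P \<Longrightarrow> x \<in> cone_field P"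
  using coneD(1) unfolding cone_field_def by force

lemma cone_field_diff: "x \<in> cone_field P \<Longrightarrow> y \<in> cone_field P \<Longrightarrow> x - y \<in> cone_field P"
proof -
  assume "x \<in> cone_field P" "y \<in> cone_field P"
  then obtain a b c d where *: "a \<in> P" "b \<in> P" "c \<in> P" "d \<in> P" "x = a - b" "y = c - d"
    by (auto simp: cone_field_def)
  then have "x - y = (a + d) - (b + c)" by simp
  then show ?thesis using * coneD(4) unfolding cone_field_def by blast
qed

lemma cone_field_zero: "0 \<in> cone_field P" and cone_field_one: "1 \<in> cone_field P"
  using coneD(1,2) cone_subset_field by auto

lemma cone_field_minus: "x \<in> cone_field P \<Longrightarrow> - x \<in> cone_field P"
  using cone_field_diff[OF cone_field_zero] by simp

lemma cone_field_add: "x \<in> cone_field P \<Longrightarrow> y \<in> cone_field P \<Longrightarrow> x + y \<in> cone_field P"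
  using cone_field_diff[of x "- y"] cone_field_minus by simp

lemma cone_field_mult: "x \<in> cone_field P \<Longrightarrow> y \<in> cone_field P \<Longrightarrow> x * y \<in> cone_field P"
proof -
  assume "x \<in> cone_field P" "y \<in> cone_field P"
  then obtain a b c d where *: "a \<in> P" "b \<in> P" "c \<in> P" "d \<in> P" "x = a - b" "y = c - d"
    by (auto simp: cone_field_def)
  have "x * y = (a * c + b * d) - (a * d + b * c)" unfolding * by (simp add: algebra_simps)
  then show ?thesis using * coneD(4,5) unfolding cone_field_def by blast
qed

lemma cone_field_inverse:
  assumes "x \<in> cone_field P"
  shows "inverse x \<in> cone_field P"
proof (cases "x = 0")
  case False
  then have "inverse x = x * inverse (x * x)" by (simp add: field_simps)
  then show ?thesis
    using cone_field_mult[OF assms cone_subset_field[OF coneD(6)[OF cone_field_square[OF assms]]]]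
    by metis
qed (use cone_field_zero in simp)

text \<open>The classical extension \<open>P - x P\<close> of a preordering:
  \<open>- 1 = p - x * q\<close> would give \<open>x = (1 + p) / q \<in> P\<close>. The subfield
  stays the same because it contains \<open>x\<close>, so the squares required of the new cone are
  already in \<open>P\<close>.\<close>

lemma cone_extend:
  assumes x: "x \<in> cone_field P" "x \<notin> P"
  shows "\<exists>T. cone T \<and> P \<subseteq> T \<and> - x \<in> T"
proof -
  define T where "T = {p - x * q | p q. p \<in> P \<and> q \<in> P}"
  have TI: "p - x * q \<in> T" if "p \<in> P" "q \<in> P" for p q using that by (auto simp: T_def)
  have TF: "t \<in> cone_field P" if "t \<in> T" for t
    using that x(1) cone_subset_field cone_field_diff cone_field_mult unfolding T_def by blast
  have PT: "p \<in> T" if "p \<in> P" for p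
  proof -
    have "p = p - x * 0" by simp
    then show ?thesis using TI[OF that coneD(1)] by simp
  qed
  have mult: "s * t \<in> T" if st: "s \<in> T" "t \<in> T" for s t
  proof -
    obtain p q p' q' where *: "p \<in> P" "q \<in> P" "p' \<in> P" "q' \<in> P" "s = p - x * q" "t = p' - x * q'"
      using st by (auto simp: T_def)
    have "s * t = (p * p' + x * x * (q * q')) - x * (p * q' + q * p')"
      unfolding * by (simp add: algebra_simps)
    moreover have "p * p' + x * x * (q * q') \<in> P" "p * q' + q * p' \<in> P"
      using * cone_field_square[OF x(1)] by (simp_all add: coneD(4,5))
    ultimately show ?thesis using TI by simp
  qed
  have "cone T"
    unfolding cone_def
  proof (intro conjI ballI)
    show "0 \<in> T" "1 \<in> T" using PT coneD by auto
    show "- 1 \<notin> T"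
    proof
      assume "- 1 \<in> T"
      then obtain p q where *: "p \<in> P" "q \<in> P" "- 1 = p - x * q" by (auto simp: T_def)
      have xq: "x * q = 1 + p" using *(3) by (simp add: algebra_simps)
      show False
      proof (cases "q = 0")
        case True
        then have "p = - 1" using *(3) by (metis diff_zero mult_zero_right)
        then show ?thesis using *(1) coneD(3) by blast
      next
        case False
        then have "x = (1 + p) * inverse q" using xq by (simp add: field_simps)
        moreover have "(1 + p) * inverse q \<in> P"
          by (rule coneD(5)[OF coneD(4)[OF coneD(2) *(1)] coneD(6)[OF *(2)]])
        ultimately show ?thesis using x(2) by simp
      qed
    qed
    fix s assume s: "s \<in> T"
    then obtain p q where *: "p \<in> P" "q \<in> P" "s = p - x * q" by (auto simp: T_def)
    have "inverse s * inverse s \<in> P" using cone_field_square[OF cone_field_inverse[OF TF[OF s]]] .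
    then have "s * (inverse s * inverse s) \<in> T" by (rule mult[OF s PT])
    then show "inverse s \<in> T" by (simp only: mult_inverse_square)
  next
    fix s t assume st: "s \<in> T" "t \<in> T"
    show "s * t \<in> T" using mult[OF st] .
    obtain p q p' q' where *: "p \<in> P" "q \<in> P" "p' \<in> P" "q' \<in> P" "s = p - x * q" "t = p' - x * q'"
      using st by (auto simp: T_def)
    have "s + t = (p + p') - x * (q + q')" unfolding * by (simp add: algebra_simps)
    moreover have "(p + p') - x * (q + q') \<in> T" using * by (intro TI coneD(4))
    ultimately show "s + t \<in> T" by (simp only:)
    show "(s - t) * (s - t) \<in> T"
      using PT cone_field_square[OF cone_field_diff[OF TF[OF st(1)] TF[OF st(2)]]] by simp
  qed
  moreover have "- x \<in> T"
  proof -
    have "- x = 0 - x * 1" by simp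
    then show ?thesis using TI[OF coneD(1,2)] by simp
  qed
  ultimately show ?thesis using PT by blast
qed

end

definition maximal_cone :: "'a::field set \<Rightarrow> bool"
  where "maximal_cone M \<longleftrightarrow> cone M \<and> (\<forall>P. cone P \<longrightarrow> M \<subseteq> P \<longrightarrow> P = M)"

lemma maximal_cone_total:
  assumes "maximal_cone M" "x \<in> cone_field M"
  shows "x \<in> M \<or> - x \<in> M"
  using assms cone_extend[of M x] unfolding maximal_cone_def by blast

lemma maximal_cone_exists:
  assumes "cone P"
  shows "\<exists>M. maximal_cone M \<and> P \<subseteq> M"
proof -
  have "\<exists>M\<in>{Q. cone Q \<and> P \<subseteq> Q}. \<forall>Q\<in>{Q. cone Q \<and> P \<subseteq> Q}. M \<subseteq> Q \<longrightarrow> Q = M"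
  proof (rule subset_Zorn_nonempty)
    show "{Q. cone Q \<and> P \<subseteq> Q} \<noteq> {}" using assms by blast
  next
    fix \<C> assume ne: "\<C> \<noteq> {}" and ch: "subset.chain {Q. cone Q \<and> P \<subseteq> Q} \<C>"
    have C: "cone Q" "P \<subseteq> Q" if "Q \<in> \<C>" for Q
      using ch that by (auto simp: subset.chain_def)
    have common: "\<exists>Q\<in>\<C>. x \<in> Q \<and> y \<in> Q" if xy: "x \<in> \<Union>\<C>" "y \<in> \<Union>\<C>" for x y
    proof -
      obtain A B where AB: "A \<in> \<C>" "B \<in> \<C>" "x \<in> A" "y \<in> B" using xy by blast
      have "A \<subseteq> B \<or> B \<subseteq> A" using ch AB(1,2) unfolding subset_chain_def by blast
      then show ?thesis using AB by blast
    qed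
    have "cone (\<Union>\<C>)"
      unfolding cone_def
    proof (intro conjI ballI)
      obtain Q where Q: "Q \<in> \<C>" using ne by blast
      then show "0 \<in> \<Union>\<C>" "1 \<in> \<Union>\<C>" using coneD(1,2)[OF C(1)[OF Q]] by blast+
      show "- 1 \<notin> \<Union>\<C>" using coneD(3)[OF C(1)] by blast
      show "inverse x \<in> \<Union>\<C>" if x: "x \<in> \<Union>\<C>" for x
      proof -
        obtain Q where "Q \<in> \<C>" "x \<in> Q" using x by blast
        then show ?thesis using coneD(6)[OF C(1)] by blast
      qed
      fix x y assume xy: "x \<in> \<Union>\<C>" "y \<in> \<Union>\<C>"
      then obtain Q where Q: "Q \<in> \<C>" "x \<in> Q" "y \<in> Q" using common by blast
      have c: "cone Q" using C(1) Q(1) .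
      then have "x + y \<in> Q" "x * y \<in> Q" "(x - y) * (x - y) \<in> Q" using Q unfolding cone_def by blast+
      then show "x + y \<in> \<Union>\<C>" "x * y \<in> \<Union>\<C>" "(x - y) * (x - y) \<in> \<Union>\<C>" using Q(1) by blast+
    qed
    moreover have "P \<subseteq> \<Union>\<C>" using ne C(2) by blast
    ultimately show "\<Union>\<C> \<in> {Q. cone Q \<and> P \<subseteq> Q}" by blast
  qed
  then obtain M where M: "cone M" "P \<subseteq> M" "\<forall>Q\<in>{Q. cone Q \<and> P \<subseteq> Q}. M \<subseteq> Q \<longrightarrow> Q = M" by blast
  then have "Q = M" if "cone Q" "M \<subseteq> Q" for Q using that by blast
  then show ?thesis using M unfolding maximal_cone_def by blast
qed

section \<open>Sums of squares and the ordered field of a maximal cone\<close>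

inductive_set sums_of_squares :: "'a::comm_ring_1 set" where
  zero: "0 \<in> sums_of_squares"
| step: "s \<in> sums_of_squares \<Longrightarrow> x * x + s \<in> sums_of_squares"

lemma sums_of_squares_square: "x * x \<in> sums_of_squares"
  using sums_of_squares.step[OF sums_of_squares.zero, of x] by simp

lemma sums_of_squares_add:
  "s \<in> sums_of_squares \<Longrightarrow> t \<in> sums_of_squares \<Longrightarrow> s + t \<in> sums_of_squares"
  by (induction rule: sums_of_squares.induct) (auto simp: add.assoc intro: sums_of_squares.step)

lemma sums_of_squares_mult:
  assumes "s \<in> sums_of_squares" "t \<in> sums_of_squares"
  shows "s * t \<in> sums_of_squares"
proof -
  have sq: "x * x * t \<in> sums_of_squares" if "t \<in> sums_of_squares" for x t :: 'a
    using that
  proof induction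
    case (step s y)
    have "x * x * (y * y + s) = (x * y) * (x * y) + x * x * s" by (simp add: algebra_simps)
    then show ?case using sums_of_squares.step[OF step.IH] by simp
  qed (simp add: sums_of_squares.zero)
  show ?thesis
    using assms(1)
    by induction (auto simp: distrib_right intro: sums_of_squares.zero sums_of_squares_add sq assms(2))
qed

lemma sums_of_squares_iff_sum:
  "s \<in> sums_of_squares \<longleftrightarrow> (\<exists>n f. s = (\<Sum>i<n::nat. f i * f i))"
proof
  assume "s \<in> sums_of_squares"
  then show "\<exists>n f. s = (\<Sum>i<n::nat. f i * f i)"
  proof induction
    case zero
    show ?case by (intro exI[of _ 0]) simp
  next
    case (step s x)
    then obtain n f where s: "s = (\<Sum>i<n::nat. f i * f i)" by blast
    have "x * x + s = (\<Sum>i<Suc n. (f(n := x)) i * (f(n := x)) i)"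
      by (simp add: s add.commute)
    then show ?case by blast
  qed
next
  assume "\<exists>n f. s = (\<Sum>i<n::nat. f i * f i)"
  then obtain n f where s: "s = (\<Sum>i<n::nat. f i * f i)" by blast
  show "s \<in> sums_of_squares"
    unfolding s
    by (induction n) (auto intro: sums_of_squares.zero sums_of_squares_add sums_of_squares_square)
qed

lemma minus_one_not_sum_of_squares: "- 1 \<notin> (sums_of_squares :: 'a::formally_real_field set)"
  using sum_squares_ne_minus_one unfolding sums_of_squares_iff_sum by metis

text \<open>The starting cone is placed in the algebraic closure, where maximality leaves room for
  adjoining roots.\<close>

lemma cone_squares: "cone (to_ac ` (sums_of_squares :: 'a::formally_real_field set))"
  unfolding cone_def
proof (intro conjI ballI)
  show "0 \<in> to_ac ` (sums_of_squares :: 'a set)"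
    using sums_of_squares.zero by (intro image_eqI[of _ _ 0]) auto
  show "1 \<in> to_ac ` (sums_of_squares :: 'a set)"
    using sums_of_squares_square[of 1] by (intro image_eqI[of _ _ 1]) auto
  show "- 1 \<notin> to_ac ` (sums_of_squares :: 'a set)"
  proof
    assume "- 1 \<in> to_ac ` (sums_of_squares :: 'a set)"
    then obtain s :: 'a where s: "s \<in> sums_of_squares" "to_ac s = - 1" by force
    then have "to_ac s = to_ac (- 1)" by simp
    then have "s = - 1" by (simp only: to_ac_eq_iff)
    then show False using s minus_one_not_sum_of_squares by blast
  qed
  fix x :: "'a alg_closure" assume "x \<in> to_ac ` (sums_of_squares :: 'a set)"
  then obtain s :: 'a where s: "s \<in> sums_of_squares" "x = to_ac s" by blast
  have "s * (inverse s * inverse s) \<in> sums_of_squares"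
    using sums_of_squares_mult s(1) sums_of_squares_square by blast
  then have "inverse s \<in> sums_of_squares" by (simp only: mult_inverse_square)
  then show "inverse x \<in> to_ac ` (sums_of_squares :: 'a set)"
    using s by (intro image_eqI[of _ _ "inverse s"]) auto
next
  fix x y :: "'a alg_closure"
  assume "x \<in> to_ac ` (sums_of_squares :: 'a set)" "y \<in> to_ac ` (sums_of_squares :: 'a set)"
  then obtain s t :: 'a where s: "s \<in> sums_of_squares" "x = to_ac s" "t \<in> sums_of_squares" "y = to_ac t"
    by blast
  show "x + y \<in> to_ac ` (sums_of_squares :: 'a set)"
    using s sums_of_squares_add by (intro image_eqI[of _ _ "s + t"]) auto
  show "x * y \<in> to_ac ` (sums_of_squares :: 'a set)"
    using s sums_of_squares_mult by (intro image_eqI[of _ _ "s * t"]) auto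
  show "(x - y) * (x - y) \<in> to_ac ` (sums_of_squares :: 'a set)"
    using s sums_of_squares_square by (intro image_eqI[of _ _ "(s - t) * (s - t)"]) auto
qed

definition positive_cone :: "'a::formally_real_field alg_closure set"
  where "positive_cone = (SOME M. maximal_cone M \<and> to_ac ` sums_of_squares \<subseteq> M)"

lemma maximal_cone_positive_cone:
  "maximal_cone (positive_cone :: 'a::formally_real_field alg_closure set)"
  using someI_ex[OF maximal_cone_exists[OF cone_squares[where 'a = 'a]]]
  unfolding positive_cone_def by blast

lemma cone_positive_cone: "cone (positive_cone :: 'a::formally_real_field alg_closure set)"
  using maximal_cone_positive_cone unfolding maximal_cone_def by blast

lemma squares_subset_positive_cone:
  "to_ac ` (sums_of_squares :: 'a::formally_real_field set) \<subseteq> positive_cone"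
  using someI_ex[OF maximal_cone_exists[OF cone_squares[where 'a = 'a]]]
  unfolding positive_cone_def by blast

typedef (overloaded) ('a::formally_real_field) real_closure =
  "cone_field (positive_cone :: 'a alg_closure set)"
  using cone_field_zero[OF cone_positive_cone] by blast

setup_lifting type_definition_real_closure

instantiation real_closure :: (formally_real_field) linordered_field
begin

lift_definition zero_real_closure :: "'a real_closure" is 0
  by (rule cone_field_zero[OF cone_positive_cone])

lift_definition one_real_closure :: "'a real_closure" is 1
  by (rule cone_field_one[OF cone_positive_cone])

lift_definition plus_real_closure :: "'a real_closure \<Rightarrow> 'a real_closure \<Rightarrow> 'a real_closure" is "(+)"
  by (rule cone_field_add[OF cone_positive_cone])

lift_definition minus_real_closure :: "'a real_closure \<Rightarrow> 'a real_closure \<Rightarrow> 'a real_closure" is "(-)"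
  by (rule cone_field_diff[OF cone_positive_cone])

lift_definition uminus_real_closure :: "'a real_closure \<Rightarrow> 'a real_closure" is uminus
  by (rule cone_field_minus[OF cone_positive_cone])

lift_definition times_real_closure :: "'a real_closure \<Rightarrow> 'a real_closure \<Rightarrow> 'a real_closure" is "(*)"
  by (rule cone_field_mult[OF cone_positive_cone])

lift_definition inverse_real_closure :: "'a real_closure \<Rightarrow> 'a real_closure" is inverse
  by (rule cone_field_inverse[OF cone_positive_cone])

definition divide_real_closure :: "'a real_closure \<Rightarrow> 'a real_closure \<Rightarrow> 'a real_closure"
  where "divide_real_closure x y = x * inverse y"

lift_definition less_eq_real_closure :: "'a real_closure \<Rightarrow> 'a real_closure \<Rightarrow> bool"
  is "\<lambda>x y. y - x \<in> positive_cone" .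

definition less_real_closure :: "'a real_closure \<Rightarrow> 'a real_closure \<Rightarrow> bool"
  where "less_real_closure x y \<longleftrightarrow> x \<le> y \<and> x \<noteq> y"

definition abs_real_closure :: "'a real_closure \<Rightarrow> 'a real_closure"
  where "abs_real_closure x = (if x < 0 then - x else x)"

definition sgn_real_closure :: "'a real_closure \<Rightarrow> 'a real_closure"
  where "sgn_real_closure x = (if x = 0 then 0 else if 0 < x then 1 else - 1)"

instance
proof
  fix x y z :: "'a real_closure"
  show "x + y + z = x + (y + z)" "x + y = y + x" "0 + x = x" "- x + x = 0" "x - y = x + - y"
    "x * y * z = x * (y * z)" "x * y = y * x" "1 * x = x" "(x + y) * z = x * z + y * z"
    "x + y - x = y" "x - y - z = x - (y + z)" "0 * x = 0" "x * 0 = 0"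
    "inverse (0 :: 'a real_closure) = 0" "(0 :: 'a real_closure) \<noteq> 1"
    by (transfer, simp add: algebra_simps)+
  show "x \<noteq> 0 \<Longrightarrow> inverse x * x = 1" by transfer simp
  show "x div y = x * inverse y" by (simp add: divide_real_closure_def)
  have refl: "x \<le> x" for x :: "'a real_closure"
    by transfer (simp add: coneD(1)[OF cone_positive_cone])
  have antisym: "x = y" if "x \<le> y" "y \<le> x" for x y :: "'a real_closure"
    using that
  proof transfer
    fix x y :: "'a alg_closure"
    assume "y - x \<in> positive_cone" "x - y \<in> positive_cone"
    then show "x = y" using cone_antisym[OF cone_positive_cone, of "y - x"] by simp
  qed
  show "x \<le> x" by (rule refl)
  show "x \<le> y \<Longrightarrow> y \<le> x \<Longrightarrow> x = y" by (rule antisym)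
  show "x < y \<longleftrightarrow> x \<le> y \<and> \<not> y \<le> x"
    unfolding less_real_closure_def using refl antisym by metis
  show "x \<le> y \<Longrightarrow> y \<le> z \<Longrightarrow> x \<le> z"
  proof transfer
    fix x y z :: "'a alg_closure"
    assume "y - x \<in> positive_cone" "z - y \<in> positive_cone"
    then show "z - x \<in> positive_cone" using coneD(4)[OF cone_positive_cone, of "y - x" "z - y"] by simp
  qed
  show "x \<le> y \<or> y \<le> x"
  proof transfer
    fix x y :: "'a alg_closure"
    assume "x \<in> cone_field positive_cone" "y \<in> cone_field positive_cone"
    then show "y - x \<in> positive_cone \<or> x - y \<in> positive_cone"
      using maximal_cone_total[OF maximal_cone_positive_cone, of "y - x"]
        cone_field_diff[OF cone_positive_cone, of y x] by simp
  qed
  show "x \<le> y \<Longrightarrow> z + x \<le> z + y" by transfer simp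
  show "x < y \<Longrightarrow> 0 < z \<Longrightarrow> z * x < z * y"
    unfolding less_real_closure_def
  proof (transfer, safe)
    fix x y z :: "'a alg_closure"
    assume "y - x \<in> positive_cone" "z - 0 \<in> positive_cone"
    then show "z * y - z * x \<in> positive_cone"
      using coneD(5)[OF cone_positive_cone, of z "y - x"] by (simp add: right_diff_distrib)
  qed auto
  show "\<bar>x\<bar> = (if x < 0 then - x else x)" by (rule abs_real_closure_def)
  show "sgn x = (if x = 0 then 0 else if 0 < x then 1 else - 1)" by (rule sgn_real_closure_def)
qed

end

lemma comm_ring_hom_Rep_real_closure: "comm_ring_hom Rep_real_closure"
  by standard (simp_all add: zero_real_closure.rep_eq one_real_closure.rep_eq
      plus_real_closure.rep_eq times_real_closure.rep_eq)

text \<open>From \<open>4 x = (x + 1)^2 - (x - 1)^2\<close> the element \<open>x\<close> is a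
  difference of squares up to the factor 4. This factor is nonzero, for otherwise
  \<open>- 1 = 1 + 1 + 1\<close> would lie in the cone.\<close>

lemma to_ac_in_cone_field: "to_ac x \<in> cone_field (positive_cone :: 'a::formally_real_field alg_closure set)"
proof -
  let ?P = "positive_cone :: 'a alg_closure set"
  let ?four = "1 + 1 + 1 + 1 :: 'a alg_closure"
  note c = coneD[OF cone_positive_cone[where 'a = 'a]]
  have sq: "to_ac (y * y) \<in> ?P" for y :: 'a
    using squares_subset_positive_cone sums_of_squares_square by blast
  have "?four \<noteq> 0"
  proof
    assume "?four = 0"
    then have "- 1 = (1 + 1 + 1 :: 'a alg_closure)" by (simp add: eq_neg_iff_add_eq_0[symmetric])
    then show False using c(2-4) by metis
  qed
  moreover have "to_ac x * ?four = to_ac ((x + 1) * (x + 1)) - to_ac ((x - 1) * (x - 1))"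
    by (simp add: algebra_simps)
  ultimately have "to_ac x = (to_ac ((x + 1) * (x + 1)) - to_ac ((x - 1) * (x - 1))) * inverse ?four"
    by (metis mult.assoc mult.right_neutral right_inverse)
  moreover have "inverse ?four \<in> cone_field ?P"
    using c by (intro cone_subset_field[OF cone_positive_cone] c(6) c(4) c(2))
  moreover have "to_ac ((x + 1) * (x + 1)) - to_ac ((x - 1) * (x - 1)) \<in> cone_field ?P"
    using sq unfolding cone_field_def by blast
  ultimately show ?thesis using cone_field_mult[OF cone_positive_cone] by metis
qed

lift_definition to_rc :: "'a::formally_real_field \<Rightarrow> 'a real_closure" is to_ac
  by (rule to_ac_in_cone_field)

lemma comm_ring_hom_to_rc: "comm_ring_hom (to_rc :: 'a::formally_real_field \<Rightarrow> _)"
  by standard (transfer, simp)+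

lemma to_rc_eq_0_iff: "to_rc x = 0 \<longleftrightarrow> x = 0"
  by transfer simp

text \<open>Their values at an adjoined root are the candidate for a larger cone. The weights are
  carried along because nonnegative elements are not yet known to be squares.\<close>

inductive_set weighted_squares :: "'a::linordered_idom poly set" where
  zero: "0 \<in> weighted_squares"
| step: "\<lbrakk>0 \<le> c; s \<in> weighted_squares\<rbrakk> \<Longrightarrow> smult c (g * g) + s \<in> weighted_squares"

lemma weighted_squares_const: "0 \<le> c \<Longrightarrow> [:c:] \<in> weighted_squares"
  using weighted_squares.step[OF _ weighted_squares.zero, of c 1] by simp

lemma weighted_squares_square: "g * g \<in> weighted_squares"
  using weighted_squares.step[OF _ weighted_squares.zero, of 1 g] by simp

lemma weighted_squares_add:
  "s \<in> weighted_squares \<Longrightarrow> t \<in> weighted_squares \<Longrightarrow> s + t \<in> weighted_squares"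
  by (induction rule: weighted_squares.induct) (auto simp: add.assoc intro: weighted_squares.step)

lemma weighted_squares_mult:
  assumes "s \<in> weighted_squares" "t \<in> weighted_squares"
  shows "s * t \<in> weighted_squares"
proof -
  have sq: "smult c (g * g) * t \<in> weighted_squares" if "t \<in> weighted_squares" "0 \<le> c"
    for c g and t :: "'a poly"
    using that(1)
  proof induction
    case (step d s h)
    have "smult c (g * g) * (smult d (h * h) + s) =
        smult (c * d) ((g * h) * (g * h)) + smult c (g * g) * s"
      by (simp add: algebra_simps)
    then show ?case using weighted_squares.step[OF _ step.IH, of "c * d" "g * h"] step(1) that(2) by simp
  qed (simp add: weighted_squares.zero)
  show ?thesis
    using assms(1)
    by induction
      (auto simp: distrib_right intro: weighted_squares.zero weighted_squares_add sq[OF assms(2)]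
        simp del: mult_smult_left)
qed

lemma poly_weighted_squares_nonneg: "s \<in> weighted_squares \<Longrightarrow> 0 \<le> poly s x"
  by (induction rule: weighted_squares.induct) auto

text \<open>Each \<open>g\<close> is replaced by its remainder modulo \<open>f\<close>. The degree
  bound later forces the cofactor of \<open>f\<close> in a multiple \<open>1 + t\<close> to have
  smaller degree than \<open>f\<close>.\<close>

lemma weighted_squares_reduce:
  fixes f :: "'a::linordered_field poly"
  assumes "s \<in> weighted_squares" "degree f \<noteq> 0"
  shows "\<exists>t\<in>weighted_squares. f dvd s - t \<and> degree t \<le> 2 * (degree f - 1)"
  using assms(1)
proof induction
  case zero
  show ?case by (intro bexI[of _ 0]) (auto intro: weighted_squares.zero)
next
  case (step c s g)
  then obtain t where t: "t \<in> weighted_squares" "f dvd s - t" "degree t \<le> 2 * (degree f - 1)" by blast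
  define r where "r = g mod f"
  have "f dvd g - r" unfolding r_def by (simp add: dvd_minus_mod)
  then have "f dvd (g - r) * (g + r)" by simp
  then have "f dvd smult c ((g - r) * (g + r)) + (s - t)" using t by (intro dvd_add dvd_smult)
  also have "smult c ((g - r) * (g + r)) + (s - t) = (smult c (g * g) + s) - (smult c (r * r) + t)"
    by (simp add: algebra_simps smult_diff_right)
  finally have "f dvd (smult c (g * g) + s) - (smult c (r * r) + t)" .
  moreover have "smult c (r * r) + t \<in> weighted_squares"
    using weighted_squares.step[OF step(1) t(1)] .
  moreover have "degree r \<le> degree f - 1"
    using degree_mod_less[of f g] assms(2) unfolding r_def by (cases "f = 0") auto
  then have "degree (r * r) \<le> 2 * (degree f - 1)"
    using degree_mult_le[of r r] by linarith
  then have "degree (smult c (r * r) + t) \<le> 2 * (degree f - 1)"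
    using t(3) degree_smult_le[of c "r * r"] by (intro degree_add_le) linarith+
  ultimately show ?case by blast
qed

lemma poly_bezout:
  fixes p q :: "'a::field poly"
  shows "\<exists>u v. (u * p + v * q) dvd p \<and> (u * p + v * q) dvd q"
\<comment> \<open>The measure ranks the zero polynomial below the nonzero constants, which have the
  same degree, so that division by a constant decreases it as well.\<close>
proof (induction "if q = 0 then 0 else Suc (degree q)" arbitrary: p q rule: less_induct)
  case less
  show ?case
  proof (cases "q = 0")
    case True
    then show ?thesis by (intro exI[of _ 1] exI[of _ 0]) simp
  next
    case False
    then have "(if p mod q = 0 then 0 else Suc (degree (p mod q))) < (if q = 0 then 0 else Suc (degree q))"
      using degree_mod_less[of q p] by auto
    from less[OF this] obtain u v where uv: "(u * q + v * (p mod q)) dvd q"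
      "(u * q + v * (p mod q)) dvd (p mod q)" by blast
    have "u * q + v * (p mod q) = v * p + (u - v * (p div q)) * q"
      unfolding minus_div_mult_eq_mod[symmetric] by (simp add: algebra_simps)
    then show ?thesis using uv dvd_mod_imp_dvd[OF uv(2,1)] by metis
  qed
qed

lemma Rep_real_closure_eq_0_iff: "Rep_real_closure x = 0 \<longleftrightarrow> x = 0"
  using Rep_real_closure_inject[of x 0] by (simp add: zero_real_closure.rep_eq)

text \<open>A sign change of a polynomial without a root leads to an irreducible one, of which a root may
  be adjoined in the algebraic closure. The sums of squares of the extension, weighted by the cone, form a cone again, for otherwise a cofactor of
  smaller degree would change sign as well.\<close>

lemma real_closure_sign_change:
  fixes f :: "'a::formally_real_field real_closure poly"
  assumes ab: "a < b"
  shows "poly f a * poly f b < 0 \<Longrightarrow> \<exists>x. a < x \<and> x < b \<and> poly f x = 0"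
proof (induction "degree f" arbitrary: f rule: less_induct)
  case less
  show ?case
  proof (rule ccontr)
    assume no: "\<not> ?thesis"
    let ?P = "positive_cone :: 'a alg_closure set"
    interpret R: comm_ring_hom "Rep_real_closure :: 'a real_closure \<Rightarrow> _"
      by (rule comm_ring_hom_Rep_real_closure)
    interpret Rp: map_poly_comm_ring_hom "Rep_real_closure :: 'a real_closure \<Rightarrow> _" ..
    have f0: "f \<noteq> 0" using less.prems by auto
    have df: "degree f \<noteq> 0"
    proof
      assume "degree f = 0"
      then obtain c where "f = [:c:]" by (rule degree_eq_zeroE)
      then show False using less.prems by (simp add: mult_less_0_iff)
    qed
    \<comment> \<open>If a product changes sign, so does one of its factors. A factor of smaller
      degree then has a root by induction, and \<open>f\<close> would have it too.\<close>
    have irr: "degree g = 0 \<or> degree h = 0" if gh: "f = g * h" for g h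
    proof (rule ccontr)
      assume "\<not> ?thesis"
      moreover have "g \<noteq> 0" "h \<noteq> 0" using f0 gh by auto
      ultimately have dg: "degree g < degree f" "degree h < degree f"
        using gh by (simp_all add: degree_mult_eq)
      have "(poly g a * poly g b) * (poly h a * poly h b) < 0"
        using less.prems gh by (simp add: mult_ac)
      then have "poly g a * poly g b < 0 \<or> poly h a * poly h b < 0"
        by (auto simp: mult_less_0_iff zero_less_mult_iff)
      then show False using less.hyps[OF dg(1)] less.hyps[OF dg(2)] no gh by auto
    qed
    have coprime: "\<exists>u v c. c \<noteq> 0 \<and> u * f + v * g = [:c:]" if g: "\<not> f dvd g" for g
    proof -
      obtain u v where uv: "(u * f + v * g) dvd f" "(u * f + v * g) dvd g" using poly_bezout by blast
      then obtain k where k: "f = (u * f + v * g) * k" by (elim dvdE)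
      show ?thesis
      proof (cases "degree k = 0")
        case True
        then obtain c where c: "k = [:c:]" by (rule degree_eq_zeroE)
        have "f = smult c w" if "w = u * f + v * g" for w using k unfolding c that by simp
        then obtain w where w: "w = u * f + v * g" "f = smult c w" by blast
        then have "c \<noteq> 0" using f0 by auto
        then have "smult (inverse c) (smult c w) = w" by simp
        then have "smult (inverse c) f = w" using w(2) by simp
        then have "f dvd w" using dvd_smult[OF dvd_refl] by metis
        then have "f dvd (u * f + v * g)" using w(1) by simp
        then show ?thesis using g uv(2) dvd_trans by blast
      next
        case False
        then have "degree (u * f + v * g) = 0" using irr[OF k] by simp
        then obtain c where c: "u * f + v * g = [:c:]" by (rule degree_eq_zeroE)
        then have "c \<noteq> 0" using k f0 by auto
        then show ?thesis using c by blast
      qed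
    qed
    have "degree (map_poly Rep_real_closure f) = degree f"
      by (rule degree_map_poly) (simp add: Rep_real_closure_eq_0_iff)
    then obtain \<theta> where \<theta>: "poly (map_poly Rep_real_closure f) \<theta> = 0"
      using alg_closed_imp_poly_has_root[of "map_poly Rep_real_closure f"] df by auto
    define ev where "ev g = poly (map_poly Rep_real_closure g) \<theta>" for g :: "'a real_closure poly"
    have ev_add: "ev (g + h) = ev g + ev h" and ev_mult: "ev (g * h) = ev g * ev h"
      and ev_diff: "ev (g - h) = ev g - ev h" and ev_f: "ev f = 0" for g h
      using \<theta> by (simp_all add: ev_def hom_distribs)
    have ev_const: "ev [:c:] = Rep_real_closure c" for c
      by (simp add: ev_def map_poly_const R.comm_ring_hom_axioms)
    have ev_dvd: "ev g = 0" if "f dvd g" for g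
      using that ev_f by (elim dvdE) (simp add: ev_mult)
    have dvd_ev: "f dvd g" if g: "ev g = 0" for g
    proof (rule ccontr)
      assume "\<not> f dvd g"
      from coprime[OF this] obtain u v c where c: "c \<noteq> 0" "u * f + v * g = [:c:]" by blast
      have "ev (u * f + v * g) = Rep_real_closure c" unfolding c(2) by (rule ev_const)
      then have "Rep_real_closure c = 0" by (simp add: ev_add ev_mult ev_f g)
      then show False using \<open>c \<noteq> 0\<close> by (simp add: Rep_real_closure_eq_0_iff)
    qed
    define T where "T = ev ` weighted_squares"
    have sq: "ev g * ev g \<in> T" for g
      using weighted_squares_square[of g] unfolding T_def by (intro image_eqI[of _ _ "g * g"]) (auto simp: ev_mult)
    have T_add: "x + y \<in> T" if "x \<in> T" "y \<in> T" for x y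
      using that unfolding T_def by (auto simp flip: ev_add intro!: imageI weighted_squares_add)
    have T_mult: "x * y \<in> T" if "x \<in> T" "y \<in> T" for x y
      using that unfolding T_def by (auto simp flip: ev_mult intro!: imageI weighted_squares_mult)
    have PT: "x \<in> T" if x: "x \<in> ?P" for x
    proof -
      obtain c where c: "x = Rep_real_closure c"
        using cone_subset_field[OF cone_positive_cone x] by (metis Rep_real_closure_cases)
      have "0 \<le> c"
        unfolding less_eq_real_closure.rep_eq zero_real_closure.rep_eq using x by (simp add: c)
      then have "ev [:c:] \<in> T"
        unfolding T_def by (intro imageI weighted_squares_const)
      then show ?thesis by (simp only: ev_const c)
    qed
    have "cone T"
      unfolding cone_def
    proof (intro conjI ballI)
      show "0 \<in> T" "1 \<in> T" using PT coneD[OF cone_positive_cone] by auto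
      show "- 1 \<notin> T"
      proof
        assume "- 1 \<in> T"
        then obtain s where s: "s \<in> weighted_squares" "ev s = - 1" by (auto simp: T_def)
        obtain t where t: "t \<in> weighted_squares" "f dvd s - t" "degree t \<le> 2 * (degree f - 1)"
          using weighted_squares_reduce[OF s(1) df] by blast
        have "ev t = - 1" using ev_dvd[OF t(2)] s(2) by (simp add: ev_diff)
        then have "ev (1 + t) = 0" using ev_const[of 1] by (simp add: ev_add one_real_closure.rep_eq one_pCons)
        then obtain h where h: "1 + t = f * h" using dvd_ev by (metis dvdE)
        \<comment> \<open>Since \<open>f * h\<close> is positive everywhere, \<open>h\<close>
          changes sign along with \<open>f\<close>. Its degree is below that of \<open>f\<close>, so
          by induction it has a root, at which \<open>1 + t\<close> would vanish.\<close>
        have pos: "0 < poly (1 + t) x" for x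
          using poly_weighted_squares_nonneg[OF t(1), of x] by (simp add: add_pos_nonneg)
        have "1 + t \<noteq> 0" using pos[of 0] by (metis less_irrefl poly_0)
        then have "h \<noteq> 0" using h by auto
        have "degree (1 + t) \<le> 2 * (degree f - 1)"
          using t(3) by (intro degree_add_le) auto
        then have "degree h < degree f"
          using \<open>h \<noteq> 0\<close> f0 df unfolding h by (simp add: degree_mult_eq)
        moreover have "0 < (poly f a * poly h a) * (poly f b * poly h b)"
          using pos[of a] pos[of b] unfolding h by (simp add: mult_pos_pos)
        then have "0 < (poly f a * poly f b) * (poly h a * poly h b)" by (simp add: mult_ac)
        then have "\<not> 0 \<le> poly h a * poly h b"
          using mult_nonpos_nonneg[OF less_imp_le[OF less.prems], of "poly h a * poly h b"] by linarith
        then have "poly h a * poly h b < 0" by simp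
        ultimately obtain x where "poly h x = 0" using less.hyps by blast
        then show False using pos[of x] unfolding h by simp
      qed
      fix x assume x: "x \<in> T"
      then obtain s where s: "x = ev s" by (auto simp: T_def)
      show "inverse x \<in> T"
      proof (cases "x = 0")
        case True
        then show ?thesis using x by simp
      next
        case False
        \<comment> \<open>The Bezout relation exhibits the inverse of \<open>ev s\<close> as a value
          of \<open>ev\<close>, so the square of this inverse lies in \<open>T\<close>, and
          multiplying it by \<open>x\<close> gives the inverse itself.\<close>
        then have "\<not> f dvd s" using ev_dvd s by blast
        from coprime[OF this] obtain u v c where c: "c \<noteq> 0" "u * f + v * s = [:c:]"
          by (elim exE conjE)
        have "ev (u * f + v * s) = Rep_real_closure c" unfolding c(2) by (rule ev_const)
        then have "ev v * x = Rep_real_closure c" by (simp add: ev_add ev_mult ev_f s)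
        moreover have "ev [:inverse c:] * Rep_real_closure c = 1"
          unfolding ev_const using c(1)
          by (metis left_inverse one_real_closure.rep_eq times_real_closure.rep_eq)
        ultimately have "ev ([:inverse c:] * v) * x = 1" by (simp only: ev_mult mult.assoc)
        then have "inverse x = ev ([:inverse c:] * v)" by (metis inverse_unique mult.commute)
        then have "inverse x * inverse x \<in> T" using sq by metis
        then have "x * (inverse x * inverse x) \<in> T" by (rule T_mult[OF x])
        then show ?thesis by (simp only: mult_inverse_square)
      qed
    next
      fix x y assume xy: "x \<in> T" "y \<in> T"
      show "x + y \<in> T" "x * y \<in> T" using T_add T_mult xy by auto
      obtain s t where "x = ev s" "y = ev t" using xy by (auto simp: T_def)
      then show "(x - y) * (x - y) \<in> T" using sq[of "s - t"] by (simp add: ev_diff)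
    qed
    then have TP: "T = ?P"
      using maximal_cone_positive_cone PT unfolding maximal_cone_def by blast
    \<comment> \<open>By maximality the extension has produced no new positive elements. It remains
      to write \<theta> as a difference of elements of \<open>T\<close>, which is achieved by
      \<open>X = (X/2 + 1/2)^2 - (X/2 - 1/2)^2\<close>.\<close>
    define h where "h = [:0, 1 / 2 :: 'a real_closure:]"
    have "map_poly Rep_real_closure [:0, 1 :: 'a real_closure:] = [:0, 1:]"
      by (rule poly_eqI) (simp add: coeff_pCons split: nat.split)
    then have "\<theta> = ev [:0, 1:]" by (simp add: ev_def)
    moreover have "[:0, 1:] = (h + [:1 / 2:]) * (h + [:1 / 2:]) - (h - [:1 / 2:]) * (h - [:1 / 2:])"
      by (simp add: h_def)
    ultimately have "\<theta> = ev ((h + [:1 / 2:]) * (h + [:1 / 2:]) - (h - [:1 / 2:]) * (h - [:1 / 2:]))"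
      by (simp only:)
    also have "ev (p * p - q * q) \<in> cone_field T" for p q
      unfolding ev_diff ev_mult cone_field_def using sq[of p] sq[of q] by blast
    finally have "\<theta> \<in> cone_field ?P" by (simp only: TP)
    then obtain r where r: "\<theta> = Rep_real_closure r" by (rule Rep_real_closure_cases)
    have "Rep_real_closure (poly f r) = 0" using \<theta> unfolding r by simp
    then have "poly f r = 0" by (simp only: Rep_real_closure_eq_0_iff)
    then have "[:- r, 1:] dvd f" by (simp add: poly_eq_0_iff_dvd)
    then obtain k where k: "f = [:- r, 1:] * k" by (elim dvdE)
    then have "degree k = 0" using irr[OF k] by simp
    then obtain c where "k = [:c:]" by (rule degree_eq_zeroE)
    \<comment> \<open>The root \<open>r\<close> makes the irreducible \<open>f\<close> linear, and
      the sign change of a linear polynomial places \<open>r\<close> strictly between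
      \<open>a\<close> and \<open>b\<close>.\<close>
    then have "poly f x = (x - r) * c" for x using k by (simp add: algebra_simps)
    then have "((a - r) * (b - r)) * (c * c) < 0" using less.prems by (simp add: mult_ac)
    then have "(a - r) * (b - r) < 0"
      using zero_le_square[of c] by (meson leD mult_nonneg_nonneg not_le_imp_less)
    then have "a < r \<and> r < b" using ab by (auto simp: mult_less_0_iff)
    then show False using no \<open>poly f r = 0\<close> by blast
  qed
qed

instance real_closure :: (formally_real_field) real_closed
proof (rule real_closedI)
  fix p :: "'a real_closure poly" and a b
  assume "a < b" "poly p a < 0" "0 < poly p b"
  then show "\<exists>x. a < x \<and> x < b \<and> poly p x = 0"
    by (intro real_closure_sign_change) (auto simp: mult_less_0_iff)
qed

section \<open>The Artin-Lang theorem and the real Nullstellensatz\<close>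

definition real_prime_ideal :: "'a::comm_ring_1 set \<Rightarrow> bool"
  where "real_prime_ideal p \<longleftrightarrow> 0 \<in> p \<and> (\<forall>x\<in>p. \<forall>y\<in>p. x + y \<in> p) \<and> (\<forall>x\<in>p. \<forall>r. r * x \<in> p) \<and>
    1 \<notin> p \<and> (\<forall>x y. x * y \<in> p \<longrightarrow> x \<in> p \<or> y \<in> p) \<and>
    (\<forall>x s. s \<in> sums_of_squares \<longrightarrow> x * x + s \<in> p \<longrightarrow> x \<in> p)"

lemma real_prime_idealD:
  assumes "real_prime_ideal p"
  shows "0 \<in> p" "\<And>x y. x \<in> p \<Longrightarrow> y \<in> p \<Longrightarrow> x + y \<in> p" "\<And>x r. x \<in> p \<Longrightarrow> r * x \<in> p"
    "1 \<notin> p" "\<And>x y. x * y \<in> p \<Longrightarrow> x \<in> p \<or> y \<in> p"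
    "\<And>x s. s \<in> sums_of_squares \<Longrightarrow> x * x + s \<in> p \<Longrightarrow> x \<in> p"
  using assms unfolding real_prime_ideal_def by blast+

lemma real_prime_ideal_minus: "real_prime_ideal p \<Longrightarrow> x \<in> p \<Longrightarrow> - x \<in> p"
  using real_prime_idealD(3)[of p x "- 1"] by simp

lemma real_prime_ideal_diff: "real_prime_ideal p \<Longrightarrow> x \<in> p \<Longrightarrow> y \<in> p \<Longrightarrow> x - y \<in> p"
  using real_prime_idealD(2)[of p x "- y"] real_prime_ideal_minus[of p y] by simp

lemma comm_ring_hom_eval_rpoly: "comm_ring_hom (eval_rpoly a)"
  by standard (simp_all add: eval_rpoly_add eval_rpoly_mult)

text \<open>It shows that real prime ideals exist, so that the choice in
  \<open>critical_ideal\<close> is meaningful even if there is no counterexample.\<close>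

lemma real_prime_ideal_point:
  fixes a :: "'d::finite \<Rightarrow> real"
  shows "real_prime_ideal {f. eval_rpoly a f = 0}"
proof -
  have nn: "0 \<le> eval_rpoly a s" if "s \<in> sums_of_squares" for s
    using that by induction (simp_all add: eval_rpoly_add eval_rpoly_mult)
  have "eval_rpoly a x = 0"
    if "s \<in> sums_of_squares" "eval_rpoly a x * eval_rpoly a x + eval_rpoly a s = 0" for x s
    using nn[OF that(1)] that(2) by (simp add: add_nonneg_eq_0_iff)
  then show ?thesis
    unfolding real_prime_ideal_def by (auto simp: eval_rpoly_add eval_rpoly_mult)
qed

text \<open>The Nullstellensatz for \<open>p\<close> in finite form: only finitely many members have
  to vanish at the point, which is enough for finitely many matrices and avoids an appeal to
  Noetherianity.\<close>

definition has_real_points :: "'d::finite rpoly set \<Rightarrow> bool"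
  where "has_real_points p \<longleftrightarrow> (\<forall>F f. finite F \<longrightarrow> F \<subseteq> p \<longrightarrow> f \<notin> p \<longrightarrow>
    (\<exists>a. (\<forall>g\<in>F. eval_rpoly a g = 0) \<and> eval_rpoly a f \<noteq> 0))"

text \<open>A type cannot depend on a prime ideal, so the coordinate ring is only formed for one ideal,
  chosen once and for all to be a counterexample to the Nullstellensatz if there is any.\<close>

definition critical_ideal :: "'d::finite rpoly set"
  where "critical_ideal = (SOME p. real_prime_ideal p \<and>
    ((\<exists>q :: 'd rpoly set. real_prime_ideal q \<and> \<not> has_real_points q) \<longrightarrow> \<not> has_real_points p))"

lemma critical_ideal:
  "real_prime_ideal (critical_ideal :: 'd::finite rpoly set)"
  "real_prime_ideal (q :: 'd rpoly set) \<Longrightarrow> \<not> has_real_points q \<Longrightarrow>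
    \<not> has_real_points (critical_ideal :: 'd rpoly set)"
proof -
  have "\<exists>p :: 'd rpoly set. real_prime_ideal p \<and>
      ((\<exists>q :: 'd rpoly set. real_prime_ideal q \<and> \<not> has_real_points q) \<longrightarrow> \<not> has_real_points p)"
    using real_prime_ideal_point by blast
  from someI_ex[OF this]
  show "real_prime_ideal (critical_ideal :: 'd rpoly set)"
    "real_prime_ideal (q :: 'd rpoly set) \<Longrightarrow> \<not> has_real_points q \<Longrightarrow>
      \<not> has_real_points (critical_ideal :: 'd rpoly set)"
    unfolding critical_ideal_def by blast+
qed

quotient_type (overloaded) 'd coordinate_ring =
  "'d::finite rpoly" / "\<lambda>x y :: 'd rpoly. x - y \<in> critical_ideal"
proof (rule equivpI)
  note c = critical_ideal(1)[where 'd = 'd]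
  show "reflp (\<lambda>x y :: 'd rpoly. x - y \<in> critical_ideal)"
    by (rule reflpI) (simp add: real_prime_idealD(1)[OF c])
  show "symp (\<lambda>x y :: 'd rpoly. x - y \<in> critical_ideal)"
    by (rule sympI) (use real_prime_ideal_minus[OF c] in fastforce)
  show "transp (\<lambda>x y :: 'd rpoly. x - y \<in> critical_ideal)"
  proof (rule transpI)
    fix x y z :: "'d rpoly"
    assume "x - y \<in> critical_ideal" "y - z \<in> critical_ideal"
    from real_prime_idealD(2)[OF c this] show "x - z \<in> critical_ideal" by simp
  qed
qed

section \<open>The coordinate ring of the chosen ideal, its fraction field and its generic
  point\<close>

class formally_real_idom = idom +
  assumes sum_squares_eq_0: "(\<Sum>i<(n::nat). f i * f i) = 0 \<Longrightarrow> i < n \<Longrightarrow> f i = 0"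

instantiation coordinate_ring :: (finite) idom
begin

lift_definition zero_coordinate_ring :: "'a coordinate_ring" is 0 .

lift_definition one_coordinate_ring :: "'a coordinate_ring" is 1 .

lift_definition plus_coordinate_ring ::
  "'a coordinate_ring \<Rightarrow> 'a coordinate_ring \<Rightarrow> 'a coordinate_ring" is "(+)"
proof -
  fix a b c d :: "'a rpoly"
  assume "a - b \<in> critical_ideal" "c - d \<in> critical_ideal"
  from real_prime_idealD(2)[OF critical_ideal(1) this]
  show "a + c - (b + d) \<in> critical_ideal" by (simp add: algebra_simps)
qed

lift_definition minus_coordinate_ring ::
  "'a coordinate_ring \<Rightarrow> 'a coordinate_ring \<Rightarrow> 'a coordinate_ring" is "(-)"
proof -
  fix a b c d :: "'a rpoly"
  assume "a - b \<in> critical_ideal" "c - d \<in> critical_ideal"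
  from real_prime_ideal_diff[OF critical_ideal(1) this]
  show "a - c - (b - d) \<in> critical_ideal" by (simp add: algebra_simps)
qed

lift_definition uminus_coordinate_ring :: "'a coordinate_ring \<Rightarrow> 'a coordinate_ring" is uminus
proof -
  fix a b :: "'a rpoly"
  assume "a - b \<in> critical_ideal"
  from real_prime_ideal_minus[OF critical_ideal(1) this]
  show "- a - - b \<in> critical_ideal" by simp
qed

lift_definition times_coordinate_ring ::
  "'a coordinate_ring \<Rightarrow> 'a coordinate_ring \<Rightarrow> 'a coordinate_ring" is "(*)"
proof -
  fix a b c d :: "'a rpoly"
  assume "a - b \<in> critical_ideal" "c - d \<in> critical_ideal"
  then have "c * (a - b) + b * (c - d) \<in> critical_ideal"
    by (intro real_prime_idealD(2,3)[OF critical_ideal(1)])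
  then show "a * c - b * d \<in> critical_ideal" by (simp add: algebra_simps)
qed

lemma abs_coordinate_ring_eq_0_iff: "abs_coordinate_ring x = 0 \<longleftrightarrow> x \<in> critical_ideal"
  by (simp add: zero_coordinate_ring_def coordinate_ring.abs_eq_iff)

instance
proof
  fix x y z :: "'a coordinate_ring"
  note c = critical_ideal(1)[where 'd = 'a]
  show "x + y + z = x + (y + z)" "x + y = y + x" "0 + x = x" "- x + x = 0" "x - y = x + - y"
    "x * y * z = x * (y * z)" "x * y = y * x" "1 * x = x" "(x + y) * z = x * z + y * z"
    "0 * x = 0" "x * 0 = 0" "x * (y + z) = x * y + x * z"
    by (transfer, simp add: algebra_simps real_prime_idealD(1)[OF c])+
  show "(0 :: 'a coordinate_ring) \<noteq> 1"
    by transfer (use real_prime_ideal_minus[OF c, of "- 1"] real_prime_idealD(4)[OF c] in auto)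
  show "x \<noteq> 0 \<Longrightarrow> y \<noteq> 0 \<Longrightarrow> x * y \<noteq> 0"
    by transfer (use real_prime_idealD(5)[OF c] in auto)
qed

end

instance coordinate_ring :: (finite) formally_real_idom
proof
  fix n :: nat and f :: "nat \<Rightarrow> 'a coordinate_ring" and i
  assume s: "(\<Sum>i<n. f i * f i) = 0" and i: "i < n"
  define g where "g i = rep_coordinate_ring (f i)" for i
  have f: "f j = abs_coordinate_ring (g j)" for j
    unfolding g_def by (simp add: Quotient_abs_rep[OF Quotient_coordinate_ring])
  have sum: "(\<Sum>j<n. f j * f j) = abs_coordinate_ring (\<Sum>j<n. g j * g j)" for n
    by (induction n) (simp_all add: f zero_coordinate_ring_def plus_coordinate_ring.abs_eq times_coordinate_ring.abs_eq)
  then have "(\<Sum>j<n. g j * g j) \<in> critical_ideal" using s abs_coordinate_ring_eq_0_iff by metis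
  also have "(\<Sum>j<n. g j * g j) = g i * g i + (\<Sum>j\<in>{..<n} - {i}. g j * g j)"
    using i by (intro sum.remove) auto
  finally have *: "g i * g i + (\<Sum>j\<in>{..<n} - {i}. g j * g j) \<in> critical_ideal" .
  have "(\<Sum>j\<in>J. g j * g j) \<in> sums_of_squares" for J
    by (induction J rule: infinite_finite_induct)
      (auto intro: sums_of_squares.zero sums_of_squares_add sums_of_squares_square)
  from real_prime_idealD(6)[OF critical_ideal(1) this *]
  show "f i = 0" by (simp add: f abs_coordinate_ring_eq_0_iff)
qed

lemma comm_ring_hom_abs_coordinate_ring: "comm_ring_hom abs_coordinate_ring"
  by standard (simp_all add: zero_coordinate_ring_def one_coordinate_ring_def
      plus_coordinate_ring.abs_eq times_coordinate_ring.abs_eq)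

lemma common_denominator:
  fixes f :: "nat \<Rightarrow> 'a::idom fract"
  shows "\<exists>b g. b \<noteq> 0 \<and> (\<forall>i<n. f i = Fract (g i) b)"
proof (induction n)
  case 0
  show ?case by (intro exI[of _ 1]) simp
next
  case (Suc n)
  then obtain b g where bg: "b \<noteq> 0" "\<And>i. i < n \<Longrightarrow> f i = Fract (g i) b" by blast
  obtain c d where cd: "f n = Fract c d" "d \<noteq> 0" by (cases "f n") auto
  define h where "h i = (if i = n then c * b else g i * d)" for i
  have "f i = Fract (h i) (b * d)" if "i < Suc n" for i
    using that bg cd by (cases "i = n") (auto simp: h_def eq_fract)
  then show ?case using bg(1) cd(2) by (intro exI[of _ "b * d"] exI[of _ h]) auto
qed

instance fract :: (formally_real_idom) formally_real_field
proof
  fix n :: nat and f :: "nat \<Rightarrow> 'a fract"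
  show "(\<Sum>i<n. f i * f i) \<noteq> - 1"
  proof
    assume s: "(\<Sum>i<n. f i * f i) = - 1"
    obtain b g where bg: "b \<noteq> 0" "\<And>i. i < n \<Longrightarrow> f i = Fract (g i) b"
      using common_denominator[of n f] by blast
    have "(\<Sum>i<k. Fract (g i) b * Fract (g i) b) = Fract (\<Sum>i<k. g i * g i) (b * b)" for k
      using bg(1) by (induction k) (simp_all add: Zero_fract_def eq_fract distrib_right)
    then have "Fract (\<Sum>i<n. g i * g i) (b * b) = Fract (- 1) 1"
      using s bg(2) by (simp add: One_fract_def)
    \<comment> \<open>With the denominators cleared, the squares of the numerators and of
      \<open>b\<close> add up to 0, so \<open>b\<close> would have to vanish.\<close>
    then have "(\<Sum>i<n. g i * g i) + b * b = 0"
      using bg(1) by (simp add: eq_fract)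
    then have "(\<Sum>i<Suc n. (g(n := b)) i * (g(n := b)) i) = 0" by simp
    then have "(g(n := b)) n = 0" by (rule sum_squares_eq_0) simp
    then show False using bg(1) by simp
  qed
qed

text \<open>Evaluation at the tautological point whose coordinates are the classes of the variables:
  exactly the members of \<open>critical_ideal\<close> vanish there.\<close>

definition generic_point :: "'d::finite rpoly \<Rightarrow> 'd coordinate_ring fract real_closure"
  where "generic_point f = to_rc (Fract (abs_coordinate_ring f) 1)"

lemma comm_ring_hom_generic_point: "comm_ring_hom (generic_point :: 'd::finite rpoly \<Rightarrow> _)"
proof -
  interpret a: comm_ring_hom "abs_coordinate_ring :: 'd::finite rpoly \<Rightarrow> _"
    by (rule comm_ring_hom_abs_coordinate_ring)
  interpret r: comm_ring_hom "to_rc :: 'd coordinate_ring fract \<Rightarrow> _"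
    by (rule comm_ring_hom_to_rc)
  have fr: "Fract (x + y) 1 = Fract x 1 + Fract y 1" "Fract (x * y) 1 = Fract x 1 * Fract y 1"
    for x y :: "'d coordinate_ring" by simp_all
  show ?thesis
    by standard (simp_all add: generic_point_def fr a.hom_add a.hom_mult r.hom_add r.hom_mult flip: Zero_fract_def One_fract_def
        del: add_fract mult_fract)
qed

lemma generic_point_eq_0_iff: "generic_point f = 0 \<longleftrightarrow> f \<in> critical_ideal"
  by (simp add: generic_point_def to_rc_eq_0_iff abs_coordinate_ring_eq_0_iff Zero_fract_def eq_fract)

text \<open>The polynomials in the variables outside \<open>W\<close>, as a subring of the full
  ring. Elimination shrinks this subring, so that the type of polynomials stays fixed in the
  induction.\<close>

definition free_of :: "'d set \<Rightarrow> 'd rpoly set"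
  where "free_of W = {f. \<forall>e\<in>Poly_Mapping.keys f. \<forall>j\<in>W. Poly_Mapping.lookup e j = 0}"

lemma subring_set_free_of: "subring_set (free_of W)"
  unfolding subring_set_def
proof (intro conjI ballI)
  fix f g assume fg: "f \<in> free_of W" "g \<in> free_of W"
  show "f - g \<in> free_of W"
    using fg keys_diff[of f g] unfolding free_of_def by blast
  have "Poly_Mapping.lookup e j = 0" if ej: "e \<in> Poly_Mapping.keys (f * g)" "j \<in> W" for e j
  proof -
    obtain e1 e2 where "e = e1 + e2" "e1 \<in> Poly_Mapping.keys f" "e2 \<in> Poly_Mapping.keys g"
      using keys_mult[of f g] ej(1) by blast
    then show ?thesis using fg ej(2) by (simp add: free_of_def lookup_add)
  qed
  then show "f * g \<in> free_of W" by (simp add: free_of_def)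
qed (simp_all add: free_of_def)

lemma subring_set_sum:
  "subring_set C \<Longrightarrow> (\<And>x. x \<in> A \<Longrightarrow> f x \<in> C) \<Longrightarrow> sum f A \<in> C"
  by (induction A rule: infinite_finite_induct) (auto simp: subring_setD intro: subring_set_add)

text \<open>The exponent of variable \<open>i\<close> moves from the monomial to the outer degree.
  The coefficients keep the old type although they are free of that variable.\<close>

definition to_univariate :: "'d \<Rightarrow> 'd rpoly \<Rightarrow> 'd rpoly poly"
  where "to_univariate i f = (\<Sum>e\<in>Poly_Mapping.keys f.
    monom (Poly_Mapping.single (Poly_Mapping.update i 0 e) (Poly_Mapping.lookup f e))
      (Poly_Mapping.lookup e i))"

lemma to_univariate_in_polys_over:
  assumes "f \<in> free_of W"
  shows "to_univariate i f \<in> polys_over (free_of (insert i W))"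
proof -
  have "Poly_Mapping.single (Poly_Mapping.update i 0 e) (Poly_Mapping.lookup f e) \<in> free_of (insert i W)"
    if "e \<in> Poly_Mapping.keys f" for e
    using that assms by (auto simp: free_of_def lookup_update)
  then show ?thesis
    unfolding polys_over_def to_univariate_def coeff_sum mem_Collect_eq
    by (intro allI subring_set_sum[OF subring_set_free_of])
      (auto simp: subring_setD(1)[OF subring_set_free_of])
qed

lemma single_var_power:
  "(Poly_Mapping.single (Poly_Mapping.single i 1) 1 :: 'd rpoly) ^ k
    = Poly_Mapping.single (Poly_Mapping.single i k) 1"
proof (induction k)
  case (Suc k)
  have "Poly_Mapping.single i (1::nat) + Poly_Mapping.single i k = Poly_Mapping.single i (Suc k)"
    by (simp flip: single_add)
  then show ?case by (simp only: power_Suc Suc.IH mult_single mult_1)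
qed simp

lemma poly_to_univariate:
  "poly (to_univariate i f) (Poly_Mapping.single (Poly_Mapping.single i 1) 1) = f"
proof -
  have e: "Poly_Mapping.update i 0 e + Poly_Mapping.single i (Poly_Mapping.lookup e i) = e"
    for e :: "'a \<Rightarrow>\<^sub>0 nat"
    by (rule poly_mapping_eqI) (auto simp: lookup_add lookup_update lookup_single when_def)
  have "poly (to_univariate i f) (Poly_Mapping.single (Poly_Mapping.single i 1) 1)
      = (\<Sum>e\<in>Poly_Mapping.keys f. Poly_Mapping.single e (Poly_Mapping.lookup f e))"
    unfolding to_univariate_def poly_sum
    by (rule sum.cong[OF refl]) (simp only: poly_monom single_var_power mult_single e mult_1_right)
  also have "\<dots> = f"
    by (rule poly_mapping_eqI)
      (simp add: lookup_sum lookup_single when_def sum.delta in_keys_iff)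
  finally show ?thesis .
qed

lemma poly_eval_to_univariate:
  "poly (map_poly (eval_rpoly a) (to_univariate i f)) z = eval_rpoly (a(i := z)) f"
proof -
  interpret comm_ring_hom "eval_rpoly a" by (rule comm_ring_hom_eval_rpoly)
  interpret p: map_poly_comm_ring_hom "eval_rpoly a" ..
  have prod: "(\<Prod>j\<in>UNIV. a j ^ Poly_Mapping.lookup (Poly_Mapping.update i 0 e) j)
      * z ^ Poly_Mapping.lookup e i = (\<Prod>j\<in>UNIV. (a(i := z)) j ^ Poly_Mapping.lookup e j)"
    for e :: "'a \<Rightarrow>\<^sub>0 nat"
  proof -
    have "(\<Prod>j\<in>UNIV - {i}. a j ^ Poly_Mapping.lookup (Poly_Mapping.update i 0 e) j)
        = (\<Prod>j\<in>UNIV - {i}. (a(i := z)) j ^ Poly_Mapping.lookup e j)"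
      by (rule prod.cong) (auto simp: lookup_update)
    then show ?thesis
      by (subst (1 2) prod.remove[of UNIV i]) (simp_all add: lookup_update mult.commute)
  qed
  have "poly (map_poly (eval_rpoly a) (to_univariate i f)) z
      = (\<Sum>e\<in>Poly_Mapping.keys f. Poly_Mapping.lookup f e *
          ((\<Prod>j\<in>UNIV. a j ^ Poly_Mapping.lookup (Poly_Mapping.update i 0 e) j)
            * z ^ Poly_Mapping.lookup e i))"
    unfolding to_univariate_def
    by (simp add: p.hom_sum poly_sum poly_monom eval_rpoly_single mult.assoc)
  then show ?thesis unfolding prod by (simp only: eval_rpoly_def)
qed

text \<open>At each step the current conditions are read as univariate polynomials in one more
  variable, and the finitely many coefficient conditions from
  \<open>finite_sign_determination\<close> take their place.\<close>

lemma eliminate_variables: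
  fixes h :: "'d::finite rpoly \<Rightarrow> 'a::real_closed"
  assumes h: "comm_ring_hom h" and W: "finite W" and F: "finite F"
  shows "\<exists>G\<subseteq>free_of W. finite G \<and> (\<forall>a :: 'd \<Rightarrow> real. (\<forall>g\<in>G. same_sgn (h g) (eval_rpoly a g)) \<longrightarrow>
    (\<exists>b. \<forall>f\<in>F. same_sgn (h f) (eval_rpoly b f)))"
  using W
proof (induction W rule: finite_induct)
  case empty
  show ?case using F by (intro exI[of _ F]) (auto simp: free_of_def)
next
  case (insert i W)
  then obtain G where G: "G \<subseteq> free_of W" "finite G"
    "\<And>a :: 'd \<Rightarrow> real. (\<forall>g\<in>G. same_sgn (h g) (eval_rpoly a g)) \<Longrightarrow>
      (\<exists>b. \<forall>f\<in>F. same_sgn (h f) (eval_rpoly b f))"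
    by blast
  interpret comm_ring_hom h by fact
  have "finite (to_univariate i ` G)" "to_univariate i ` G \<subseteq> polys_over (free_of (insert i W))"
    using G(1,2) by (auto intro!: to_univariate_in_polys_over)
  from finite_sign_determination[OF subring_set_free_of this, where 'a = 'a and 'b = real]
  obtain K where K: "K \<subseteq> free_of (insert i W)" "finite K"
    "determines TYPE('a) TYPE(real) K (to_univariate i ` G)" by blast
  have "\<exists>b. \<forall>f\<in>F. same_sgn (h f) (eval_rpoly b f)"
    if s: "\<forall>g\<in>K. same_sgn (h g) (eval_rpoly a g)" for a
  proof -
    obtain H where H: "matching H" "\<forall>f\<in>to_univariate i ` G.
        matched H (map_poly h f) (map_poly (eval_rpoly a) f)"
      by (rule determinesD[OF K(3) h comm_ring_hom_eval_rpoly]) (use s in auto)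
    define x where "x = Poly_Mapping.single (Poly_Mapping.single i (1::nat)) (1::real)"
    \<comment> \<open>The variable has the value \<open>h x\<close> in the abstract field. A real
      number in the corresponding cell becomes the new coordinate \<open>i\<close> of the
      point.\<close>
    obtain z where z: "same_pos H (h x) z" using same_pos_exists[OF H(1)] by blast
    have "same_sgn (h g) (eval_rpoly (a(i := z)) g)" if g: "g \<in> G" for g
    proof -
      have "same_sgn (poly (map_poly h (to_univariate i g)) (h x))
          (poly (map_poly (eval_rpoly a) (to_univariate i g)) z)"
        using bspec[OF H(2) imageI[OF g]] z unfolding matched_def by blast
      moreover have "poly (map_poly h (to_univariate i g)) (h x) = h g"
        unfolding poly_map_poly x_def poly_to_univariate ..
      ultimately show ?thesis by (simp only: poly_eval_to_univariate)
    qed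
    then show ?thesis using G(3) by blast
  qed
  then show ?case using K(1,2) by blast
qed

text \<open>A positive real is both a square and a unit, so its image is a nonzero square. Thus
  \<open>h\<close> respects the order of the constants, although it is only assumed to be a ring
  homomorphism.\<close>

lemma same_sgn_real_const:
  fixes h :: "'d::finite rpoly \<Rightarrow> 'a::linordered_field"
  assumes "comm_ring_hom h"
  shows "same_sgn (h (Poly_Mapping.single 0 c)) c"
proof -
  interpret comm_ring_hom h by fact
  have pos: "0 < h (Poly_Mapping.single 0 c)" if "0 < c" for c
  proof -
    have "h (Poly_Mapping.single 0 c) = h (Poly_Mapping.single 0 (sqrt c)) * h (Poly_Mapping.single 0 (sqrt c))"
      using that by (simp add: mult_single flip: hom_mult)
    moreover have "h (Poly_Mapping.single 0 c) * h (Poly_Mapping.single 0 (inverse c)) = 1"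
      using that by (simp add: mult_single flip: hom_mult)
    then have "h (Poly_Mapping.single 0 c) \<noteq> 0" by auto
    ultimately show ?thesis by (metis less_le zero_le_square)
  qed
  have neg: "h (Poly_Mapping.single 0 c) = - h (Poly_Mapping.single 0 (- c))"
    by (simp add: single_uminus hom_uminus)
  consider "0 < c" | "c = 0" | "c < 0" by linarith
  then show ?thesis
  proof cases
    case 1
    then show ?thesis using pos[of c] by (auto simp: same_sgn_def)
  next
    case 2
    then show ?thesis by (simp add: same_sgn_def)
  next
    case 3
    then show ?thesis using pos[of "- c"] neg by (auto simp: same_sgn_def)
  qed
qed

text \<open>Once all variables are eliminated, the remaining conditions concern constants. They hold
  at every real point, for instance at the origin.\<close>

theorem artin_lang:
  fixes h :: "'d::finite rpoly \<Rightarrow> 'a::real_closed"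
  assumes h: "comm_ring_hom h" and F: "finite F"
  shows "\<exists>a :: 'd \<Rightarrow> real. \<forall>f\<in>F. same_sgn (h f) (eval_rpoly a f)"
proof -
  from eliminate_variables[OF h finite F, of UNIV]
  obtain G where G: "G \<subseteq> free_of UNIV" "finite G"
    "\<forall>a :: 'd \<Rightarrow> real. (\<forall>g\<in>G. same_sgn (h g) (eval_rpoly a g)) \<longrightarrow>
      (\<exists>b. \<forall>f\<in>F. same_sgn (h f) (eval_rpoly b f))"
    by (elim exE conjE)
  have "same_sgn (h g) (eval_rpoly (\<lambda>_. 0) g)" if g: "g \<in> G" for g
  proof -
    have "g \<in> free_of UNIV" using G(1) g by (rule subsetD)
    then have "\<forall>e\<in>Poly_Mapping.keys g. \<forall>j. Poly_Mapping.lookup e j = 0" by (simp add: free_of_def)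
    then have keys: "e = 0" if "e \<in> Poly_Mapping.keys g" for e
      using that by (intro poly_mapping_eqI) simp
    have g: "g = Poly_Mapping.single 0 (Poly_Mapping.lookup g 0)"
      using keys by (intro poly_mapping_eqI) (auto simp: lookup_single when_def in_keys_iff)
    show ?thesis
      by (subst (1 2) g) (simp only: same_sgn_real_const[OF h] eval_rpoly_const)
  qed
  then show ?thesis using G(3) by blast
qed

theorem real_nullstellensatz_prime:
  fixes p :: "'d::finite rpoly set"
  assumes p: "real_prime_ideal p" and F: "finite F" "F \<subseteq> p" and f: "f \<notin> p"
  shows "\<exists>a. (\<forall>g\<in>F. eval_rpoly a g = 0) \<and> eval_rpoly a f \<noteq> 0"
proof -
  have "has_real_points (critical_ideal :: 'd rpoly set)"
    unfolding has_real_points_def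
  proof (intro allI impI)
    fix F :: "'d rpoly set" and f :: "'d rpoly"
    assume F: "finite F" "F \<subseteq> critical_ideal" and f: "f \<notin> critical_ideal"
    obtain a :: "'d \<Rightarrow> real" where a: "\<forall>g\<in>insert f F. same_sgn (generic_point g) (eval_rpoly a g)"
      using artin_lang[OF comm_ring_hom_generic_point, of "insert f F"] F(1) by blast
    have "eval_rpoly a g = 0 \<longleftrightarrow> g \<in> critical_ideal" if "g \<in> insert f F" for g
      using same_sgn_zero[OF bspec[OF a that]] generic_point_eq_0_iff[of g] by simp
    then show "\<exists>a. (\<forall>g\<in>F. eval_rpoly a g = 0) \<and> eval_rpoly a f \<noteq> 0"
      using F f by blast
  qed
  then have "has_real_points p" using critical_ideal(2)[OF p] by blast
  then show ?thesis using F f unfolding has_real_points_def by blast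
qed

section \<open>Real submodules\<close>

text \<open>Vectors of length \<open>n\<close> are functions of which only the values below \<open>n\<close> matter.\<close>

definition submodule :: "(nat \<Rightarrow> 'a::comm_ring_1) set \<Rightarrow> bool"
  where "submodule N \<longleftrightarrow> (\<lambda>_. 0) \<in> N \<and> (\<forall>u\<in>N. \<forall>v\<in>N. \<forall>c d. (\<lambda>l. c * u l + d * v l) \<in> N)"

lemma submodule_zero: "submodule N \<Longrightarrow> (\<lambda>_. 0) \<in> N"
  by (simp add: submodule_def)

lemma submodule_comb:
  "submodule N \<Longrightarrow> u \<in> N \<Longrightarrow> v \<in> N \<Longrightarrow> (\<lambda>l. c * u l + d * v l) \<in> N"
  by (simp add: submodule_def)

lemma submodule_smult: "submodule N \<Longrightarrow> u \<in> N \<Longrightarrow> (\<lambda>l. c * u l) \<in> N"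
  using submodule_comb[of N u u c 0] by simp

text \<open>This is the separation of a vector from a subspace over the fraction field of the quotient
  by \<open>p\<close>, with all denominators cleared.\<close>

lemma separating_functional:
  fixes p :: "'a::comm_ring_1 set"
  assumes p: "real_prime_ideal p" and N: "submodule N"
    and sep: "\<And>s \<nu>. s \<notin> p \<Longrightarrow> \<nu> \<in> N \<Longrightarrow> \<exists>l<n. s * q l - \<nu> l \<notin> p"
  shows "\<exists>w. (\<forall>\<nu>\<in>N. (\<Sum>l<n. \<nu> l * w l) \<in> p) \<and> (\<Sum>l<n. q l * w l) \<notin> p"
  using N sep
proof (induction n arbitrary: N q)
  case 0
  then show ?case using real_prime_idealD(4)[OF p] submodule_zero by blast
next
  case (Suc n)
  show ?case
  proof (cases "\<forall>\<nu>\<in>N. \<nu> n \<in> p")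
    case True
    show ?thesis
    proof (cases "q n \<in> p")
      case qn: True
      have "\<exists>l<n. s * q l - \<nu> l \<notin> p" if "s \<notin> p" "\<nu> \<in> N" for s \<nu>
      proof -
        have "s * q n - \<nu> n \<in> p"
          using real_prime_ideal_diff[OF p real_prime_idealD(3)[OF p qn]] True that(2) by blast
        then show ?thesis using Suc.prems(2)[OF that] less_Suc_eq by metis
      qed
      from Suc.IH[OF Suc.prems(1) this] obtain w where
        w: "\<forall>\<nu>\<in>N. (\<Sum>l<n. \<nu> l * w l) \<in> p" "(\<Sum>l<n. q l * w l) \<notin> p" by blast
      then show ?thesis by (intro exI[of _ "w(n := 0)"]) simp
    next
      case False
      have "(\<Sum>l<Suc n. f l * (if l = n then 1 else 0)) = f n" for f :: "nat \<Rightarrow> 'a"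
        by simp
      then show ?thesis using True False by (intro exI[of _ "\<lambda>l. if l = n then 1 else 0"]) simp
    qed
  next
    case False
    then obtain \<nu>\<^sub>0 where \<nu>\<^sub>0: "\<nu>\<^sub>0 \<in> N" "\<nu>\<^sub>0 n \<notin> p" by blast
    define c where "c = \<nu>\<^sub>0 n"
    \<comment> \<open>Fraction-free Gaussian elimination with pivot \<open>c\<close>: entry
      \<open>n\<close> of \<open>el u\<close> is \<open>c * u n - u n * c = 0\<close>.\<close>
    define el where "el u = (\<lambda>l. c * u l + (- u n) * \<nu>\<^sub>0 l)" for u :: "nat \<Rightarrow> 'a"
    have el_comb: "el (\<lambda>l. a * u l + b * v l) = (\<lambda>l. a * el u l + b * el v l)" for a b u v
      by (simp add: el_def algebra_simps)
    have "submodule (el ` N)"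
      unfolding submodule_def
    proof (intro conjI ballI allI)
      have "el (\<lambda>_. 0) = (\<lambda>_. 0)" by (simp add: el_def)
      then show "(\<lambda>_. 0) \<in> el ` N" using submodule_zero[OF Suc.prems(1)] by (metis imageI)
    next
      fix u v a b assume "u \<in> el ` N" "v \<in> el ` N"
      then obtain u' v' where uv: "u' \<in> N" "v' \<in> N" "u = el u'" "v = el v'" by blast
      have "el (\<lambda>l. a * u' l + b * v' l) \<in> el ` N"
        using submodule_comb[OF Suc.prems(1) uv(1,2)] by (rule imageI)
      then show "(\<lambda>l. a * u l + b * v l) \<in> el ` N" by (simp only: el_comb uv)
    qed
    moreover have "\<exists>l<n. s * el q l - \<nu> l \<notin> p" if s: "s \<notin> p" "\<nu> \<in> el ` N" for s \<nu>
    proof -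
      obtain \<mu> where \<mu>: "\<mu> \<in> N" "\<nu> = el \<mu>" using s(2) by blast
      \<comment> \<open>The multiple of \<open>\<nu>\<^sub>0\<close> is chosen so that
        \<open>s * c * q - \<kappa>\<close> equals \<open>s * el q - el \<mu>\<close>, whose last
        entry is 0. The entry outside \<open>p\<close> must therefore have an index below
        \<open>n\<close>.\<close>
      define \<kappa> where "\<kappa> = (\<lambda>l. c * \<mu> l + (s * q n - \<mu> n) * \<nu>\<^sub>0 l)"
      have "\<kappa> \<in> N" unfolding \<kappa>_def by (rule submodule_comb[OF Suc.prems(1) \<mu>(1) \<nu>\<^sub>0(1)])
      moreover have "s * c \<notin> p" using real_prime_idealD(5)[OF p] s(1) \<nu>\<^sub>0(2) c_def by blast
      ultimately obtain l where l: "l < Suc n" "s * c * q l - \<kappa> l \<notin> p" using Suc.prems(2) by blast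
      have eq: "s * c * q l - \<kappa> l = s * el q l - \<nu> l"
        by (simp add: \<kappa>_def \<mu>(2) el_def algebra_simps)
      have "s * c * q n - \<kappa> n = 0" by (simp add: \<kappa>_def c_def algebra_simps)
      then have "l \<noteq> n" using l(2) real_prime_idealD(1)[OF p] by metis
      then show ?thesis using l eq by (intro exI[of _ l]) auto
    qed
    ultimately obtain w where w: "\<forall>\<nu>\<in>el ` N. (\<Sum>l<n. \<nu> l * w l) \<in> p" "(\<Sum>l<n. el q l * w l) \<notin> p"
      using Suc.IH[of "el ` N" "el q"] by blast
    \<comment> \<open>The transpose of the elimination applied to \<open>w\<close>: pairing any
      \<open>u\<close> with \<open>x\<close> gives the same value as pairing \<open>el u\<close>
      with \<open>w\<close>.\<close>
    define x where "x = (\<lambda>l. if l = n then - (\<Sum>i<n. \<nu>\<^sub>0 i * w i) else c * w l)"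
    have "(\<Sum>l<Suc n. u l * x l) = (\<Sum>l<n. el u l * w l)" for u
    proof -
      have "(\<Sum>l<n. el u l * w l) = (\<Sum>l<n. c * (u l * w l)) + (\<Sum>l<n. - u n * (\<nu>\<^sub>0 l * w l))"
        unfolding sum.distrib[symmetric] by (rule sum.cong[OF refl]) (simp add: el_def algebra_simps)
      also have "\<dots> = (\<Sum>l<n. u l * (c * w l)) + u n * - (\<Sum>l<n. \<nu>\<^sub>0 l * w l)"
        by (simp add: sum_distrib_left sum_negf mult_ac)
      also have "\<dots> = (\<Sum>l<Suc n. u l * x l)" by (simp add: x_def)
      finally show ?thesis ..
    qed
    then show ?thesis using w by (intro exI[of _ x]) simp
  qed
qed

text \<open>If the vectors \<open>r i\<close> are the rows of a matrix \<open>R\<close>, then the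
  hypothesis says that each row \<open>j\<close> of \<open>R\<^sup>T R\<close> lies in
  \<open>N\<close>. This is the condition on real left ideals, expressed by rows.\<close>

definition real_submodule :: "nat \<Rightarrow> (nat \<Rightarrow> 'a::comm_ring_1) set \<Rightarrow> bool"
  where "real_submodule n N \<longleftrightarrow> submodule N \<and>
    (\<forall>k r. (\<forall>j<n. (\<lambda>l. \<Sum>i<k. r i j * r i l) \<in> N) \<longrightarrow> (\<forall>i<k::nat. r i \<in> N))"

lemma real_submoduleD:
  assumes "real_submodule n N"
  shows "submodule N"
    "\<And>k r i. (\<And>j. j < n \<Longrightarrow> (\<lambda>l. \<Sum>i<k. r i j * r i l) \<in> N) \<Longrightarrow> i < (k::nat) \<Longrightarrow> r i \<in> N"
  using assms unfolding real_submodule_def by blast+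

text \<open>Zorn's lemma applies because each instance of the realness condition involves only the
  \<open>n\<close> rows of one Gram matrix, all of which lie in a single member of a chain.\<close>

lemma real_submodule_maximal:
  assumes N: "real_submodule n N" and q: "q \<notin> N"
  obtains M where "real_submodule n M" "N \<subseteq> M" "q \<notin> M"
    "\<forall>L. real_submodule n L \<longrightarrow> M \<subseteq> L \<longrightarrow> q \<notin> L \<longrightarrow> L = M"
proof -
  let ?S = "{L. real_submodule n L \<and> N \<subseteq> L \<and> q \<notin> L}"
  have "\<exists>M\<in>?S. \<forall>L\<in>?S. M \<subseteq> L \<longrightarrow> L = M"
  proof (rule subset_Zorn_nonempty)
    show "?S \<noteq> {}" using N q by blast
  next
    fix \<C> assume ne: "\<C> \<noteq> {}" and ch: "subset.chain ?S \<C>"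
    have C: "real_submodule n L" "N \<subseteq> L" "q \<notin> L" if "L \<in> \<C>" for L
      using ch that by (auto simp: subset.chain_def)
    have common: "\<exists>L\<in>\<C>. A \<subseteq> L" if "finite A" "A \<subseteq> \<Union>\<C>" for A
      using finite_subset_Union_chain[OF that ne ch] by blast
    have "real_submodule n (\<Union>\<C>)"
      unfolding real_submodule_def submodule_def
    proof (intro conjI ballI allI impI)
      obtain L where L: "L \<in> \<C>" using ne by blast
      have "(\<lambda>_. 0) \<in> L" using submodule_zero[OF real_submoduleD(1)[OF C(1)[OF L]]] .
      then show "(\<lambda>_. 0) \<in> \<Union>\<C>" using L by blast
    next
      fix u v c d assume "u \<in> \<Union>\<C>" "v \<in> \<Union>\<C>"
      then obtain L where L: "L \<in> \<C>" "u \<in> L" "v \<in> L" using common[of "{u, v}"] by auto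
      have "(\<lambda>l. c * u l + d * v l) \<in> L"
        using submodule_comb[OF real_submoduleD(1)[OF C(1)[OF L(1)]] L(2,3)] .
      then show "(\<lambda>l. c * u l + d * v l) \<in> \<Union>\<C>" using L(1) by blast
    next
      fix k r i
      assume r: "\<forall>j<n. (\<lambda>l. \<Sum>i<k. r i j * r i l) \<in> \<Union>\<C>" and i: "i < (k::nat)"
      have "(\<lambda>j. (\<lambda>l. \<Sum>i<k. r i j * r i l)) ` {..<n} \<subseteq> \<Union>\<C>" using r by blast
      then obtain L where L: "L \<in> \<C>" "(\<lambda>j. (\<lambda>l. \<Sum>i<k. r i j * r i l)) ` {..<n} \<subseteq> L"
        using common[OF finite_imageI[OF finite_lessThan]] by blast
      have "r i \<in> L" by (rule real_submoduleD(2)[OF C(1)[OF L(1)] _ i]) (use L(2) in blast)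
      then show "r i \<in> \<Union>\<C>" using L(1) by blast
    qed
    moreover have "N \<subseteq> \<Union>\<C>" "q \<notin> \<Union>\<C>" using ne C by blast+
    ultimately show "\<Union>\<C> \<in> ?S" by blast
  qed
  then obtain M where M: "real_submodule n M" "N \<subseteq> M" "q \<notin> M" "\<forall>L\<in>?S. M \<subseteq> L \<longrightarrow> L = M"
    by (elim bexE CollectE conjE)
  then have "\<forall>L. real_submodule n L \<longrightarrow> M \<subseteq> L \<longrightarrow> q \<notin> L \<longrightarrow> L = M" by auto
  with M(1-3) show ?thesis by (rule that)
qed

text \<open>A second multiplication by \<open>c\<close> turns the given rows into those of the Gram
  matrix of the vectors \<open>c r\<^sub>i\<close>.\<close>

lemma real_submodule_colon:
  assumes M: "real_submodule n M"
  shows "real_submodule n {u. (\<lambda>l. c * u l) \<in> M}"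
  unfolding real_submodule_def submodule_def mem_Collect_eq
proof (intro conjI ballI allI impI)
  note S = real_submoduleD(1)[OF M]
  show "(\<lambda>l. c * 0) \<in> M" using submodule_zero[OF S] by simp
  fix u v d e assume "u \<in> {u. (\<lambda>l. c * u l) \<in> M}" "v \<in> {u. (\<lambda>l. c * u l) \<in> M}"
  then have "(\<lambda>l. d * (c * u l) + e * (c * v l)) \<in> M" using submodule_comb[OF S] by blast
  then show "(\<lambda>l. c * (d * u l + e * v l)) \<in> M" by (simp add: algebra_simps)
next
  note S = real_submoduleD(1)[OF M]
  fix k r i assume r: "\<forall>j<n. (\<lambda>l. c * (\<Sum>i<k. r i j * r i l)) \<in> M" and i: "i < (k::nat)"
  have "(\<lambda>l. \<Sum>i<k. c * r i j * (c * r i l)) \<in> M" if "j < n" for j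
  proof -
    have "(\<lambda>l. c * (c * (\<Sum>i<k. r i j * r i l))) \<in> M"
      by (rule submodule_smult[OF S]) (use r that in blast)
    moreover have "(\<lambda>l. c * (c * (\<Sum>i<k. r i j * r i l))) = (\<lambda>l. \<Sum>i<k. c * r i j * (c * r i l))"
      by (simp add: sum_distrib_left mult_ac)
    ultimately show ?thesis by simp
  qed
  then show "(\<lambda>l. c * r i l) \<in> M" by (rule real_submoduleD(2)[OF M _ i])
qed

lemma real_submodule_separation:
  assumes N: "real_submodule n N" and q: "q \<notin> N"
  shows "\<exists>p w. real_prime_ideal p \<and> (\<forall>\<nu>\<in>N. (\<Sum>l<n. \<nu> l * w l) \<in> p) \<and> (\<Sum>l<n. q l * w l) \<notin> p"
proof -
  obtain M where M: "real_submodule n M" "N \<subseteq> M" "q \<notin> M"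
    and max: "\<forall>L. real_submodule n L \<longrightarrow> M \<subseteq> L \<longrightarrow> q \<notin> L \<longrightarrow> L = M"
    using real_submodule_maximal[OF N q] .
  note S = real_submoduleD(1)[OF M(1)]
  define p where "p = {c. (\<lambda>l. c * q l) \<in> M}"
  \<comment> \<open>For \<open>c\<close> outside \<open>p\<close> the submodule of all
    \<open>u\<close> with \<open>c u \<in> M\<close> still omits \<open>q\<close>, so maximality
    makes it equal to \<open>M\<close>. This cancellation makes \<open>p\<close> prime.\<close>
  have cancel: "u \<in> M" if c: "c \<notin> p" "(\<lambda>l. c * u l) \<in> M" for c u
  proof -
    have "M \<subseteq> {u. (\<lambda>l. c * u l) \<in> M}" using submodule_smult[OF S] by blast
    then have "{u. (\<lambda>l. c * u l) \<in> M} = M"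
      using c(1) by (intro max[rule_format] real_submodule_colon[OF M(1)]) (simp_all add: p_def)
    then show ?thesis using c(2) by blast
  qed
  have p: "real_prime_ideal p"
    unfolding real_prime_ideal_def
  proof (intro conjI ballI allI impI)
    show "0 \<in> p" using submodule_zero[OF S] by (simp add: p_def)
    show "1 \<notin> p" using M(3) by (simp add: p_def)
    show "x + y \<in> p" if "x \<in> p" "y \<in> p" for x y
      using submodule_comb[OF S, of "\<lambda>l. x * q l" "\<lambda>l. y * q l" 1 1] that
      by (simp add: p_def distrib_right)
    show "r * x \<in> p" if "x \<in> p" for x r
      using submodule_smult[OF S, of "\<lambda>l. x * q l" r] that by (simp add: p_def mult.assoc)
    show "x \<in> p \<or> y \<in> p" if "x * y \<in> p" for x y
      using cancel[of x "\<lambda>l. y * q l"] that by (auto simp: p_def mult.assoc)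
    fix x s assume "s \<in> sums_of_squares" and xs: "x * x + s \<in> p"
    then obtain k f where s: "s = (\<Sum>i<k::nat. f i * f i)" by (auto simp: sums_of_squares_iff_sum)
    \<comment> \<open>The vectors \<open>f\<^sub>i q\<close>, with \<open>x q\<close> placed at
      index \<open>k\<close>, have a Gram matrix whose row \<open>j\<close> is
      \<open>q\<^sub>j (x\<^sup>2 + s) q\<close>.\<close>
    define r where "r i = (\<lambda>l. (f(k := x)) i * q l)" for i
    have "(\<lambda>l. \<Sum>i<Suc k. r i j * r i l) \<in> M" for j
    proof -
      have "(\<Sum>i<Suc k. r i j * r i l) = q j * ((x * x + s) * q l)" for l
        by (simp add: r_def s algebra_simps sum_distrib_left)
      then show ?thesis
        using submodule_smult[OF S, of "\<lambda>l. (x * x + s) * q l" "q j"] xs by (simp add: p_def)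
    qed
    then have "r k \<in> M" by (rule real_submoduleD(2)[OF M(1), where k = "Suc k"]) simp_all
    then show "x \<in> p" by (simp add: r_def p_def)
  qed
  have sep: "\<exists>l<n. s * q l - \<nu> l \<notin> p" if s: "s \<notin> p" "\<nu> \<in> M" for s \<nu>
  proof (rule ccontr)
    assume "\<not> ?thesis"
    then have r: "s * q j - \<nu> j \<in> p" if "j < n" for j using that by blast
    \<comment> \<open>Row \<open>j\<close> of the Gram matrix of the single vector
      \<open>s q - \<nu>\<close>. Its factor \<open>s q\<^sub>j - \<nu>\<^sub>j\<close> lies in
      \<open>p\<close> and so carries \<open>q\<close> into \<open>M\<close>.\<close>
    have "(\<lambda>l. \<Sum>i<Suc 0. (s * q j - \<nu> j) * (s * q l - \<nu> l)) \<in> M" if "j < n" for j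
    proof -
      have "(\<lambda>l. s * ((s * q j - \<nu> j) * q l) + (- (s * q j - \<nu> j)) * \<nu> l) \<in> M"
        using r[OF that] s(2) by (intro submodule_comb[OF S]) (simp_all add: p_def)
      then show ?thesis by (simp add: algebra_simps)
    qed
    then have "(\<lambda>l. s * q l - \<nu> l) \<in> M"
      by (rule real_submoduleD(2)[OF M(1), where k = "Suc 0" and r = "\<lambda>_ l. s * q l - \<nu> l" and i = 0]) simp_all
    then have "(\<lambda>l. 1 * (s * q l - \<nu> l) + 1 * \<nu> l) \<in> M" using s(2) by (intro submodule_comb[OF S])
    then show False using s(1) by (simp add: p_def)
  qed
  have "\<exists>w. (\<forall>\<nu>\<in>M. (\<Sum>l<n. \<nu> l * w l) \<in> p) \<and> (\<Sum>l<n. q l * w l) \<notin> p"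
    by (rule separating_functional[OF p S]) (rule sep)
  then show ?thesis using p M(2) by blast
qed

theorem real_submodule_point:
  fixes N :: "(nat \<Rightarrow> 'd::finite rpoly) set"
  assumes N: "real_submodule n N" and F: "finite F" "F \<subseteq> N" and q: "q \<notin> N"
  shows "\<exists>a v. (\<forall>u\<in>F. (\<Sum>l<n. eval_rpoly a (u l) * v l) = 0) \<and> (\<Sum>l<n. eval_rpoly a (q l) * v l) \<noteq> 0"
proof -
  from real_submodule_separation[OF N q] obtain p w where p: "real_prime_ideal p"
    "\<forall>\<nu>\<in>N. (\<Sum>l<n. \<nu> l * w l) \<in> p" "(\<Sum>l<n. q l * w l) \<notin> p"
    by (elim exE conjE)
  have "(\<lambda>u. \<Sum>l<n. u l * w l) ` F \<subseteq> p" using p(2) F(2) by blast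
  from real_nullstellensatz_prime[OF p(1) finite_imageI[OF F(1)] this p(3)]
  obtain a where a: "\<forall>u\<in>F. eval_rpoly a (\<Sum>l<n. u l * w l) = 0" "eval_rpoly a (\<Sum>l<n. q l * w l) \<noteq> 0"
    by auto
  interpret comm_ring_hom "eval_rpoly a" by (rule comm_ring_hom_eval_rpoly)
  have "eval_rpoly a (\<Sum>l<n. u l * w l) = (\<Sum>l<n. eval_rpoly a (u l) * eval_rpoly a (w l))" for u
    by (simp add: hom_sum hom_mult)
  then show ?thesis using a by (intro exI[of _ a] exI[of _ "\<lambda>l. eval_rpoly a (w l)"]) simp
qed

section \<open>Real left ideals of matrices\<close>

text \<open>A row must become a square matrix before it can belong to the ideal, so it is stored as
  the first row. Left multiplication by matrix units moves rows to this place and back.\<close>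

definition row_mat :: "nat \<Rightarrow> (nat \<Rightarrow> 'a::zero) \<Rightarrow> 'a mat"
  where "row_mat n u = mat n n (\<lambda>(i, j). if i = 0 then u j else 0)"

definition matrix_unit :: "nat \<Rightarrow> nat \<Rightarrow> nat \<Rightarrow> 'a::{zero,one} mat"
  where "matrix_unit n k l = mat n n (\<lambda>(i, j). if i = k \<and> j = l then 1 else 0)"

lemma row_mat_carrier [simp]: "row_mat n u \<in> carrier_mat n n"
  by (simp add: row_mat_def)

lemma matrix_unit_carrier [simp]: "matrix_unit n k l \<in> carrier_mat n n"
  by (simp add: matrix_unit_def)

lemma matrix_unit_mult:
  fixes B :: "'a::comm_ring_1 mat"
  assumes "B \<in> carrier_mat n n" "l < n"
  shows "matrix_unit n k l * B = mat n n (\<lambda>(i, j). if i = k then B $$ (l, j) else 0)"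
proof (rule eq_matI)
  fix i j assume "i < dim_row (mat n n (\<lambda>(i, j). if i = k then B $$ (l, j) else 0))"
    "j < dim_col (mat n n (\<lambda>(i, j). if i = k then B $$ (l, j) else 0))"
  then have ij: "i < n" "j < n" by auto
  have "(matrix_unit n k l * B) $$ (i, j)
      = (\<Sum>x<n. (if i = k \<and> x = l then 1 else 0) * B $$ (x, j))"
    using assms ij by (simp add: matrix_unit_def scalar_prod_def atLeast0LessThan)
  also have "\<dots> = (\<Sum>x<n. if x = l then (if i = k then B $$ (x, j) else 0) else 0)"
    by (rule sum.cong) auto
  also have "\<dots> = (if i = k then B $$ (l, j) else 0)" using assms(2) by simp
  finally show "(matrix_unit n k l * B) $$ (i, j)
      = mat n n (\<lambda>(i, j). if i = k then B $$ (l, j) else 0) $$ (i, j)" using ij by simp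
qed (use assms in \<open>auto simp: matrix_unit_def\<close>)

lemma row_mat_row:
  fixes B :: "'a::comm_ring_1 mat"
  assumes "B \<in> carrier_mat n n" "l < n"
  shows "row_mat n (\<lambda>j. B $$ (l, j)) = matrix_unit n 0 l * B"
  unfolding matrix_unit_mult[OF assms] row_mat_def ..

lemma finsum_ring_mat:
  fixes f :: "'i \<Rightarrow> 'a::comm_ring_1 mat"
  assumes "finite A" "\<And>x. x \<in> A \<Longrightarrow> f x \<in> carrier_mat n n"
  shows "finsum (ring_mat TYPE('a) n b) f A \<in> carrier_mat n n \<and>
    (\<forall>i<n. \<forall>j<n. finsum (ring_mat TYPE('a) n b) f A $$ (i, j) = (\<Sum>x\<in>A. f x $$ (i, j)))"
proof -
  interpret ring "ring_mat TYPE('a) n b" by (rule ring_mat)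
  show ?thesis
    using assms
  proof (induction A rule: finite_induct)
    case empty
    then show ?case by (simp add: ring_mat_simps)
  next
    case (insert x A)
    then have "finsum (ring_mat TYPE('a) n b) f (insert x A) = f x + finsum (ring_mat TYPE('a) n b) f A"
      by (subst finsum_insert) (auto simp: ring_mat_simps)
    moreover have c: "finsum (ring_mat TYPE('a) n b) f A \<in> carrier_mat n n" using insert by simp
    ultimately show ?case using insert by (simp add: carrier_matD[OF c])
  qed
qed

text \<open>If \<open>S\<close> is the sum of the products
  \<open>B\<^sub>i\<^sup>T B\<^sub>i\<close>, then the squared lengths of the vectors
  \<open>B\<^sub>i(a) v\<close> add up to \<open>v\<^sup>T S(a) v\<close>. If
  \<open>S(a) v = 0\<close>, all these real vectors vanish.\<close>

lemma real_left_ideal_of_point: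
  fixes v :: "real vec" and a :: "'d::finite \<Rightarrow> real"
  assumes v: "v \<in> carrier_vec n"
  shows "real_left_ideal {B \<in> carrier_mat n n. eval_mat a B *\<^sub>v v = 0\<^sub>v n} (rpoly_mat_ring n) transpose_mat"
proof -
  let ?R = "rpoly_mat_ring n :: 'd rpoly mat ring"
  let ?I = "{B \<in> carrier_mat n n. eval_mat a B *\<^sub>v v = 0\<^sub>v n}"
  interpret e: comm_ring_hom "eval_rpoly a" by (rule comm_ring_hom_eval_rpoly)
  interpret involution_ring ?R transpose_mat by (rule involution_ring_mat)
  have hom_zero: "eval_mat a (0\<^sub>m n n) = 0\<^sub>m n n" by (rule eq_matI) auto
  have hom_add: "eval_mat a (x + y) = eval_mat a x + eval_mat a y"
    if "x \<in> carrier_mat n n" "y \<in> carrier_mat n n" for x y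
    using that by (intro eq_matI) (auto simp: e.hom_add)
  have "additive_subgroup ?I ?R"
  proof (intro additive_subgroup.intro subgroup.intro)
    show "?I \<subseteq> carrier (add_monoid ?R)" by (auto simp: ring_mat_simps)
    show "\<one>\<^bsub>add_monoid ?R\<^esub> \<in> ?I"
      using v by (auto simp: ring_mat_simps hom_zero)
  next
    fix x y assume xy: "x \<in> ?I" "y \<in> ?I"
    then show "x \<otimes>\<^bsub>add_monoid ?R\<^esub> y \<in> ?I"
      using v by (auto simp: ring_mat_simps hom_add add_mult_distrib_mat_vec[of _ n n])
  next
    fix x assume x: "x \<in> ?I"
    then have "\<ominus>\<^bsub>?R\<^esub> x = - x"
      by (intro minus_equality) (auto simp: ring_mat_simps uminus_l_inv_mat)
    then have "inv\<^bsub>add_monoid ?R\<^esub> x = - x" by (simp add: a_inv_def)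
    moreover have "map_mat (eval_rpoly a) (- x) = - map_mat (eval_rpoly a) x"
      by (rule eq_matI) (auto simp: e.hom_uminus)
    moreover have "- map_mat (eval_rpoly a) x *\<^sub>v v = - (map_mat (eval_rpoly a) x *\<^sub>v v)"
      using x v by (intro uminus_mult_mat_vec) auto
    ultimately show "inv\<^bsub>add_monoid ?R\<^esub> x \<in> ?I" using x by auto
  qed
  moreover have "left_ideal_axioms ?I ?R"
  proof
    fix x y assume x: "x \<in> ?I" and y: "y \<in> carrier ?R"
    then have "eval_mat a (y * x) *\<^sub>v v = eval_mat a y *\<^sub>v (eval_mat a x *\<^sub>v v)"
      using v by (auto simp: ring_mat_simps e.mat_hom_mult[of _ n n _ n] intro!: assoc_mult_mat_vec)
    then show "y \<otimes>\<^bsub>?R\<^esub> x \<in> ?I" using x y by (auto simp: ring_mat_simps)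
  qed
  moreover have "real_left_ideal_axioms ?I ?R transpose_mat"
  proof
    fix k :: nat and b i
    assume b: "\<And>i. i \<in> {1..k} \<Longrightarrow> b i \<in> carrier ?R"
      and s: "(\<Oplus>\<^bsub>?R\<^esub>i\<in>{1..k}. transpose_mat (b i) \<otimes>\<^bsub>?R\<^esub> b i) \<in> ?I" and i: "i \<in> {1..k}"
    have bc: "b i \<in> carrier_mat n n" if "i \<in> {1..k}" for i using b[OF that] by (simp add: ring_mat_simps)
    define S where "S = (\<Oplus>\<^bsub>?R\<^esub>i\<in>{1..k}. transpose_mat (b i) \<otimes>\<^bsub>?R\<^esub> b i)"
    have S: "S \<in> carrier_mat n n" "eval_mat a S *\<^sub>v v = 0\<^sub>v n" using s by (simp_all add: S_def)
    have bb: "transpose_mat (b i) * b i \<in> carrier_mat n n" if "i \<in> {1..k}" for i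
      using bc[OF that] by simp
    have entry: "S $$ (j, l) = (\<Sum>i\<in>{1..k}. \<Sum>x<n. b i $$ (x, j) * b i $$ (x, l))" if "j < n" "l < n" for j l
    proof -
      have "S $$ (j, l) = (\<Sum>i\<in>{1..k}. (transpose_mat (b i) * b i) $$ (j, l))"
        using finsum_ring_mat[where A = "{1..k}" and f = "\<lambda>i. transpose_mat (b i) * b i"
            and b = "()" and n = n] bb that by (simp add: S_def ring_mat_simps)
      also have "\<dots> = (\<Sum>i\<in>{1..k}. \<Sum>x<n. b i $$ (x, j) * b i $$ (x, l))"
      proof (rule sum.cong[OF refl])
        fix i assume "i \<in> {1..k}"
        then show "(transpose_mat (b i) * b i) $$ (j, l) = (\<Sum>x<n. b i $$ (x, j) * b i $$ (x, l))"
          using bc[of i] that by (simp add: scalar_prod_def atLeast0LessThan)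
      qed
      finally show ?thesis .
    qed
    define y where "y i x = (\<Sum>l<n. eval_rpoly a (b i $$ (x, l)) * v $ l)" for i x
    \<comment> \<open>\<open>y i x\<close> is entry \<open>x\<close> of
      \<open>B\<^sub>i(a) v\<close>. The chain exchanges the sums until the entries of
      \<open>S\<close> appear.\<close>
    have "(\<Sum>i\<in>{1..k}. \<Sum>x<n. y i x * y i x)
        = (\<Sum>i\<in>{1..k}. \<Sum>x<n. \<Sum>j<n. \<Sum>l<n. v $ j * (eval_rpoly a (b i $$ (x, j) * b i $$ (x, l)) * v $ l))"
      unfolding y_def sum_product by (intro sum.cong refl) (simp add: e.hom_mult mult_ac)
    also have "\<dots> = (\<Sum>i\<in>{1..k}. \<Sum>j<n. \<Sum>l<n. \<Sum>x<n. v $ j * (eval_rpoly a (b i $$ (x, j) * b i $$ (x, l)) * v $ l))"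
    proof (rule sum.cong[OF refl])
      fix i
      show "(\<Sum>x<n. \<Sum>j<n. \<Sum>l<n. v $ j * (eval_rpoly a (b i $$ (x, j) * b i $$ (x, l)) * v $ l))
        = (\<Sum>j<n. \<Sum>l<n. \<Sum>x<n. v $ j * (eval_rpoly a (b i $$ (x, j) * b i $$ (x, l)) * v $ l))"
        by (subst sum.swap) (intro sum.cong refl sum.swap)
    qed
    also have "\<dots> = (\<Sum>j<n. \<Sum>l<n. \<Sum>i\<in>{1..k}. \<Sum>x<n. v $ j * (eval_rpoly a (b i $$ (x, j) * b i $$ (x, l)) * v $ l))"
      by (subst sum.swap) (intro sum.cong refl sum.swap)
    also have "\<dots> = (\<Sum>j<n. v $ j * (\<Sum>l<n. eval_rpoly a (S $$ (j, l)) * v $ l))"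
    proof (rule sum.cong[OF refl])
      fix j assume j: "j \<in> {..<n}"
      have "(\<Sum>l<n. \<Sum>i\<in>{1..k}. \<Sum>x<n. v $ j * (eval_rpoly a (b i $$ (x, j) * b i $$ (x, l)) * v $ l))
          = (\<Sum>l<n. v $ j * (eval_rpoly a (S $$ (j, l)) * v $ l))"
        by (rule sum.cong[OF refl])
          (use j in \<open>simp only: entry lessThan_iff e.hom_sum sum_distrib_left sum_distrib_right\<close>)
      then show "(\<Sum>l<n. \<Sum>i\<in>{1..k}. \<Sum>x<n. v $ j * (eval_rpoly a (b i $$ (x, j) * b i $$ (x, l)) * v $ l))
          = v $ j * (\<Sum>l<n. eval_rpoly a (S $$ (j, l)) * v $ l)"
        by (simp only: sum_distrib_left)
    qed
    also have "\<dots> = (\<Sum>j<n. v $ j * (eval_mat a S *\<^sub>v v) $ j)"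
    proof (rule sum.cong[OF refl])
      fix j assume "j \<in> {..<n}"
      then show "v $ j * (\<Sum>l<n. eval_rpoly a (S $$ (j, l)) * v $ l) = v $ j * (eval_mat a S *\<^sub>v v) $ j"
        using S(1) v by (auto simp: scalar_prod_def atLeast0LessThan)
    qed
    also have "\<dots> = 0" by (simp add: S(2))
    finally have *: "(\<Sum>i\<in>{1..k}. \<Sum>x<n. y i x * y i x) = 0" .
    have "(\<Sum>x<n. y i x * y i x) = 0"
      using * i by (subst (asm) sum_nonneg_eq_0_iff) (auto intro: sum_nonneg)
    then have "y i x = 0" if "x < n" for x
      using that by (subst (asm) sum_nonneg_eq_0_iff) auto
    then have "eval_mat a (b i) *\<^sub>v v = 0\<^sub>v n"
      using bc[OF i] v by (intro eq_vecI) (auto simp: y_def scalar_prod_def atLeast0LessThan)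
    then show "b i \<in> ?I" using bc[OF i] by simp
  qed
  ultimately show ?thesis
    unfolding real_left_ideal_def left_ideal_def using ring_axioms involution_ring_axioms by (intro conjI)
qed

text \<open>For square matrices whose only nonzero row is the first, \<open>B\<^sup>T B\<close> is
  the Gram matrix of that row. Realness of the ideal thus becomes realness of the submodule of its
  rows.\<close>

lemma real_submodule_of_left_ideal:
  fixes I :: "'a::comm_ring_1 mat set"
  assumes I: "real_left_ideal I (ring_mat TYPE('a) n b) transpose_mat" and n: "1 \<le> n"
  shows "real_submodule n {u. row_mat n u \<in> I}"
    and "B \<in> carrier_mat n n \<Longrightarrow> B \<in> I \<longleftrightarrow> (\<forall>l<n. row_mat n (\<lambda>j. B $$ (l, j)) \<in> I)"
proof -
  let ?R = "ring_mat TYPE('a) n b"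
  interpret real_left_ideal I ?R transpose_mat by (rule I)
  have add: "x + y \<in> I" if "x \<in> I" "y \<in> I" for x y
    using additive_subgroup.a_closed[OF additive_subgroup_axioms that] by (simp add: ring_mat_simps)
  have mult: "x * y \<in> I" if "x \<in> carrier_mat n n" "y \<in> I" for x y
    using I_l_closed[OF that(2), of x] that(1) by (simp add: ring_mat_simps)
  have zero: "0\<^sub>m n n \<in> I" using additive_subgroup.zero_closed[OF additive_subgroup_axioms] by (simp add: ring_mat_simps)
  have rows: "B \<in> I \<longleftrightarrow> (\<forall>l<n. row_mat n (\<lambda>j. B $$ (l, j)) \<in> I)" if B: "B \<in> carrier_mat n n" for B
  proof
    assume "B \<in> I"
    then show "\<forall>l<n. row_mat n (\<lambda>j. B $$ (l, j)) \<in> I"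
      using row_mat_row[OF B] mult[OF matrix_unit_carrier] by simp
  next
    assume r: "\<forall>l<n. row_mat n (\<lambda>j. B $$ (l, j)) \<in> I"
    \<comment> \<open>\<open>B\<close> is assembled inside the ideal row by row, with
      \<open>k\<close> counting the rows already in place.\<close>
    have "mat n n (\<lambda>(i, j). if i < k then B $$ (i, j) else 0) \<in> I" if "k \<le> n" for k
      using that
    proof (induction k)
      case 0
      have "mat n n (\<lambda>(i, j). if i < 0 then B $$ (i, j) else 0) = 0\<^sub>m n n" by (rule eq_matI) auto
      then show ?case using zero by metis
    next
      case (Suc k)
      have "mat n n (\<lambda>(i, j). if i < Suc k then B $$ (i, j) else 0) =
          mat n n (\<lambda>(i, j). if i < k then B $$ (i, j) else 0)
          + matrix_unit n k 0 * row_mat n (\<lambda>j. B $$ (k, j))"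
        using n by (subst matrix_unit_mult) (auto simp: row_mat_def less_Suc_eq intro!: eq_matI)
      moreover have "matrix_unit n k 0 * row_mat n (\<lambda>j. B $$ (k, j)) \<in> I"
        using r Suc.prems by (intro mult) auto
      ultimately show ?case using add[OF Suc.IH] Suc.prems by simp
    qed
    from this[OF order.refl] have "mat n n (\<lambda>(i, j). if i < n then B $$ (i, j) else 0) \<in> I" .
    moreover have "mat n n (\<lambda>(i, j). if i < n then B $$ (i, j) else 0) = B"
      using B by (intro eq_matI) auto
    ultimately show "B \<in> I" by simp
  qed
  then show "B \<in> carrier_mat n n \<Longrightarrow> B \<in> I \<longleftrightarrow> (\<forall>l<n. row_mat n (\<lambda>j. B $$ (l, j)) \<in> I)" .
  show "real_submodule n {u. row_mat n u \<in> I}"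
    unfolding real_submodule_def submodule_def mem_Collect_eq
  proof (intro conjI ballI allI impI)
    have "row_mat n (\<lambda>_. 0) = (0\<^sub>m n n :: 'a mat)" by (rule eq_matI) (auto simp: row_mat_def)
    then show "row_mat n (\<lambda>_. 0) \<in> I" using zero by simp
  next
    fix u v c d assume uv: "u \<in> {u. row_mat n u \<in> I}" "v \<in> {u. row_mat n u \<in> I}"
    have "row_mat n (\<lambda>l. c * u l + d * v l) =
        (c \<cdot>\<^sub>m 1\<^sub>m n) * row_mat n u + (d \<cdot>\<^sub>m 1\<^sub>m n) * row_mat n v"
      by (subst (1 2) mult_smult_assoc_mat[of _ n n _ n])
        (auto simp: row_mat_def intro!: eq_matI)
    then show "row_mat n (\<lambda>l. c * u l + d * v l) \<in> I"
      using uv by (auto intro!: add mult)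
  next
    fix k r i
    assume r: "\<forall>j<n. row_mat n (\<lambda>l. \<Sum>i<k. r i j * r i l) \<in> I" and i: "i < (k::nat)"
    \<comment> \<open>The shift translates between families of matrices indexed from 1 and families
      of vectors indexed from 0.\<close>
    define B where "B i = row_mat n (r (i - 1))" for i
    define S where "S = (\<Oplus>\<^bsub>?R\<^esub>i\<in>{1..k}. transpose_mat (B i) \<otimes>\<^bsub>?R\<^esub> B i)"
    have B: "B i \<in> carrier_mat n n" for i by (simp add: B_def)
    have BB: "transpose_mat (B i) * B i \<in> carrier_mat n n" for i using B[of i] by simp
    have S: "S \<in> carrier_mat n n" and
      S_entry: "\<And>j l. j < n \<Longrightarrow> l < n \<Longrightarrow> S $$ (j, l) = (\<Sum>i\<in>{1..k}. (transpose_mat (B i) * B i) $$ (j, l))"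
      using finsum_ring_mat[where A = "{1..k}" and f = "\<lambda>i. transpose_mat (B i) * B i"
          and b = b and n = n] BB by (simp_all add: S_def ring_mat_simps)
    have entry: "S $$ (j, l) = (\<Sum>i<k. r i j * r i l)" if jl: "j < n" "l < n" for j l
    proof -
      have "(transpose_mat (B i) * B i) $$ (j, l) = r (i - 1) j * r (i - 1) l" for i
      proof -
        have "(transpose_mat (B i) * B i) $$ (j, l) = (\<Sum>x<n. B i $$ (x, j) * B i $$ (x, l))"
          using B[of i] jl by (simp add: scalar_prod_def atLeast0LessThan)
        also have "\<dots> = (\<Sum>x<n. if x = 0 then r (i - 1) j * r (i - 1) l else 0)"
          by (rule sum.cong) (use jl in \<open>auto simp: B_def row_mat_def\<close>)
        finally show ?thesis using n by simp
      qed
      then have "S $$ (j, l) = (\<Sum>i\<in>{1..k}. r (i - 1) j * r (i - 1) l)" using S_entry[OF jl] by simp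
      also have "\<dots> = (\<Sum>i<k. r i j * r i l)"
        by (rule sum.reindex_bij_witness[of _ Suc "\<lambda>i. i - 1"]) auto
      finally show ?thesis .
    qed
    have "row_mat n (\<lambda>j. S $$ (l, j)) = row_mat n (\<lambda>j. \<Sum>i<k. r i l * r i j)" if "l < n" for l
      using entry[OF that] by (auto simp: row_mat_def intro!: eq_matI)
    then have "S \<in> I" unfolding rows[OF S] using r by simp
    then have "B (Suc i) \<in> I"
      using i by (intro real[of k B "Suc i"]) (use \<open>S \<in> I\<close> B in \<open>auto simp: S_def ring_mat_simps\<close>)
    then show "row_mat n (r i) \<in> I" by (simp add: B_def)
  qed
qed

theorem theorem4:
  fixes n m :: nat
    and P :: "nat \<Rightarrow> 'd::finite rpoly mat" and Q :: "'d rpoly mat"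
  assumes "n \<ge> 1" and "m \<ge> 1"
    and "\<And>i. i \<in> {1..m} \<Longrightarrow> P i \<in> carrier_mat n n"
    and "Q \<in> carrier_mat n n"
  shows "(\<forall>a :: 'd \<Rightarrow> real. \<forall>v \<in> carrier_vec n.
            (\<forall>i\<in>{1..m}. eval_mat a (P i) *\<^sub>v v = 0\<^sub>v n) \<longrightarrow> eval_mat a Q *\<^sub>v v = 0\<^sub>v n)
         \<longleftrightarrow> Q \<in> smallest_real_left_ideal (rpoly_mat_ring n) transpose_mat (P ` {1..m})"
proof
  assume Q: "Q \<in> smallest_real_left_ideal (rpoly_mat_ring n) transpose_mat (P ` {1..m})"
  show "\<forall>a :: 'd \<Rightarrow> real. \<forall>v \<in> carrier_vec n.
      (\<forall>i\<in>{1..m}. eval_mat a (P i) *\<^sub>v v = 0\<^sub>v n) \<longrightarrow> eval_mat a Q *\<^sub>v v = 0\<^sub>v n"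
  proof (intro allI ballI impI)
    fix a :: "'d \<Rightarrow> real" and v :: "real vec"
    assume v: "v \<in> carrier_vec n" and P: "\<forall>i\<in>{1..m}. eval_mat a (P i) *\<^sub>v v = 0\<^sub>v n"
    have "P ` {1..m} \<subseteq> {B \<in> carrier_mat n n. eval_mat a B *\<^sub>v v = 0\<^sub>v n}" using P assms(3) by auto
    with real_left_ideal_of_point[OF v, of a]
    have "Q \<in> {B \<in> carrier_mat n n. eval_mat a B *\<^sub>v v = 0\<^sub>v n}"
      using Q unfolding smallest_real_left_ideal_def by blast
    then show "eval_mat a Q *\<^sub>v v = 0\<^sub>v n" by simp
  qed
next
  assume vanish: "\<forall>a :: 'd \<Rightarrow> real. \<forall>v \<in> carrier_vec n.
      (\<forall>i\<in>{1..m}. eval_mat a (P i) *\<^sub>v v = 0\<^sub>v n) \<longrightarrow> eval_mat a Q *\<^sub>v v = 0\<^sub>v n"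
  show "Q \<in> smallest_real_left_ideal (rpoly_mat_ring n) transpose_mat (P ` {1..m})"
    unfolding smallest_real_left_ideal_def
  proof (rule InterI, elim CollectE conjE, rule ccontr)
    fix I assume I: "real_left_ideal I (rpoly_mat_ring n) transpose_mat"
      and PI: "P ` {1..m} \<subseteq> I" and QI: "Q \<notin> I"
    note rows = real_submodule_of_left_ideal[OF I assms(1)]
    obtain l where l: "l < n" "row_mat n (\<lambda>j. Q $$ (l, j)) \<notin> I" using rows(2)[OF assms(4)] QI by blast
    define F where "F = (\<lambda>(k, i) j. P k $$ (i, j)) ` ({1..m} \<times> {..<n})"
    have "F \<subseteq> {u. row_mat n u \<in> I}"
    proof
      fix u assume "u \<in> F"
      then obtain k i where u: "k \<in> {1..m}" "i < n" "u = (\<lambda>j. P k $$ (i, j))" by (auto simp: F_def)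
      have "P k \<in> I" using PI u(1) by blast
      then show "u \<in> {u. row_mat n u \<in> I}" using rows(2)[OF assms(3)[OF u(1)]] u by simp
    qed
    moreover have "finite F" by (simp add: F_def)
    moreover have "(\<lambda>j. Q $$ (l, j)) \<notin> {u. row_mat n u \<in> I}" using l(2) by simp
    ultimately obtain a v where av: "\<forall>u\<in>F. (\<Sum>j<n. eval_rpoly a (u j) * v j) = 0"
        "(\<Sum>j<n. eval_rpoly a (Q $$ (l, j)) * v j) \<noteq> 0"
      using real_submodule_point[OF rows(1), of F "\<lambda>j. Q $$ (l, j)"] by blast
    have ev: "(eval_mat a B *\<^sub>v vec n v) $ i = (\<Sum>j<n. eval_rpoly a (B $$ (i, j)) * v j)"
      if "B \<in> carrier_mat n n" "i < n" for B i
      using that by (simp add: scalar_prod_def atLeast0LessThan)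
    have "eval_mat a (P k) *\<^sub>v vec n v = 0\<^sub>v n" if k: "k \<in> {1..m}" for k
    proof (rule eq_vecI)
      fix i assume "i < dim_vec (0\<^sub>v n :: real vec)"
      then have i: "i < n" by simp
      then have "(\<lambda>j. P k $$ (i, j)) \<in> F" using k by (force simp: F_def)
      then show "(eval_mat a (P k) *\<^sub>v vec n v) $ i = 0\<^sub>v n $ i"
        using av(1) ev[OF assms(3)[OF k] i] i by simp
    qed (use assms(3)[OF k] in simp)
    then have "eval_mat a Q *\<^sub>v vec n v = 0\<^sub>v n" using vanish by simp
    then have "(eval_mat a Q *\<^sub>v vec n v) $ l = 0" using l(1) by simp
    then show False using av(2) ev[OF assms(4) l(1)] by simp
  qed
qed

end
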